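(* Let $T\in\mathcal T_h^b$, let $e\in\mathcal E_h^b$ be the boundary edge of $T$, and let $\tilde u_h$ on $T$ be the linear extension of $u_h^*$ (as defined in the context). Assume $g|_e\in H^1(e)$. Then $$\|\nabla(\tilde u_h-u_h)\|_{L^2(T)}\le C\,h_e^{1/2}\,\|g'-g_h'\|_{L^2(e)},$$ where $C$ is a positive constant depending only on the shape-regularity of $\mathcal T_h$ (in particular independent of $T$), and $g'$ (resp. $g_h'$) denotes the tangential derivative of $g$ (resp. $g_h$) along $e$.
   Context: $\Omega\subset\mathbb R^2$ is a bounded polygonal domain (without slits); $(\cdot,\cdot)$ is the $L^2(\Omega)$ inner product; $f\in L^2(\Omega)$; $g\in C(\partial\Omega)$ is the trace of some $H^1(\Omega)$ function; $\chi\in C(\bar\Omega)\cap H^1(\Omega)$ satisfies $\chi|_{\partial\Omega}\le g$; $a(v,w)=(\nabla v,\nabla w)$. Mesh. $\mathcal T_h$ is a conforming (no hanging nodes), shape-regular triangulation of $\Omega$ into closed triangles (all angles at least a fixed $\theta_0>0$). $\mathcal V_h^i,\mathcal V_h^b$ are the sets of vertices in $\Omega$ and on $\partial\Omega$; $\mathcal E_h^b$ is the set of boundary edges; $h_e$ is the length of $e$. $\mathcal T_h^b$ is the set of triangles having an edge in $\mathcal E_h^b$; each $T\in\mathcal T_h^b$ is assumed to have at most one edge on $\partial\Omega$. Discrete problem. $V_h=\{v\in H^1(\Omega):v|_T\in\mathbb P_1(T)\ \forall T\in\mathcal T_h\}$. $g_h\in C(\partial\Omega)$ is the piecewise affine (on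 each $e\in\mathcal E_h^b$) nodal interpolant of $g$ at $\mathcal V_h^b$. $\mathcal K_h=\{v_h\in V_h: v_h(z)\ge\chi(z)\ \forall z\in\mathcal V_h^i,\ v_h=g_h\text{ on }\partial\Omega\}$. $u_h\in\mathcal K_h$ is the unique solution of $a(u_h,v_h-u_h)\ge(f,v_h-u_h)$ for all $v_h\in\mathcal K_h$. Linear extension. For $T\in\mathcal T_h^b$ define $u_h^*\in C(\partial T)$ by $u_h^*=g$ on $\partial T\cap\partial\Omega$ and $u_h^*=u_h$ on $\partial T\setminus\partial\Omega$. For $z$ in the interior of $T$ let $\ell$ be the line through $z$ orthogonal to $e$, let $z_1$ and $z_2$ be the points of intersection of $\ell$ with $\partial T$, $z_1$ being the one on $e$, and let $h_1=|z-z_1|$, $h_2=|z-z_2|$; set $\tilde u_h(z)=\frac{h_2u_h^*(z_1)+h_1u_h^*(z_2)}{h_1+h_2}$. *)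

theory Defs
  imports "HOL-Analysis.Analysis"
begin

definition in_L2 :: "'a::euclidean_space set \<Rightarrow> ('a \<Rightarrow> 'b::real_normed_vector) \<Rightarrow> bool" where
  "in_L2 S u \<longleftrightarrow> u \<in> borel_measurable (lebesgue_on S)
     \<and> integrable (lebesgue_on S) (\<lambda>x. (norm (u x))\<^sup>2)"

definition L2_nrm :: "'a::euclidean_space set \<Rightarrow> ('a \<Rightarrow> 'b::real_normed_vector) \<Rightarrow> real" where
  "L2_nrm S u = sqrt (integral\<^sup>L (lebesgue_on S) (\<lambda>x. (norm (u x))\<^sup>2))"

text \<open>\<open>C_times k f\<close>: all partial derivatives of \<open>f\<close> of order at most \<open>k\<close> exist and are continuous
  on the whole space (for \<open>j < k\<close>, the derivatives of order \<open>j\<close> are Frechet differentiable).\<close>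

fun C_times :: "nat \<Rightarrow> ('a::euclidean_space \<Rightarrow> real) \<Rightarrow> bool" where
  "C_times 0 f \<longleftrightarrow> continuous_on UNIV f"
| "C_times (Suc k) f \<longleftrightarrow> (\<forall>x. f differentiable (at x))
     \<and> (\<forall>v. C_times k (\<lambda>x. frechet_derivative f (at x) v))"

definition smooth :: "('a::euclidean_space \<Rightarrow> real) \<Rightarrow> bool" where
  "smooth f \<longleftrightarrow> (\<forall>k. C_times k f)"

definition test_function :: "'a::euclidean_space set \<Rightarrow> ('a \<Rightarrow> real) \<Rightarrow> bool" where
  "test_function S \<phi> \<longleftrightarrow> smooth \<phi> \<and> compact (closure {x. \<phi> x \<noteq> 0}) \<and> closure {x. \<phi> x \<noteq> 0} \<subseteq> S"

text \<open>\<open>u\<close> belongs to \<open>H\<^sup>1(S)\<close> (\<open>S\<close> open) and \<open>G\<close> is its weak gradient, which is unique up to null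
  sets. For \<open>S\<close> a subset of the real line, \<open>G\<close> is the weak derivative.\<close>

definition has_H1_gradient ::
    "'a::euclidean_space set \<Rightarrow> ('a \<Rightarrow> real) \<Rightarrow> ('a \<Rightarrow> 'a) \<Rightarrow> bool" where
  "has_H1_gradient S u G \<longleftrightarrow> in_L2 S u \<and> in_L2 S G \<and>
     (\<forall>\<phi> v. test_function S \<phi> \<longrightarrow>
        integral\<^sup>L (lebesgue_on S) (\<lambda>x. u x * frechet_derivative \<phi> (at x) v)
        = - integral\<^sup>L (lebesgue_on S) (\<lambda>x. (G x \<bullet> v) * \<phi> x))"

definition in_H1 :: "'a::euclidean_space set \<Rightarrow> ('a \<Rightarrow> real) \<Rightarrow> bool" where
  "in_H1 S u \<longleftrightarrow> (\<exists>G. has_H1_gradient S u G)"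

definition wgrad :: "'a::euclidean_space set \<Rightarrow> ('a \<Rightarrow> real) \<Rightarrow> 'a \<Rightarrow> 'a" where
  "wgrad S u = (SOME G. has_H1_gradient S u G)"

text \<open>The arc-length parametrisation of the segment from \<open>a\<close> to \<open>b\<close> by \<open>{0..dist a b}\<close>.\<close>

definition arclen :: "'a::euclidean_space \<Rightarrow> 'a \<Rightarrow> real \<Rightarrow> 'a" where
  "arclen a b t = a + (t / dist a b) *\<^sub>R (b - a)"

text \<open>\<open>g\<close> is the trace of \<open>v \<in> H\<^sup>1(\<Omega>)\<close>: some functions that are smooth up to the boundary tend to
  \<open>v\<close> in \<open>H\<^sup>1(\<Omega>)\<close> while their boundary values tend to \<open>g\<close> in \<open>L\<^sup>2(\<partial>\<Omega>)\<close>. As the boundary of a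
  polygonal domain is a finite union of segments, the latter is convergence in \<open>L\<^sup>2\<close>
  on every segment contained in the boundary.\<close>

definition has_trace :: "(real^2) set \<Rightarrow> (real^2 \<Rightarrow> real) \<Rightarrow> (real^2 \<Rightarrow> real) \<Rightarrow> bool" where
  "has_trace \<Omega> v g \<longleftrightarrow> in_H1 \<Omega> v \<and>
     (\<exists>w G. (\<forall>n::nat. smooth (w n) \<and> has_H1_gradient \<Omega> (\<lambda>x. w n x - v x) (G n)) \<and>
        (\<lambda>n. L2_nrm \<Omega> (\<lambda>x. w n x - v x)) \<longlonglongrightarrow> 0 \<and>
        (\<lambda>n. L2_nrm \<Omega> (G n)) \<longlonglongrightarrow> 0 \<and>
        (\<forall>a b. a \<noteq> b \<and> closed_segment a b \<subseteq> frontier \<Omega> \<longrightarrow>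
           (\<lambda>n. L2_nrm {0<..<dist a b} (\<lambda>t. w n (arclen a b t) - g (arclen a b t))) \<longlonglongrightarrow> 0))"

text \<open>The last condition excludes slits: \<open>\<Omega>\<close> never lies on both sides of a boundary segment.\<close>

definition polygonal_domain :: "(real^2) set \<Rightarrow> bool" where
  "polygonal_domain \<Omega> \<longleftrightarrow> open \<Omega> \<and> connected \<Omega> \<and> \<Omega> \<noteq> {} \<and> bounded \<Omega> \<and>
     (\<exists>F. finite F \<and> frontier \<Omega> = (\<Union>(a, b)\<in>F. closed_segment a b)) \<and>
     interior (closure \<Omega>) = \<Omega>"

definition obstacle_data ::
    "(real^2) set \<Rightarrow> (real^2 \<Rightarrow> real) \<Rightarrow> (real^2 \<Rightarrow> real) \<Rightarrow> (real^2 \<Rightarrow> real) \<Rightarrow> bool" where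
  "obstacle_data \<Omega> f g \<psi> \<longleftrightarrow> in_L2 \<Omega> f \<and>
     continuous_on (frontier \<Omega>) g \<and> (\<exists>v. has_trace \<Omega> v g) \<and>
     continuous_on (closure \<Omega>) \<psi> \<and> in_H1 \<Omega> \<psi> \<and> (\<forall>z\<in>frontier \<Omega>. \<psi> z \<le> g z)"

text \<open>In the library's notion of triangulation any two members meet in a common face
  (possibly empty), so there are no hanging nodes.\<close>

definition conforming_mesh :: "(real^2) set \<Rightarrow> (real^2) set set \<Rightarrow> bool" where
  "conforming_mesh \<Omega> \<T> \<longleftrightarrow> triangulation \<T> \<and> (\<forall>T\<in>\<T>. 2 simplex T) \<and> \<Union>\<T> = closure \<Omega>"

definition angle_at :: "real^2 \<Rightarrow> real^2 \<Rightarrow> real^2 \<Rightarrow> real" where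
  "angle_at p q r = arccos (((q - p) \<bullet> (r - p)) / (norm (q - p) * norm (r - p)))"

definition shape_regular :: "real \<Rightarrow> (real^2) set set \<Rightarrow> bool" where
  "shape_regular \<theta> \<T> \<longleftrightarrow> (\<forall>T\<in>\<T>. \<forall>p q r.
     p extreme_point_of T \<and> q extreme_point_of T \<and> r extreme_point_of T \<and>
     p \<noteq> q \<and> q \<noteq> r \<and> p \<noteq> r \<longrightarrow> \<theta> \<le> angle_at p q r)"

definition mesh_vertices :: "(real^2) set set \<Rightarrow> (real^2) set" where
  "mesh_vertices \<T> = {z. \<exists>T\<in>\<T>. z extreme_point_of T}"

definition interior_vertices :: "(real^2) set \<Rightarrow> (real^2) set set \<Rightarrow> (real^2) set" where
  "interior_vertices \<Omega> \<T> = mesh_vertices \<T> \<inter> \<Omega>"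

definition boundary_vertices :: "(real^2) set \<Rightarrow> (real^2) set set \<Rightarrow> (real^2) set" where
  "boundary_vertices \<Omega> \<T> = mesh_vertices \<T> \<inter> frontier \<Omega>"

definition boundary_edges :: "(real^2) set \<Rightarrow> (real^2) set set \<Rightarrow> (real^2) set set" where
  "boundary_edges \<Omega> \<T> = {e. (\<exists>T\<in>\<T>. e edge_of T) \<and> e \<subseteq> frontier \<Omega>}"

definition boundary_triangles :: "(real^2) set \<Rightarrow> (real^2) set set \<Rightarrow> (real^2) set set" where
  "boundary_triangles \<Omega> \<T> = {T\<in>\<T>. \<exists>e\<in>boundary_edges \<Omega> \<T>. e edge_of T}"

definition at_most_one_boundary_edge :: "(real^2) set \<Rightarrow> (real^2) set set \<Rightarrow> bool" where
  "at_most_one_boundary_edge \<Omega> \<T> \<longleftrightarrow> (\<forall>T\<in>boundary_triangles \<Omega> \<T>.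
     \<forall>e\<in>boundary_edges \<Omega> \<T>. \<forall>e'\<in>boundary_edges \<Omega> \<T>. e edge_of T \<and> e' edge_of T \<longrightarrow> e = e')"

definition affine_fun_on :: "(real^2) set \<Rightarrow> (real^2 \<Rightarrow> real) \<Rightarrow> bool" where
  "affine_fun_on S v \<longleftrightarrow> (\<exists>c d. \<forall>x\<in>S. v x = c + d \<bullet> x)"

text \<open>A finite element function is represented by its continuous representative on the closed
  domain: affine on each closed triangle, hence single-valued on common edges.\<close>

definition fe_space :: "(real^2) set \<Rightarrow> (real^2) set set \<Rightarrow> (real^2 \<Rightarrow> real) set" where
  "fe_space \<Omega> \<T> = {v. in_H1 \<Omega> v \<and> (\<forall>T\<in>\<T>. affine_fun_on T v)}"

definition boundary_interpolant ::
    "(real^2) set \<Rightarrow> (real^2) set set \<Rightarrow> (real^2 \<Rightarrow> real) \<Rightarrow> (real^2 \<Rightarrow> real) \<Rightarrow> bool" where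
  "boundary_interpolant \<Omega> \<T> g gh \<longleftrightarrow> continuous_on (frontier \<Omega>) gh \<and>
     (\<forall>e\<in>boundary_edges \<Omega> \<T>. affine_fun_on e gh) \<and>
     (\<forall>z\<in>boundary_vertices \<Omega> \<T>. gh z = g z)"

definition admissible_set ::
    "(real^2) set \<Rightarrow> (real^2) set set \<Rightarrow> (real^2 \<Rightarrow> real) \<Rightarrow> (real^2 \<Rightarrow> real) \<Rightarrow> (real^2 \<Rightarrow> real) set" where
  "admissible_set \<Omega> \<T> \<psi> gh = {v\<in>fe_space \<Omega> \<T>.
     (\<forall>z\<in>interior_vertices \<Omega> \<T>. v z \<ge> \<psi> z) \<and> (\<forall>z\<in>frontier \<Omega>. v z = gh z)}"

definition dirichlet_form :: "(real^2) set \<Rightarrow> (real^2 \<Rightarrow> real) \<Rightarrow> (real^2 \<Rightarrow> real) \<Rightarrow> real" where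
  "dirichlet_form \<Omega> v w = integral\<^sup>L (lebesgue_on \<Omega>) (\<lambda>x. wgrad \<Omega> v x \<bullet> wgrad \<Omega> w x)"

definition discrete_solution ::
    "(real^2) set \<Rightarrow> (real^2) set set \<Rightarrow> (real^2 \<Rightarrow> real) \<Rightarrow> (real^2 \<Rightarrow> real) \<Rightarrow> (real^2 \<Rightarrow> real)
      \<Rightarrow> (real^2 \<Rightarrow> real) \<Rightarrow> bool" where
  "discrete_solution \<Omega> \<T> f \<psi> gh u \<longleftrightarrow> u \<in> admissible_set \<Omega> \<T> \<psi> gh \<and>
     (\<forall>v\<in>admissible_set \<Omega> \<T> \<psi> gh.
        dirichlet_form \<Omega> u (\<lambda>x. v x - u x)
        \<ge> integral\<^sup>L (lebesgue_on \<Omega>) (\<lambda>x. f x * (v x - u x)))"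

text \<open>The values on the boundary of a triangle that are to be extended; only used there.\<close>

definition ustar :: "(real^2) set \<Rightarrow> (real^2 \<Rightarrow> real) \<Rightarrow> (real^2 \<Rightarrow> real) \<Rightarrow> real^2 \<Rightarrow> real" where
  "ustar \<Omega> g u z = (if z \<in> frontier \<Omega> then g z else u z)"

definition orthogonal_line :: "(real^2) set \<Rightarrow> real^2 \<Rightarrow> (real^2) set" where
  "orthogonal_line e z = {y. \<forall>p\<in>e. \<forall>q\<in>e. (y - z) \<bullet> (p - q) = 0}"

text \<open>For \<open>z\<close> in the interior of \<open>T\<close>, the line meets the boundary of \<open>T\<close> in exactly two points.
  If \<open>T\<close> has an obtuse angle at an endpoint of \<open>e\<close>, the line may miss \<open>e\<close>; then the two points
  are taken in either order, which is harmless because the formula is symmetric.\<close>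

definition linear_extension ::
    "(real^2) set \<Rightarrow> (real^2) set \<Rightarrow> (real^2 \<Rightarrow> real) \<Rightarrow> real^2 \<Rightarrow> real" where
  "linear_extension T e w z = (THE y. \<exists>z1 z2.
     orthogonal_line e z \<inter> frontier T = {z1, z2} \<and>
     (orthogonal_line e z \<inter> e \<noteq> {} \<longrightarrow> z1 \<in> e) \<and>
     y = (dist z z2 * w z1 + dist z z1 * w z2) / (dist z z1 + dist z z2))"

end

theory Submission
  imports Defs "HOL-Computational_Algebra.Polynomial" "HOL-Real_Asymp.Real_Asymp"
begin

text \<open>
  Choose orthonormal coordinates in which the edge \<open>e\<close> is the segment \<open>[0, L]\<close> of the \<open>x\<close>-axis and
  the triangle has its apex at \<open>(p, H)\<close>, \<open>H > 0\<close>. Since the discrete solution is affine on the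
  triangle, it is its own linear extension along vertical chords. The difference \<open>v\<close> of the two
  functions is therefore the linear extension of the boundary values that equal \<open>\<phi> = g - g\<^sub>h\<close> on \<open>e\<close>
  and zero on the other two edges. If \<open>\<tau> x\<close> is the height of the triangle above the point
  \<open>x\<close> of \<open>e\<close>, then \<open>v (x, y) = \<phi> x (1 - y / \<tau> x)\<close> for \<open>0 < x < L\<close>, and \<open>v = 0\<close> on the part
  of the triangle that does not lie above \<open>e\<close> (\<open>linear_extension_minus_affine\<close>).

  The boundary values do vanish on the other two edges because these edges run inside \<open>\<Omega>\<close>. An edge
  one point of which is inside \<open>\<Omega>\<close> has a second triangle on its other side, which shares both end
  points with it; so all its relatively interior points are interior
  (\<open>conforming_mesh_edge_inside\<close>), and the only alternative is that the whole edge is a boundary edge.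
  At the vertices \<open>g\<close> and \<open>g\<^sub>h\<close> agree.

  The partial derivatives of \<open>v\<close> are \<open>- \<phi> / \<tau>\<close> and \<open>\<phi>' (1 - y / \<tau>) + \<phi> y \<tau>' / \<tau>\<^sup>2\<close>. Integration over \<open>y\<close>
  bounds the squared norm of the gradient by the integrals over \<open>[0, L]\<close> of multiples of
  \<open>\<phi>'\<^sup>2 \<tau>\<close>, \<open>\<phi>\<^sup>2 \<tau>'\<^sup>2 / \<tau>\<close> and \<open>\<phi>\<^sup>2 / \<tau>\<close>. The first is at most \<open>H N\<close> with \<open>N\<close> the integral of \<open>\<phi>'\<^sup>2\<close>. In the
  others \<open>\<tau>\<close> may vanish at an end of \<open>e\<close>, but only linearly, and \<open>\<phi> 0 = \<phi> L = 0\<close> gives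
  \<open>\<phi>\<^sup>2 \<le> N x\<close> and \<open>\<phi>\<^sup>2 \<le> N (L - x)\<close> by Cauchy-Schwarz. So both integrands are bounded by constants on
  either side of the apex. The result is \<open>N (6 H + \<kappa> L)\<close> (\<open>nn_integral_G\<close>), where \<open>\<kappa>\<close> bounds the
  cotangents of the two angles at \<open>e\<close>; the third angle bounds \<open>H\<close> by a multiple of \<open>L\<close>
  (\<open>shape_bounds\<close>).

  What remains is to show that these formulas give the weak gradient. Here \<open>\<phi>\<close> is merely the primitive
  of a square-integrable function. That it is one is the lemma of du Bois-Reymond
  (\<open>weak_derivative_FTC\<close>), for which smooth cut-off functions have to be constructed. For a primitive,
  integration by parts against a piecewise continuously differentiable factor is an exchange of two
  integrals (\<open>integral_weak_ibp\<close>). Applied on horizontal and vertical slices of the triangle, it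
  gives the two components of the identity that defines the weak gradient.
\<close>

section \<open>A smooth step function\<close>

text \<open>On the real line \<open>C_times\<close> is governed by the ordinary derivative; the factor \<open>v\<close> is the
  direction.\<close>

lemma C_times_Suc_real:
  fixes f f' :: "real \<Rightarrow> real"
  assumes "\<And>x. (f has_real_derivative f' x) (at x)"
  shows "C_times (Suc k) f \<longleftrightarrow> (\<forall>v. C_times k (\<lambda>x. f' x * v))"
proof -
  have "frechet_derivative f (at x) = (\<lambda>v. f' x * v)" for x
    using assms[of x] by (metis frechet_derivative_at has_field_derivative_def)
  moreover have "f differentiable (at x)" for x
    using assms[of x] by (metis differentiable_def has_field_derivative_def)
  ultimately show ?thesis by simp
qed

lemma C_times_Suc_imp: "C_times (Suc k) f \<Longrightarrow> C_times k f"
proof (induction k arbitrary: f)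
  case 0
  then show ?case
    by (simp add: continuous_on_eq_continuous_at differentiable_imp_continuous_within)
next
  case (Suc k)
  then show ?case by simp
qed

lemma C_times_add:
  assumes "C_times k f" "C_times k g" shows "C_times k (\<lambda>x. f x + g x)"
  using assms
proof (induction k arbitrary: f g)
  case 0
  then show ?case by (simp add: continuous_on_add)
next
  case (Suc k)
  then have d: "f differentiable (at x)" "g differentiable (at x)" for x by auto
  have "((\<lambda>x. f x + g x) has_derivative (\<lambda>v. frechet_derivative f (at x) v + frechet_derivative g (at x) v)) (at x)" for x
    using d by (intro has_derivative_add) (simp_all add: frechet_derivative_works)
  then have "frechet_derivative (\<lambda>x. f x + g x) (at x) = (\<lambda>v. frechet_derivative f (at x) v + frechet_derivative g (at x) v)" for x
    by (rule frechet_derivative_at[symmetric])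
  then show ?case using Suc d by simp
qed

lemma C_times_mult:
  assumes "C_times k f" "C_times k g" shows "C_times k (\<lambda>x. f x * g x)"
  using assms
proof (induction k arbitrary: f g)
  case 0
  then show ?case by (simp add: continuous_on_mult)
next
  case (Suc k)
  then have d: "f differentiable (at x)" "g differentiable (at x)" for x by auto
  have "((\<lambda>x. f x * g x) has_derivative (\<lambda>v. f x * frechet_derivative g (at x) v + frechet_derivative f (at x) v * g x)) (at x)" for x
    using d by (intro has_derivative_mult) (simp_all add: frechet_derivative_works)
  then have "frechet_derivative (\<lambda>x. f x * g x) (at x) = (\<lambda>v. f x * frechet_derivative g (at x) v + frechet_derivative f (at x) v * g x)" for x
    by (rule frechet_derivative_at[symmetric])
  moreover have "C_times k f" "C_times k g" by (rule C_times_Suc_imp, fact)+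
  ultimately show ?case using Suc d by (simp add: C_times_add)
qed

lemma C_times_const: "C_times k (\<lambda>x. c)"
  by (induction k arbitrary: c) (auto simp: frechet_derivative_const)

lemma C_times_affine:
  fixes f :: "real \<Rightarrow> real"
  assumes "C_times k f" shows "C_times k (\<lambda>x. f (c * x + d))"
  using assms
proof (induction k arbitrary: f)
  case 0
  then show ?case
    by simp (rule continuous_on_compose2[of UNIV f], auto intro!: continuous_on_add continuous_on_mult continuous_on_id continuous_on_const)
next
  case (Suc k)
  let ?D = "\<lambda>x. frechet_derivative f (at x) 1"
  have F: "(f has_derivative frechet_derivative f (at x)) (at x)" for x
    using Suc.prems frechet_derivative_works by auto
  have "v * ?D x = frechet_derivative f (at x) v" for x v
    using linear_scale[OF has_derivative_linear[OF F[of x]], of v 1] by simp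
  then have D: "(f has_real_derivative ?D x) (at x)" for x
    by (rule has_derivative_imp_has_field_derivative[OF F])
  have D': "((\<lambda>x. f (c * x + d)) has_real_derivative (?D (c * x + d) * c)) (at x)" for x
    by (rule DERIV_chain2[OF D]) (auto intro!: derivative_eq_intros)
  have "C_times k ?D" using Suc.prems by simp
  from Suc.IH[OF this] show ?case
    unfolding C_times_Suc_real[OF D'] by (intro allI C_times_mult C_times_const)
qed

text \<open>Differences of two shifted and rescaled copies of a step are the cut-off functions that
  imitate the indicator of an interval.\<close>

lemma smooth_diff_affine:
  fixes \<sigma> :: "real \<Rightarrow> real"
  assumes "smooth \<sigma>"
  shows "smooth (\<lambda>x. \<sigma> (c * x + d) - \<sigma> (c * x + d'))"
proof -
  have "C_times k (\<lambda>x. \<sigma> (c * x + d) + (- 1) * \<sigma> (c * x + d'))" for k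
    using assms unfolding smooth_def by (intro C_times_add C_times_mult C_times_const C_times_affine) blast+
  then show ?thesis by (simp add: smooth_def)
qed

text \<open>The functions \<open>p (1 / x) exp (- 1 / x)\<close>, extended by zero to \<open>x \<le> 0\<close>, form a class that is
  closed under differentiation, whence all of them are smooth.\<close>

definition flat :: "real poly \<Rightarrow> real \<Rightarrow> real" where
  "flat p x = (if x \<le> 0 then 0 else poly p (1 / x) * exp (- (1 / x)))"

lemma tendsto_poly_times_exp_minus:
  "((\<lambda>t. poly p t * exp (- t)) \<longlongrightarrow> (0::real)) at_top"
proof -
  have "((\<lambda>t. t ^ i * exp (- t)) \<longlongrightarrow> (0::real)) at_top" for i
    using tendsto_power_div_exp_0[of i] by (simp add: exp_minus field_simps)
  then have "((\<lambda>t. \<Sum>i\<le>degree p. coeff p i * (t ^ i * exp (- t)))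
      \<longlongrightarrow> (\<Sum>i\<le>degree p. coeff p i * 0)) at_top"
    by (intro tendsto_intros)
  then show ?thesis
    by (simp add: poly_altdef sum_distrib_right mult.assoc)
qed

text \<open>This is the difference quotient of \<open>flat p\<close> at the origin.\<close>

lemma flat_div_tendsto_0: "((\<lambda>x. flat p x / x) \<longlongrightarrow> 0) (at 0)"
proof -
  have "((\<lambda>x. flat p x / x) \<longlongrightarrow> 0) (at_right 0)"
  proof (rule Lim_transform_eventually)
    show "((\<lambda>x. poly (pCons 0 p) (inverse x) * exp (- inverse x)) \<longlongrightarrow> (0::real)) (at_right 0)"
      by (rule filterlim_compose[OF tendsto_poly_times_exp_minus filterlim_inverse_at_top_right])
    show "\<forall>\<^sub>F x in at_right 0. poly (pCons 0 p) (inverse x) * exp (- inverse x) = flat p x / x"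
      by (rule eventually_at_rightI[of 0 1]) (auto simp: flat_def field_simps)
  qed
  moreover have "((\<lambda>x. flat p x / x) \<longlongrightarrow> 0) (at_left 0)"
    by (rule Lim_transform_eventually[OF tendsto_const])
      (auto simp: flat_def eventually_at intro!: exI[of _ 1])
  ultimately show ?thesis by (simp add: filterlim_split_at)
qed

lemma flat_has_derivative:
  "(flat p has_real_derivative flat ((p - pderiv p) * [:0, 0, 1:]) x) (at x)"
proof (cases x "0::real" rule: linorder_cases)
  case less
  have "((\<lambda>_. 0) has_real_derivative 0) (at x)" by simp
  then have "(flat p has_real_derivative 0) (at x)"
    by (rule has_field_derivative_transform_within_open[of _ _ _ "{..<0}"])
      (use less in \<open>auto simp: flat_def\<close>)
  then show ?thesis using less by (simp add: flat_def)
next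
  case equal
  have "(flat p has_real_derivative 0) (at 0)"
    unfolding has_field_derivative_iff using flat_div_tendsto_0[of p] by (simp add: flat_def)
  then show ?thesis using equal by (simp add: flat_def)
next
  case greater
  have "((\<lambda>x. poly p (1 / x) * exp (- (1 / x))) has_real_derivative
       poly ((p - pderiv p) * [:0, 0, 1:]) (1 / x) * exp (- (1 / x))) (at x)"
    using greater
    by (auto intro!: derivative_eq_intros DERIV_chain2[OF poly_DERIV] simp: field_simps power2_eq_square)
  then have "(flat p has_real_derivative poly ((p - pderiv p) * [:0, 0, 1:]) (1 / x) * exp (- (1 / x))) (at x)"
    by (rule has_field_derivative_transform_within_open[of _ _ _ "{0<..}"])
      (use greater in \<open>auto simp: flat_def\<close>)
  then show ?thesis using greater by (simp add: flat_def)
qed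

lemma C_times_flat: "C_times k (flat p)"
proof (induction k arbitrary: p)
  case 0
  show ?case
    using DERIV_continuous[OF flat_has_derivative] by (auto simp: continuous_on_eq_continuous_at)
next
  case (Suc k)
  then show ?case
    unfolding C_times_Suc_real[OF flat_has_derivative] by (intro allI C_times_mult C_times_const)
qed

text \<open>The product \<open>flat 1 x * flat 1 (1 - x)\<close> is smooth and positive exactly on \<open>(0, 1)\<close>; the step
  is its normalised primitive.\<close>

lemma smooth_step_exists:
  obtains \<sigma> \<sigma>' :: "real \<Rightarrow> real"
  where "smooth \<sigma>" "\<And>x. (\<sigma> has_real_derivative \<sigma>' x) (at x)" "continuous_on UNIV \<sigma>'"
    "\<And>x. 0 \<le> \<sigma> x" "\<And>x. \<sigma> x \<le> 1" "\<And>x. x \<le> 0 \<Longrightarrow> \<sigma> x = 0" "\<And>x. x \<ge> 1 \<Longrightarrow> \<sigma> x = 1"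
    "\<And>x. x \<le> 0 \<Longrightarrow> \<sigma>' x = 0" "\<And>x. x \<ge> 1 \<Longrightarrow> \<sigma>' x = 0"
proof -
  define \<eta> where "\<eta> x = flat 1 x * flat 1 ((-1) * x + 1)" for x
  have C\<eta>: "C_times k \<eta>" for k
    unfolding \<eta>_def by (intro C_times_mult C_times_affine C_times_flat)
  have cont: "continuous_on UNIV \<eta>" using C\<eta>[of 0] by simp
  have nn: "0 \<le> \<eta> x" for x by (auto simp: \<eta>_def flat_def)
  have pos: "0 < \<eta> x" if "0 < x" "x < 1" for x using that by (auto simp: \<eta>_def flat_def)
  have z0: "\<eta> x = 0" if "x \<le> 0" for x using that by (auto simp: \<eta>_def flat_def)
  have z1: "\<eta> x = 0" if "x \<ge> 1" for x using that by (auto simp: \<eta>_def flat_def)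
  define I where "I x = integral {-1..x} \<eta>" for x
  have int: "\<eta> integrable_on {u..w}" for u w
    by (rule integrable_continuous_real) (use cont continuous_on_subset in blast)
  have split: "I y = I x + integral {x..y} \<eta>" if "-1 \<le> x" "x \<le> y" for x y
    unfolding I_def using Henstock_Kurzweil_Integration.integral_combine[OF that int] by simp
  have I0: "I x = 0" if "x \<le> 0" for x
  proof -
    have "integral {-1..x} \<eta> = integral {-1..x} (\<lambda>_. 0)"
      by (rule integral_cong) (use that z0 in auto)
    then show ?thesis by (simp add: I_def)
  qed
  have mono: "I x \<le> I y" if "x \<le> y" for x y
  proof (cases "-1 \<le> x")
    case True
    then show ?thesis using split[OF True that] integral_nonneg[OF int] nn by simp
  next
    case False
    then show ?thesis using I0[of x] integral_nonneg[OF int[of "-1" y]] nn by (simp add: I_def)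
  qed
  have I1: "I x = I 1" if "x \<ge> 1" for x
  proof -
    have "integral {1..x} \<eta> = integral {1..x} (\<lambda>_. 0)"
      by (rule integral_cong) (use z1 in auto)
    then show ?thesis using split[of 1 x] that by simp
  qed
  have DI: "(I has_real_derivative \<eta> x) (at x)" for x
  proof (cases "x < 0")
    case True
    have "((\<lambda>_. 0) has_real_derivative 0) (at x)" by simp
    then have "(I has_real_derivative 0) (at x)"
      by (rule has_field_derivative_transform_within_open[of _ _ _ "{..<0}"])
        (use True I0 in auto)
    then show ?thesis using True z0 by simp
  next
    case False
    have "continuous_on {-1..x+1} \<eta>" by (rule continuous_on_subset[OF cont]) simp
    then have "(I has_real_derivative \<eta> x) (at x within {-1..x+1})"
      unfolding I_def by (rule integral_has_real_derivative) (use False in simp)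
    then show ?thesis
      using False by (simp add: at_within_interior[of x "{-1..x+1}"])
  qed
  have "I 1 > 0"
  proof -
    have "I 0 < I 1"
    proof (rule ccontr)
      assume "\<not> I 0 < I 1"
      then have "I y = I 0" if "0 \<le> y" "y \<le> 1" for y
        using mono[of 0 y] mono[of y 1] that by linarith
      then have eq: "I y = 0" if "y \<in> {0<..<1}" for y
        using that I0[of 0] by simp
      have "((\<lambda>_. 0) has_real_derivative 0) (at (1/2::real))" by simp
      then have "(I has_real_derivative 0) (at (1/2))"
        by (rule has_field_derivative_transform_within_open[of _ _ _ "{0<..<1}"]) (use eq in auto)
      with DI[of "1/2"] have "\<eta> (1/2) = 0" by (rule DERIV_unique)
      then show False using pos[of "1/2"] by simp
    qed
    then show ?thesis using I0[of 0] by simp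
  qed
  show thesis
  proof (rule that)
    show D: "((\<lambda>x. I x / I 1) has_real_derivative (\<eta> x / I 1)) (at x)" for x
      by (rule DERIV_cdivide[OF DI])
    have "C_times (Suc k) (\<lambda>x. I x / I 1)" for k
      unfolding C_times_Suc_real[OF D] unfolding divide_inverse
      by (intro allI C_times_mult C_times_const C\<eta>)
    then have "C_times k (\<lambda>x. I x / I 1)" for k
      by (rule C_times_Suc_imp)
    then show "smooth (\<lambda>x. I x / I 1)"
      unfolding smooth_def by blast
    show "continuous_on UNIV (\<lambda>x. \<eta> x / I 1)"
      using \<open>I 1 > 0\<close> by (auto intro!: continuous_intros cont)
    show "0 \<le> I x / I 1" for x
      using \<open>I 1 > 0\<close> I0[of x] mono[of 0 x] I0[of 0] by (cases "x \<le> 0") simp_all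
    show "I x / I 1 \<le> 1" for x
      using \<open>I 1 > 0\<close> I1[of x] mono[of x 1] by (cases "x \<le> 1") auto
    show "I x / I 1 = 1" if "x \<ge> 1" for x
      unfolding I1[OF that] using \<open>I 1 > 0\<close> by simp
  qed (simp_all add: I0 z0 z1)
qed

section \<open>Integration by parts against a primitive\<close>

text \<open>Integration by parts for an absolutely continuous \<open>\<phi>\<close>, given as the primitive of an
  integrable \<open>D\<close>. Writing \<open>\<phi> x - \<phi> \<alpha>\<close> as an integral of \<open>D\<close> over \<open>(\<alpha>, x)\<close> turns the integral
  of \<open>\<phi> q'\<close> into a double integral over \<open>t < x\<close>. In the other order, the inner integral of
  \<open>q'\<close> over \<open>(t, \<beta>)\<close> is \<open>q \<beta> - q t\<close>. Finitely many kinks of \<open>q\<close> are allowed because the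
  function used later has one below the apex of the triangle.\<close>

lemma integral_weak_ibp:
  fixes D \<phi> q q' :: "real \<Rightarrow> real"
  assumes "\<alpha> \<le> \<beta>" and D: "integrable lborel D"
    and \<phi>: "\<And>x. x \<in> {\<alpha>..\<beta>} \<Longrightarrow> \<phi> x = \<phi> \<alpha> + (\<integral>t. indicator {\<alpha><..<x} t * D t \<partial>lborel)"
    and "finite S" and q: "continuous_on {\<alpha>..\<beta>} q"
    and q': "\<And>x. x \<in> {\<alpha><..<\<beta>} - S \<Longrightarrow> (q has_real_derivative q' x) (at x)"
    and m[measurable]: "q' \<in> borel_measurable borel" and B: "\<And>x. x \<in> {\<alpha><..<\<beta>} \<Longrightarrow> \<bar>q' x\<bar> \<le> B"
  shows "(\<integral>x. indicator {\<alpha><..<\<beta>} x * (\<phi> x * q' x + D x * q x) \<partial>lborel) = \<phi> \<beta> * q \<beta> - \<phi> \<alpha> * q \<alpha>"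
proof -
  define Q where "Q x = indicator {\<alpha><..<\<beta>} x * q' x" for x
  have [measurable]: "D \<in> borel_measurable borel" using D by (simp add: borel_measurable_integrable)
  have Qm[measurable]: "Q \<in> borel_measurable borel" unfolding Q_def by measurable
  have "B \<ge> 0 \<or> \<alpha> = \<beta>"
    using B[of "(\<alpha>+\<beta>)/2"] \<open>\<alpha> \<le> \<beta>\<close> by force
  then have Qb: "\<bar>Q x\<bar> \<le> B * indicator {\<alpha><..<\<beta>} x" for x
    using B[of x] by (auto simp: Q_def split: split_indicator)
  have "integrable lborel (indicat_real {\<alpha><..<\<beta>})"
    using \<open>\<alpha> \<le> \<beta>\<close> by (intro integrable_real_indicator) auto
  then have "integrable lborel (\<lambda>x. B * indicat_real {\<alpha><..<\<beta>} x)" by simp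
  then have Qi: "integrable lborel Q"
    by (rule Bochner_Integration.integrable_bound)
      (use Qb in \<open>auto intro!: order.trans[OF _ abs_ge_self]\<close>)
  define K where "K x t = Q x * (indicator {\<alpha><..<x} t * D t)" for x t
  have Km[measurable]: "case_prod K \<in> borel_measurable (lborel \<Otimes>\<^sub>M lborel)"
  proof -
    have "case_prod K = (\<lambda>p. Q (fst p) * ((if \<alpha> < snd p \<and> snd p < fst p then 1 else 0) * D (snd p)))"
      by (auto simp: K_def fun_eq_iff)
    also have "\<dots> \<in> borel_measurable (lborel \<Otimes>\<^sub>M lborel)" by measurable
    finally show ?thesis .
  qed
  have "integrable (lborel \<Otimes>\<^sub>M lborel) (\<lambda>p. Q (fst p) * D (snd p))"
    by (rule lborel_pair.Fubini_integrable) (use Qi D in \<open>auto simp: abs_mult\<close>)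
  then have Ki: "integrable (lborel \<Otimes>\<^sub>M lborel) (case_prod K)"
    by (rule Bochner_Integration.integrable_bound)
      (auto simp: K_def abs_mult split: split_indicator)
  have D1: "integrable lborel (\<lambda>t. indicator A t * D t)" if "A \<in> sets borel" for A
    using integrable_mult_indicator[of A lborel D] that D by simp
  have inner: "(\<integral>t. K x t \<partial>lborel) = Q x * (\<phi> x - \<phi> \<alpha>)" for x
  proof (cases "x \<in> {\<alpha><..<\<beta>}")
    case True
    then show ?thesis using \<phi>[of x] by (simp add: K_def)
  qed (simp add: K_def Q_def)
  have "(\<integral>x. Q x * (\<phi> x - \<phi> \<alpha>) \<partial>lborel) = (\<integral>x. (\<integral>t. K x t \<partial>lborel) \<partial>lborel)"
    by (simp only: inner)
  also have "\<dots> = (\<integral>t. (\<integral>x. K x t \<partial>lborel) \<partial>lborel)"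
    by (rule lborel_pair.Fubini_integral[OF Ki, symmetric])
  also have "\<dots> = (\<integral>t. indicator {\<alpha><..<\<beta>} t * (q \<beta> * D t - q t * D t) \<partial>lborel)"
  proof (rule Bochner_Integration.integral_cong)
    fix t
    consider "t \<le> \<alpha> \<or> \<beta> \<le> t" | "t \<in> {\<alpha><..<\<beta>}" by force
    then show "(\<integral>x. K x t \<partial>lborel) = indicator {\<alpha><..<\<beta>} t * (q \<beta> * D t - q t * D t)"
    proof cases
      case 1
      then have "K x t = 0" for x by (auto simp: K_def Q_def split: split_indicator)
      with 1 show ?thesis by auto
    next
      case 2
      have i: "integrable lborel (\<lambda>x. indicator {t<..} x * Q x)"
        using integrable_mult_indicator[of "{t<..}" lborel Q] Qi by simp
      have "(q' has_integral (q \<beta> - q t)) {t..\<beta>}"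
        by (rule fundamental_theorem_of_calculus_interior_strong[OF \<open>finite S\<close>])
          (use 2 q' in \<open>auto simp: has_real_derivative_iff_has_vector_derivative[symmetric]
             intro: continuous_on_subset[OF q]\<close>)
      then have "((\<lambda>x. if x \<in> {t..\<beta>} then q' x else 0) has_integral (q \<beta> - q t)) UNIV"
        by (simp only: has_integral_restrict_UNIV)
      then have "((\<lambda>x. indicator {t<..} x * Q x) has_integral (q \<beta> - q t)) UNIV"
        by (rule has_integral_spike_finite[of "{t, \<beta>}", rotated 2])
          (use 2 in \<open>auto simp: Q_def split: split_indicator\<close>)
      with has_integral_integral_lborel[OF i]
      have "(\<integral>x. indicator {t<..} x * Q x \<partial>lborel) = q \<beta> - q t"
        by (rule has_integral_unique)
      moreover have "K x t = D t * (indicator {t<..} x * Q x)" for x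
        using 2 by (auto simp: K_def split: split_indicator)
      ultimately have "(\<integral>x. K x t \<partial>lborel) = D t * (q \<beta> - q t)" by simp
      then show ?thesis using 2 by (simp add: algebra_simps)
    qed
  qed simp
  finally have eq: "(\<integral>x. Q x * (\<phi> x - \<phi> \<alpha>) \<partial>lborel)
      = (\<integral>t. indicator {\<alpha><..<\<beta>} t * (q \<beta> * D t - q t * D t) \<partial>lborel)" .
  have i1: "integrable lborel (\<lambda>x. Q x * (\<phi> x - \<phi> \<alpha>))"
  proof -
    have "integrable lborel (\<lambda>x. \<integral>t. K x t \<partial>lborel)"
      using lborel_pair.integrable_fst'[OF Ki] by simp
    then show ?thesis by (simp only: inner)
  qed
  have i2: "integrable lborel (\<lambda>x. indicator {\<alpha><..<\<beta>} x * (q x * D x))"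
  proof -
    obtain M where M: "\<And>x. x \<in> {\<alpha>..\<beta>} \<Longrightarrow> \<bar>q x\<bar> \<le> M"
      using compact_imp_bounded[OF compact_continuous_image[OF q compact_Icc]]
      by (force simp: bounded_iff)
    have qm: "(\<lambda>x. indicator {\<alpha><..<\<beta>} x * q x) \<in> borel_measurable borel"
      using borel_measurable_continuous_on_indicator[of "{\<alpha><..<\<beta>}" q]
        continuous_on_subset[OF q greaterThanLessThan_subseteq_atLeastAtMost_iff[THEN iffD2]]
      by auto
    have "integrable lborel (\<lambda>x. (indicator {\<alpha><..<\<beta>} x * q x) * D x)"
      by (rule Bochner_Integration.integrable_bound[OF integrable_mult_right[OF D, of M]])
        (use qm in \<open>auto simp: abs_mult intro!: AE_I2 mult_right_mono order.trans[OF M abs_ge_self] split: split_indicator\<close>)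
    then show ?thesis by (simp add: mult.assoc)
  qed
  have "(\<integral>x. indicator {\<alpha><..<\<beta>} x * (\<phi> x * q' x + D x * q x) \<partial>lborel)
     = (\<integral>x. Q x * (\<phi> x - \<phi> \<alpha>) + \<phi> \<alpha> * Q x + indicator {\<alpha><..<\<beta>} x * (q x * D x) \<partial>lborel)"
    by (rule Bochner_Integration.integral_cong) (auto simp: Q_def algebra_simps)
  also have "\<dots> = (\<integral>x. Q x * (\<phi> x - \<phi> \<alpha>) \<partial>lborel) + \<phi> \<alpha> * (\<integral>x. Q x \<partial>lborel)
       + (\<integral>x. indicator {\<alpha><..<\<beta>} x * (q x * D x) \<partial>lborel)"
    using i1 i2 Qi by simp
  also have "(\<integral>x. Q x * (\<phi> x - \<phi> \<alpha>) \<partial>lborel)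
     = (\<integral>t. q \<beta> * (indicator {\<alpha><..<\<beta>} t * D t) - indicator {\<alpha><..<\<beta>} t * (q t * D t) \<partial>lborel)"
    unfolding eq by (simp add: algebra_simps)
  also have "\<dots> = q \<beta> * (\<integral>t. indicator {\<alpha><..<\<beta>} t * D t \<partial>lborel)
      - (\<integral>x. indicator {\<alpha><..<\<beta>} x * (q x * D x) \<partial>lborel)"
    using i2 D1 by simp
  also have "(\<integral>t. indicator {\<alpha><..<\<beta>} t * D t \<partial>lborel) = \<phi> \<beta> - \<phi> \<alpha>"
    using \<phi>[of \<beta>] \<open>\<alpha> \<le> \<beta>\<close> by simp
  also have "(\<integral>x. Q x \<partial>lborel) = q \<beta> - q \<alpha>"
  proof -
    have "(q' has_integral (q \<beta> - q \<alpha>)) {\<alpha>..\<beta>}"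
      by (rule fundamental_theorem_of_calculus_interior_strong[OF \<open>finite S\<close> \<open>\<alpha> \<le> \<beta>\<close>])
        (use q' q in \<open>auto simp: has_real_derivative_iff_has_vector_derivative[symmetric]\<close>)
    then have "((\<lambda>x. if x \<in> {\<alpha>..\<beta>} then q' x else 0) has_integral (q \<beta> - q \<alpha>)) UNIV"
      by (simp only: has_integral_restrict_UNIV)
    then have "(Q has_integral (q \<beta> - q \<alpha>)) UNIV"
      by (rule has_integral_spike_finite[of "{\<alpha>, \<beta>}", rotated 2])
        (auto simp: Q_def split: split_indicator)
    with has_integral_integral_lborel[OF Qi] show ?thesis by (rule has_integral_unique)
  qed
  finally show ?thesis by (simp add: algebra_simps)
qed

section \<open>Weak derivatives on an interval\<close>

lemma L2_imp_integrable:
  fixes d :: "real \<Rightarrow> real"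
  assumes "in_L2 {0<..<L} d" shows "integrable (lebesgue_on {0<..<L}) d"
proof -
  have "emeasure (lebesgue_on {0<..<L}) (space (lebesgue_on {0<..<L})) \<noteq> \<infinity>"
    by (cases "0 \<le> L") (simp_all add: emeasure_restrict_space)
  then interpret finite_measure "lebesgue_on {0<..<L}" by (rule finite_measureI)
  have bound: "\<bar>y\<bar> \<le> 1 + y\<^sup>2" for y :: real
    using zero_le_power2[of "\<bar>y\<bar> - 1"] by (simp add: power2_diff)
  show ?thesis
    by (rule Bochner_Integration.integrable_bound[of _ "\<lambda>x. 1 + (norm (d x))\<^sup>2"])
      (use assms bound in \<open>auto simp: in_L2_def\<close>)
qed

text \<open>The lemma of du Bois-Reymond between two interior points. The test function \<open>\<psi> n\<close> rises from
  0 to 1 just to the right of \<open>s\<close> and falls back to 0 just to the right of \<open>t\<close>. Its derivative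
  is the difference of two approximate unit masses, which pick out \<open>u s - u t\<close> by continuity
  of \<open>u\<close>; \<open>\<psi> n\<close> itself tends to the indicator of \<open>(s, t]\<close>.\<close>

lemma weak_derivative_FTC_open:
  fixes u d :: "real \<Rightarrow> real"
  assumes H1: "has_H1_gradient {0<..<L} u d" and u: "continuous_on {0..L} u"
    and st: "0 < s" "s < t" "t < L"
  shows "u t - u s = (\<integral>x. d x * indicator {s<..t} x \<partial>lebesgue_on {0<..<L})"
proof -
  obtain \<sigma> \<sigma>' :: "real \<Rightarrow> real"
    where \<sigma>: "smooth \<sigma>" and D\<sigma>: "\<And>x. (\<sigma> has_real_derivative \<sigma>' x) (at x)" and c\<sigma>': "continuous_on UNIV \<sigma>'"
    and \<sigma>01: "\<And>x. 0 \<le> \<sigma> x" "\<And>x. \<sigma> x \<le> 1" and \<sigma>0: "\<And>x. x \<le> 0 \<Longrightarrow> \<sigma> x = 0"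
    and \<sigma>1: "\<And>x. x \<ge> 1 \<Longrightarrow> \<sigma> x = 1"
    and \<sigma>'0: "\<And>x. x \<le> 0 \<Longrightarrow> \<sigma>' x = 0" and \<sigma>'1: "\<And>x. x \<ge> 1 \<Longrightarrow> \<sigma>' x = 0"
    by (fact smooth_step_exists)
  have [measurable]: "\<sigma>' \<in> borel_measurable borel" "\<sigma> \<in> borel_measurable borel"
    using c\<sigma>' DERIV_continuous[OF D\<sigma>]
    by (auto intro!: borel_measurable_continuous_onI simp: continuous_on_eq_continuous_at)
  define S where "S = {0<..<L}"
  have S: "S \<in> sets lebesgue" by (simp add: S_def)
  obtain N :: nat where N: "1 / real N < L - t" "N > 0"
    using st nat_approx_posE[of "L - t"] by (metis diff_gt_0_iff_gt zero_less_Suc)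
  define m where "m n = real (n + N)" for n
  have m0: "m n > 0" for n using N by (simp add: m_def)
  have mL: "t + 1 / m n < L" for n
  proof -
    have "1 / m n \<le> 1 / real N" using N by (simp add: m_def field_simps)
    then show ?thesis using N by simp
  qed
  have m_lim: "filterlim m at_top sequentially"
    unfolding m_def by (intro filterlim_compose[OF filterlim_real_sequentially]) real_asymp
  then have m_inv: "(\<lambda>n. inverse (m n)) \<longlonglongrightarrow> 0"
    by (rule filterlim_compose[OF tendsto_inverse_0_at_top, OF filterlim_ident, unfolded o_def])
  define \<psi> where "\<psi> n x = \<sigma> (m n * x + (- m n * s)) - \<sigma> (m n * x + (- m n * t))" for n x
  define \<psi>' where "\<psi>' n x = m n * \<sigma>' (m n * (x - s)) - m n * \<sigma>' (m n * (x - t))" for n x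
  have D\<psi>: "(\<psi> n has_real_derivative \<psi>' n x) (at x)" for n x
    unfolding \<psi>_def \<psi>'_def
    by (auto intro!: derivative_eq_intros DERIV_chain2[OF D\<sigma>] simp: algebra_simps)
  have supp: "closure {x. \<psi> n x \<noteq> 0} \<subseteq> {s..t + 1 / m n}" for n
  proof (rule closure_minimal)
    show "{x. \<psi> n x \<noteq> 0} \<subseteq> {s..t + 1 / m n}"
    proof (rule ccontr)
      assume "\<not> {x. \<psi> n x \<noteq> 0} \<subseteq> {s..t + 1 / m n}"
      then obtain x where x: "\<psi> n x \<noteq> 0" "x < s \<or> x > t + 1 / m n" by force
      from x(2) show False
      proof
        assume "x < s"
        then have "m n * (x - s) \<le> 0" "m n * (x - t) \<le> 0"
          using m0[of n] st by (auto simp: mult_le_0_iff)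
        then show False using x(1) \<sigma>0 by (simp add: \<psi>_def algebra_simps)
      next
        assume "x > t + 1 / m n"
        then have "m n * (x - t) \<ge> 1"
          using m0[of n] by (simp add: field_simps)
        moreover have "m n * (x - t) \<le> m n * (x - s)"
          using m0[of n] st by simp
        ultimately have "m n * (x - s) \<ge> 1" "m n * (x - t) \<ge> 1" by linarith+
        then show False using x(1) \<sigma>1 by (simp add: \<psi>_def algebra_simps)
      qed
    qed
  qed simp
  have test: "test_function S (\<psi> n)" for n
    unfolding test_function_def
  proof (intro conjI)
    show "smooth (\<psi> n)" unfolding \<psi>_def by (rule smooth_diff_affine[OF \<sigma>])
    show "compact (closure {x. \<psi> n x \<noteq> 0})"
      using compact_Int_closed[OF compact_Icc closed_closure, of s "t + 1 / m n" "{x. \<psi> n x \<noteq> 0}"] supp[of n]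
      by (simp only: Int_absorb1)
    show "closure {x. \<psi> n x \<noteq> 0} \<subseteq> S"
      using supp[of n] st mL[of n] by (auto simp: S_def)
  qed
  have frechet: "frechet_derivative (\<psi> n) (at x) 1 = \<psi>' n x" for n x
    using frechet_derivative_at[OF D\<psi>[unfolded has_field_derivative_def], of n x, symmetric] by simp
  have weak: "(\<integral>x. u x * \<psi>' n x \<partial>lebesgue_on S) = - (\<integral>x. d x * \<psi> n x \<partial>lebesgue_on S)" for n
    using H1 test[of n] unfolding has_H1_gradient_def S_def[symmetric] frechet[symmetric]
    by (simp add: mult.commute)

  \<comment> \<open>The substitution \<open>y = m n (x - r)\<close> fixes the kernel and lets the argument of \<open>u1\<close> tend to \<open>r\<close>;
    \<open>u1\<close> is bounded on the whole line, as dominated convergence requires.\<close>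
  define u1 where "u1 x = indicator S x * u x" for x
  have u1m[measurable]: "u1 \<in> borel_measurable borel"
    using borel_measurable_continuous_on_indicator[of S u]
      continuous_on_subset[OF u greaterThanLessThan_subseteq_atLeastAtMost_iff[THEN iffD2]]
    by (auto simp: S_def u1_def[abs_def])
  obtain M where M: "\<And>x. \<bar>u1 x\<bar> \<le> M"
  proof -
    obtain M where "\<And>x. x \<in> {0..L} \<Longrightarrow> \<bar>u x\<bar> \<le> M"
      using compact_imp_bounded[OF compact_continuous_image[OF u compact_Icc]]
      by (force simp: bounded_iff)
    then have "\<bar>u1 x\<bar> \<le> max M 0" for x
      by (auto simp: u1_def S_def le_max_iff_disj split: split_indicator)
    then show thesis by (rule that)
  qed
  have int_\<sigma>': "has_bochner_integral lborel \<sigma>' 1"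
  proof -
    have "has_bochner_integral lborel (\<lambda>x. \<sigma>' x * indicator {0..1} x) (\<sigma> 1 - \<sigma> 0)"
      by (rule has_bochner_integral_FTC_Icc_real)
        (use D\<sigma> c\<sigma>' in \<open>auto intro: continuous_on_interior[of UNIV]\<close>)
    moreover have "\<sigma>' x * indicator {0..1} x = \<sigma>' x" for x
      using \<sigma>'0[of x] \<sigma>'1[of x] by (auto split: split_indicator)
    ultimately show ?thesis using \<sigma>0[of 0] \<sigma>1[of 1] by simp
  qed
  have shift: "(\<integral>x. u1 x * (m n * \<sigma>' (m n * (x - r))) \<partial>lborel) = (\<integral>y. u1 (r + inverse (m n) * y) * \<sigma>' y \<partial>lborel)" for n r
  proof -
    have "(\<integral>x. u1 x * (m n * \<sigma>' (m n * (x - r))) \<partial>lborel)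
        = inverse (m n) * (\<integral>y. u1 (r + inverse (m n) * y) * (m n * \<sigma>' (m n * (r + inverse (m n) * y - r))) \<partial>lborel)"
      using m0[of n] by (subst lborel_integral_real_affine[of "inverse (m n)" _ r]) auto
    also have "(\<lambda>y. u1 (r + inverse (m n) * y) * (m n * \<sigma>' (m n * (r + inverse (m n) * y - r))))
        = (\<lambda>y. m n * (u1 (r + inverse (m n) * y) * \<sigma>' y))"
      using m0[of n] by (simp add: fun_eq_iff mult.assoc[symmetric])
    finally show ?thesis using m0[of n] by simp
  qed
  have conv: "(\<lambda>n. (\<integral>y. u1 (r + inverse (m n) * y) * \<sigma>' y \<partial>lborel)) \<longlonglongrightarrow> u r" if "r \<in> S" for r
  proof -
    have "(\<lambda>n. (\<integral>y. u1 (r + inverse (m n) * y) * \<sigma>' y \<partial>lborel)) \<longlonglongrightarrow> (\<integral>y. u r * \<sigma>' y \<partial>lborel)"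
    proof (rule integral_dominated_convergence)
      show "integrable lborel (\<lambda>y. M * \<bar>\<sigma>' y\<bar>)"
        using int_\<sigma>' by (auto simp: has_bochner_integral_iff)
      show "AE y in lborel. norm (u1 (r + inverse (m n) * y) * \<sigma>' y) \<le> M * \<bar>\<sigma>' y\<bar>" for n
        using M by (auto simp: abs_mult intro!: mult_right_mono)
      have "isCont u1 r"
      proof -
        have "isCont u r" using u that continuous_on_interior[of "{0..L}" u r] by (auto simp: S_def)
        moreover have "\<forall>\<^sub>F x in nhds r. u1 x = u x"
          by (rule eventually_nhds_in_open[of S, THEN eventually_mono])
            (use that in \<open>auto simp: S_def u1_def\<close>)
        ultimately show ?thesis using isCont_cong by blast
      qed
      moreover have "(\<lambda>n. r + inverse (m n) * y) \<longlonglongrightarrow> r" for y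
        using tendsto_add[OF tendsto_const tendsto_mult_right[OF m_inv, of y], of r] by simp
      ultimately have "(\<lambda>n. u1 (r + inverse (m n) * y)) \<longlonglongrightarrow> u1 r" for y
        by (rule isCont_tendsto_compose)
      then show "AE y in lborel. (\<lambda>n. u1 (r + inverse (m n) * y) * \<sigma>' y) \<longlonglongrightarrow> u r * \<sigma>' y"
        using that by (auto simp: u1_def intro!: tendsto_intros)
    qed measurable
    then show ?thesis using int_\<sigma>' by (simp add: has_bochner_integral_iff)
  qed
  have ibd: "integrable lborel (\<lambda>x. u1 x * (m n * \<sigma>' (m n * (x - r))))" for n r
  proof -
    have "integrable lborel (\<lambda>x. \<sigma>' (- m n * r + m n * x))"
      using lborel_integrable_real_affine[of \<sigma>' "m n" "- m n * r"] int_\<sigma>' m0[of n]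
      by (auto simp: has_bochner_integral_iff)
    then have "integrable lborel (\<lambda>x. M * (m n * \<sigma>' (m n * (x - r))))"
      by (simp add: algebra_simps)
    then show ?thesis
      by (rule Bochner_Integration.integrable_bound)
       (use M in \<open>auto simp: abs_mult intro!: mult_right_mono order.trans[OF M abs_ge_self]\<close>)
  qed
  have lhs: "(\<integral>x. u x * \<psi>' n x \<partial>lebesgue_on S)
      = (\<integral>y. u1 (s + inverse (m n) * y) * \<sigma>' y \<partial>lborel) - (\<integral>y. u1 (t + inverse (m n) * y) * \<sigma>' y \<partial>lborel)" for n
  proof -
    have "(\<integral>x. u x * \<psi>' n x \<partial>lebesgue_on S) = (\<integral>x. indicator S x * (u x * \<psi>' n x) \<partial>lebesgue)"
      using S by (subst integral_restrict_space) auto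
    also have "\<dots> = (\<integral>x. u1 x * \<psi>' n x \<partial>lebesgue)"
      by (simp add: u1_def mult.assoc)
    also have "\<dots> = (\<integral>x. u1 x * \<psi>' n x \<partial>lborel)"
      by (rule integral_completion) (simp add: \<psi>'_def)
    also have "\<dots> = (\<integral>x. u1 x * (m n * \<sigma>' (m n * (x - s))) - u1 x * (m n * \<sigma>' (m n * (x - t))) \<partial>lborel)"
      by (simp add: \<psi>'_def right_diff_distrib)
    also have "\<dots> = (\<integral>x. u1 x * (m n * \<sigma>' (m n * (x - s))) \<partial>lborel) - (\<integral>x. u1 x * (m n * \<sigma>' (m n * (x - t))) \<partial>lborel)"
      by (rule Bochner_Integration.integral_diff[OF ibd ibd])
    finally show ?thesis by (simp only: shift)
  qed
  have "(\<lambda>n. (\<integral>x. u x * \<psi>' n x \<partial>lebesgue_on S)) \<longlonglongrightarrow> u s - u t"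
    unfolding lhs by (intro tendsto_diff conv) (use st in \<open>auto simp: S_def\<close>)
  moreover have "(\<lambda>n. (\<integral>x. d x * \<psi> n x \<partial>lebesgue_on S)) \<longlonglongrightarrow> (\<integral>x. d x * indicator {s<..t} x \<partial>lebesgue_on S)"
  proof (rule integral_dominated_convergence)
    have di: "integrable (lebesgue_on S) d"
      using H1 unfolding S_def has_H1_gradient_def by (auto intro: L2_imp_integrable)
    then show "integrable (lebesgue_on S) (\<lambda>x. \<bar>d x\<bar>)" by simp
    have dm: "d \<in> borel_measurable (lebesgue_on S)" using di by simp
    have sub: "f \<in> borel_measurable (lebesgue_on S)" if "f \<in> borel_measurable borel" for f :: "real \<Rightarrow> real"
      using that by (intro measurable_restrict_space1 measurable_completion) simp
    have "\<psi> n \<in> borel_measurable borel" for n unfolding \<psi>_def by measurable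
    from borel_measurable_times[OF dm sub[OF this]]
    show "(\<lambda>x. d x * \<psi> n x) \<in> borel_measurable (lebesgue_on S)" for n .
    show "(\<lambda>x. d x * indicator {s<..t} x) \<in> borel_measurable (lebesgue_on S)"
      by (rule borel_measurable_times[OF dm sub]) simp
    have "\<bar>\<psi> n x\<bar> \<le> 1" for n x
      unfolding \<psi>_def using \<sigma>01[of "m n * x + (- m n * s)"] \<sigma>01[of "m n * x + (- m n * t)"] by linarith
    then show "AE x in lebesgue_on S. norm (d x * \<psi> n x) \<le> \<bar>d x\<bar>" for n
      by (simp add: abs_mult mult_left_le)
    have step: "(\<lambda>n. \<sigma> (m n * x + (- m n * r))) \<longlonglongrightarrow> indicator {r<..} x" for x r
    proof (cases "x \<le> r")
      case True
      then have "m n * x + (- m n * r) \<le> 0" for n using m0[of n] by simp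
      then show ?thesis using True \<sigma>0 by simp
    next
      case False
      have "\<forall>\<^sub>F n in sequentially. m n \<ge> 1 / (x - r)"
        using m_lim by (simp add: filterlim_at_top)
      then have "\<forall>\<^sub>F n in sequentially. \<sigma> (m n * x + (- m n * r)) = 1"
      proof eventually_elim
        case (elim n)
        then have "m n * x + (- m n * r) \<ge> 1" using False by (simp add: field_simps)
        then show ?case by (rule \<sigma>1)
      qed
      then show ?thesis using False by (simp add: tendsto_eventually)
    qed
    have ind: "indicator {s<..t} x = indicator {s<..} x - (indicator {t<..} x :: real)" for x
      using st by (auto split: split_indicator)
    show "AE x in lebesgue_on S. (\<lambda>n. d x * \<psi> n x) \<longlonglongrightarrow> d x * indicator {s<..t} x"
      unfolding \<psi>_def ind by (intro AE_I2 tendsto_intros step)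
  qed
  then have "(\<lambda>n. (\<integral>x. u x * \<psi>' n x \<partial>lebesgue_on S)) \<longlonglongrightarrow> - (\<integral>x. d x * indicator {s<..t} x \<partial>lebesgue_on S)"
    unfolding weak by (rule tendsto_minus)
  ultimately have "u s - u t = - (\<integral>x. d x * indicator {s<..t} x \<partial>lebesgue_on S)"
    by (rule LIMSEQ_unique)
  then show ?thesis by (simp add: S_def)
qed

text \<open>Continuity of \<open>u\<close> up to the ends carries the formula to the closed interval.\<close>

lemma weak_derivative_FTC:
  fixes u d :: "real \<Rightarrow> real"
  assumes H1: "has_H1_gradient {0<..<L} u d" and u: "continuous_on {0..L} u"
    and st: "0 \<le> s" "s \<le> t" "t \<le> L"
  shows "u t - u s = (\<integral>x. d x * indicator {s<..<t} x \<partial>lebesgue_on {0<..<L})"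
proof (cases "s = t")
  case False
  then have "s < t" using st by simp
  define \<delta> where "\<delta> n = (t - s) * (1 / (real n + 3))" for n
  have \<delta>0: "\<delta> n > 0" "2 * \<delta> n < t - s" for n
  proof -
    have "2 * (1 / (real n + 3)) < 1" by simp
    from mult_strict_left_mono[OF this, of "t - s"] \<open>s < t\<close> show "2 * \<delta> n < t - s"
      unfolding \<delta>_def by (simp only: mult.left_commute[of 2] diff_gt_0_iff_gt) simp
  qed (use \<open>s < t\<close> in \<open>simp add: \<delta>_def\<close>)
  have \<delta>: "\<delta> \<longlonglongrightarrow> 0" unfolding \<delta>_def by real_asymp
  have di: "integrable (lebesgue_on {0<..<L}) d"
    using H1 unfolding has_H1_gradient_def by (auto intro: L2_imp_integrable)
  then have dm: "d \<in> borel_measurable (lebesgue_on {0<..<L})" by simp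
  have sub: "f \<in> borel_measurable (lebesgue_on {0<..<L})" if "f \<in> borel_measurable borel" for f :: "real \<Rightarrow> real"
    using that by (intro measurable_restrict_space1 measurable_completion) simp
  have lim: "(\<lambda>n. (\<integral>x. d x * indicator {s + \<delta> n<..t - \<delta> n} x \<partial>lebesgue_on {0<..<L}))
      \<longlonglongrightarrow> (\<integral>x. d x * indicator {s<..<t} x \<partial>lebesgue_on {0<..<L})"
  proof (rule integral_dominated_convergence)
    show "integrable (lebesgue_on {0<..<L}) (\<lambda>x. \<bar>d x\<bar>)" using di by simp
    have "(\<lambda>n. indicator {s + \<delta> n<..t - \<delta> n} x) \<longlonglongrightarrow> (indicator {s<..<t} x :: real)" for x
    proof (cases "x \<in> {s<..<t}")
      case True
      then have "\<forall>\<^sub>F n in sequentially. \<delta> n < min (x - s) (t - x)"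
        by (intro order_tendstoD[OF \<delta>]) auto
      then have "\<forall>\<^sub>F n in sequentially. indicator {s + \<delta> n<..t - \<delta> n} x = (1::real)"
        by eventually_elim auto
      then show ?thesis using True by (simp add: tendsto_eventually)
    next
      case False
      then have "indicator {s + \<delta> n<..t - \<delta> n} x = (0::real)" for n
        using \<delta>0[of n] by (auto split: split_indicator)
      then show ?thesis using False by simp
    qed
    then show "AE x in lebesgue_on {0<..<L}. (\<lambda>n. d x * indicator {s + \<delta> n<..t - \<delta> n} x) \<longlonglongrightarrow> d x * indicator {s<..<t} x"
      by (intro AE_I2 tendsto_intros)
    show "AE x in lebesgue_on {0<..<L}. norm (d x * indicator {s + \<delta> n<..t - \<delta> n} x) \<le> \<bar>d x\<bar>" for n
      by (auto split: split_indicator)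
  qed (intro borel_measurable_times[OF dm sub], simp)+
  have eq: "(\<integral>x. d x * indicator {s + \<delta> n<..t - \<delta> n} x \<partial>lebesgue_on {0<..<L}) = u (t - \<delta> n) - u (s + \<delta> n)" for n
    by (rule weak_derivative_FTC_open[OF H1 u, symmetric]) (use \<delta>0[of n] st in auto)
  have "(\<lambda>n. u (t - \<delta> n) - u (s + \<delta> n)) \<longlonglongrightarrow> u t - u s"
  proof (intro tendsto_diff)
    show "(\<lambda>n. u (t - \<delta> n)) \<longlonglongrightarrow> u t"
    proof (rule continuous_on_tendsto_compose[OF u])
      show "(\<lambda>n. t - \<delta> n) \<longlonglongrightarrow> t" using \<delta> by (auto intro!: tendsto_eq_intros)
      have "t - \<delta> n \<in> {0..L}" for n using \<delta>0[of n] st by auto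
      then show "\<forall>\<^sub>F n in sequentially. t - \<delta> n \<in> {0..L}" by simp
    qed (use st in auto)
    show "(\<lambda>n. u (s + \<delta> n)) \<longlonglongrightarrow> u s"
    proof (rule continuous_on_tendsto_compose[OF u])
      show "(\<lambda>n. s + \<delta> n) \<longlonglongrightarrow> s" using \<delta> by (auto intro!: tendsto_eq_intros)
      have "s + \<delta> n \<in> {0..L}" for n using \<delta>0[of n] st by auto
      then show "\<forall>\<^sub>F n in sequentially. s + \<delta> n \<in> {0..L}" by simp
    qed (use st in auto)
  qed
  from LIMSEQ_unique[OF this lim[unfolded eq]] show ?thesis .
qed simp

section \<open>Triangles in adapted coordinates\<close>

text \<open>An orthonormal frame at the point \<open>a\<close>, with coordinate functions \<open>X\<close>, \<open>Y\<close> and their inverse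
  \<open>pt\<close>.\<close>

locale plane_frame =
  fixes a e1 e2 :: "real^2"
  assumes e11: "e1 \<bullet> e1 = 1" and e22: "e2 \<bullet> e2 = 1" and e12: "e1 \<bullet> e2 = 0"
begin

definition X :: "real^2 \<Rightarrow> real" where "X z = (z - a) \<bullet> e1"
definition Y :: "real^2 \<Rightarrow> real" where "Y z = (z - a) \<bullet> e2"
definition pt :: "real \<Rightarrow> real \<Rightarrow> real^2" where "pt x y = a + x *\<^sub>R e1 + y *\<^sub>R e2"

lemma e21: "e2 \<bullet> e1 = 0"
  using e12 by (simp add: inner_commute)

lemma X_pt [simp]: "X (pt x y) = x" and Y_pt [simp]: "Y (pt x y) = y"
  by (simp_all add: X_def Y_def pt_def inner_simps e11 e22 e12 e21)

lemma basis_expansion: "v = (v \<bullet> e1) *\<^sub>R e1 + (v \<bullet> e2) *\<^sub>R e2"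
proof -
  have ne: "e1 \<noteq> e2" "e1 \<noteq> 0" "e2 \<noteq> 0" using e11 e12 e22 by auto
  have "pairwise orthogonal {e1, e2}"
    by (auto simp: pairwise_def orthogonal_def e12 e21)
  then have ind: "independent {e1, e2}"
    using ne by (intro pairwise_orthogonal_independent) auto
  then have "span {e1, e2} = UNIV"
    using ne dim_eq_full[of "{e1,e2}"] dim_eq_card_independent[OF ind] by simp
  then have "v \<in> span {e1, e2}" by simp
  then obtain k l where v: "v = k *\<^sub>R e1 + l *\<^sub>R e2"
    unfolding span_insert span_empty by (auto simp: algebra_simps)
  show ?thesis unfolding v by (simp add: inner_simps e11 e22 e12 e21)
qed

lemma pt_XY [simp]: "pt (X z) (Y z) = z"
  using basis_expansion[of "z - a"] by (simp add: pt_def X_def Y_def algebra_simps)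

lemma XY_eqI: "X z = X w \<Longrightarrow> Y z = Y w \<Longrightarrow> z = w"
  by (metis pt_XY)

lemma inner_e: "v \<bullet> w = (v \<bullet> e1) * (w \<bullet> e1) + (v \<bullet> e2) * (w \<bullet> e2)"
  by (subst basis_expansion[of v]) (simp add: inner_simps inner_commute)

lemma continuous_on_X: "continuous_on S X" and continuous_on_Y: "continuous_on S Y"
  by (auto simp: X_def[abs_def] Y_def[abs_def] intro!: continuous_intros)

lemma X_measurable [measurable]: "X \<in> borel_measurable borel"
  and Y_measurable [measurable]: "Y \<in> borel_measurable borel"
  by (simp_all add: borel_measurable_continuous_onI continuous_on_X continuous_on_Y)

lemma pt_measurable: "(\<lambda>(x, y). pt x y) \<in> borel_measurable (lborel \<Otimes>\<^sub>M lborel)"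
  unfolding pt_def by measurable

text \<open>The coordinate map is the standard identification of pairs with vectors, followed by a
  rotation or reflection and a translation; each of them preserves Lebesgue measure.\<close>

lemma distr_pt: "distr (lborel \<Otimes>\<^sub>M lborel) borel (\<lambda>(x, y). pt x y) = lborel"
proof -
  define J :: "real \<times> real \<Rightarrow> real^2" where "J = (\<lambda>(x, y). x *\<^sub>R axis 1 1 + y *\<^sub>R axis 2 1)"
  define f :: "real^2 \<Rightarrow> real^2" where "f v = (v $ 1) *\<^sub>R e1 + (v $ 2) *\<^sub>R e2" for v
  define f' :: "real^2 \<Rightarrow> real^2" where "f' v = vector [v \<bullet> e1, v \<bullet> e2]" for v
  have Jm: "J \<in> borel_measurable borel"
    unfolding J_def case_prod_beta by (intro borel_measurable_continuous_onI)
      (intro continuous_intros)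
  have J: "distr lborel borel J = lborel"
  proof (rule lborel_eqI[symmetric])
    fix l u :: "real^2" assume lu: "\<And>b. b \<in> Basis \<Longrightarrow> l \<bullet> b \<le> u \<bullet> b"
    have le: "l $ i \<le> u $ i" for i using lu[of "axis i 1"] by (simp add: inner_axis)
    have "J -` box l u = box (l $ 1, l $ 2) (u $ 1, u $ 2)"
      by (auto simp: J_def mem_box_cart forall_2 box_prod axis_def)
    then have "emeasure (distr lborel borel J) (box l u)
        = emeasure (lborel :: (real \<times> real) measure) (box (l $ 1, l $ 2) (u $ 1, u $ 2))"
      using Jm by (simp add: emeasure_distr)
    also have "\<dots> = ennreal (\<Prod>b\<in>Basis. (u - l) \<bullet> b)"
      using le by (subst emeasure_lborel_box)
        (auto simp: Basis_prod_def Basis_vec_def sum_2 UNIV_2 inner_axis axis_eq_axis prod.UNION_disjoint)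
    finally show "emeasure (distr lborel borel J) (box l u) = (\<Prod>b\<in>Basis. (u - l) \<bullet> b)" .
  qed simp
  have "linear f'"
    by (rule linearI) (simp_all add: f'_def vec_eq_iff forall_2 inner_add_left)
  moreover have "f' v \<bullet> f' w = v \<bullet> w" for v w
  proof -
    have "f' v \<bullet> f' w = f' v $ 1 * f' w $ 1 + f' v $ 2 * f' w $ 2"
      by (simp add: inner_vec_def[of "f' v"] sum_2)
    then show ?thesis by (simp add: f'_def inner_e[symmetric])
  qed
  ultimately have orth: "orthogonal_transformation f'"
    by (simp add: orthogonal_transformation_def)
  have ff': "f (f' v) = v" for v
    using basis_expansion[of v] by (simp add: f_def f'_def)
  have f'f: "f' (f v) = v" for v
    by (simp add: f_def f'_def vec_eq_iff forall_2 inner_simps e11 e22 e12 e21)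
  have fm: "f \<in> borel_measurable borel"
    by (auto simp: f_def[abs_def] intro!: borel_measurable_continuous_onI continuous_intros)
  have F: "distr lborel borel f = lborel"
  proof (rule lborel_eqI[symmetric])
    fix l u :: "real^2" assume lu: "\<And>b. b \<in> Basis \<Longrightarrow> l \<bullet> b \<le> u \<bullet> b"
    have "f -` box l u = f' ` box l u"
      using ff' f'f by (auto simp: image_iff) (metis ff' f'f)+
    moreover have "f' ` box l u \<in> lmeasurable"
      and "measure lebesgue (f' ` box l u) = measure lebesgue (box l u)"
      using measurable_orthogonal_image[OF orth] measure_orthogonal_image[OF orth] by simp_all
    ultimately have "emeasure lebesgue (f -` box l u) = emeasure lebesgue (box l u)"
      by (simp add: emeasure_eq_measure2)
    moreover have "f -` box l u \<in> sets borel" using fm by (metis borel_open inf_top_right measurable_sets open_box space_borel)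
    ultimately show "emeasure (distr lborel borel f) (box l u) = (\<Prod>b\<in>Basis. (u - l) \<bullet> b)"
      using fm lu by (simp add: emeasure_distr)
  qed simp
  have "distr (lborel \<Otimes>\<^sub>M lborel) borel (\<lambda>(x, y). pt x y)
      = distr (distr (distr lborel borel J) borel f) borel ((+) a)"
    using fm Jm by (simp add: distr_distr lborel_prod o_def)
      (simp add: J_def f_def pt_def case_prod_unfold axis_def add.assoc)
  then show ?thesis by (simp add: J F lborel_distr_plus)
qed

end

text \<open>The second frame vector is a normal of \<open>b - a\<close>, with its sign chosen to point to the side of
  \<open>c\<close>.\<close>

lemma frame_exists:
  fixes a b c :: "real^2"
  assumes "\<not> affine_dependent {a, b, c}" "a \<noteq> b" "a \<noteq> c" "b \<noteq> c"
  obtains e1 e2 where "plane_frame e1 e2" "b - a = dist a b *\<^sub>R e1" "(c - a) \<bullet> e2 > 0"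
proof -
  define e1 where "e1 = (1 / dist a b) *\<^sub>R (b - a)"
  define r :: "real^2" where "r = vector [- (e1 $ 2), e1 $ 1]"
  have ba: "b - a = dist a b *\<^sub>R e1" using \<open>a \<noteq> b\<close> by (simp add: e1_def)
  have "norm e1 = 1" using \<open>a \<noteq> b\<close> by (simp add: e1_def dist_norm norm_minus_commute)
  then have e11: "e1 \<bullet> e1 = 1" by (simp add: dot_square_norm)
  then have fr: "plane_frame e1 r" "plane_frame e1 (- r)"
    by (unfold_locales; simp add: r_def inner_vec_def sum_2)+
  have "(c - a) \<bullet> r \<noteq> 0"
  proof
    assume 0: "(c - a) \<bullet> r = 0"
    then have "c - a = ((c - a) \<bullet> e1) *\<^sub>R e1"
      using plane_frame.basis_expansion[OF fr(1), of "c - a"] by simp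
    also have "\<dots> = (((c - a) \<bullet> e1) / dist a b) *\<^sub>R (b - a)" by (simp add: e1_def)
    finally have "c = a + (((c - a) \<bullet> e1) / dist a b) *\<^sub>R (b - a)" by (simp add: algebra_simps)
    then have "c \<in> affine hull {a, b}"
      unfolding affine_hull_2_alt by blast
    then have "affine_dependent (insert c {a, b})"
      using assms by (auto simp: affine_dependent_def)
    with assms(1) show False by (simp add: insert_commute)
  qed
  then consider "(c - a) \<bullet> r > 0" | "(c - a) \<bullet> (- r) > 0" by (force simp: inner_minus_right)
  then show thesis
    using that[OF fr(1) ba] that[OF fr(2) ba] by cases auto
qed

text \<open>The reciprocal of the height of the triangle above the point \<open>x\<close> of its base. The
  difference function and its gradient depend affinely on it and its derivative. For \<open>p = 0\<close> and \<open>x = 0\<close> the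
  first branch would be \<open>0 / 0 = 0\<close>; the condition \<open>0 < p\<close> selects the other one, which is correct.\<close>
definition inv_height :: "real \<Rightarrow> real \<Rightarrow> real \<Rightarrow> real \<Rightarrow> real" where
  "inv_height L p H x = (if 0 < p \<and> x \<le> p then p / (H * x) else (L - p) / (H * (L - x)))"

text \<open>The height above \<open>x\<close> is the smaller of the two bounds that the slanted sides impose, hence
  it satisfies both and attains one of them.\<close>

lemma inv_height:
  assumes "L > 0" "H > 0" "0 < x" "x < L"
  shows inv_height_pos: "inv_height L p H x > 0"
    and inv_height_le1: "p * (1 / inv_height L p H x) \<le> H * x"
    and inv_height_le2: "(L - p) * (1 / inv_height L p H x) \<le> H * (L - x)"
    and inv_height_eq: "0 < p \<and> p * (1 / inv_height L p H x) = H * x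
       \<or> p < L \<and> (L - p) * (1 / inv_height L p H x) = H * (L - x)"
proof -
  let ?s = "inv_height L p H x"
  have "?s > 0 \<and> p * (1 / ?s) \<le> H * x \<and> (L - p) * (1 / ?s) \<le> H * (L - x) \<and>
    (0 < p \<and> p * (1 / ?s) = H * x \<or> p < L \<and> (L - p) * (1 / ?s) = H * (L - x))"
  proof (cases "0 < p \<and> x \<le> p")
    case True
    then have s: "1 / ?s = H * x / p" by (simp add: inv_height_def)
    have "H * (L * x) \<le> H * (L * p)" using True assms by simp
    then have "(L - p) * (H * x / p) \<le> H * (L - x)"
      using True by (simp add: field_simps)
    moreover have "?s > 0" using True assms by (simp add: inv_height_def)
    ultimately show ?thesis using True unfolding s by simp
  next
    case False
    then have s: "1 / ?s = H * (L - x) / (L - p)" and pL: "p < L" "p < x"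
      using assms by (auto simp: inv_height_def)
    have "H * (L * p) \<le> H * (L * x)" using pL assms by simp
    then have "p * (H * (L - x) / (L - p)) \<le> H * x"
      using pL by (simp add: field_simps)
    moreover have "?s > 0" using False pL assms by (simp add: inv_height_def)
    ultimately show ?thesis using pL unfolding s by simp
  qed
  then show "?s > 0" "p * (1 / ?s) \<le> H * x" "(L - p) * (1 / ?s) \<le> H * (L - x)"
    "0 < p \<and> p * (1 / ?s) = H * x \<or> p < L \<and> (L - p) * (1 / ?s) = H * (L - x)" by auto
qed

lemma inv_height_less_iff:
  assumes "L > 0" "H > 0" "0 < x" "x < L" "0 \<le> y"
  shows "p * y < H * x \<and> (L - p) * y < H * (L - x) \<longleftrightarrow> y * inv_height L p H x < 1"
proof -
  let ?s = "inv_height L p H x"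
  have s: "?s > 0" using assms by (intro inv_height_pos)
  have "p * y < H * x \<and> (L - p) * y < H * (L - x) \<longleftrightarrow> y < 1 / ?s"
  proof
    assume L: "p * y < H * x \<and> (L - p) * y < H * (L - x)"
    from inv_height_eq[OF assms(1-4), of p] show "y < 1 / ?s"
    proof
      assume "0 < p \<and> p * (1 / ?s) = H * x"
      with L have "0 < p" "p * y < p * (1 / ?s)" by auto
      then show ?thesis using mult_less_cancel_left_pos by blast
    next
      assume "p < L \<and> (L - p) * (1 / ?s) = H * (L - x)"
      with L have "0 < L - p" "(L - p) * y < (L - p) * (1 / ?s)" by auto
      then show ?thesis using mult_less_cancel_left_pos by blast
    qed
  next
    assume y: "y < 1 / ?s"
    have "k * y < r" if "k * (1 / ?s) \<le> r" "0 < r" for k r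
    proof (cases "k > 0")
      case True
      then have "k * y < k * (1 / ?s)" using y by (rule mult_strict_left_mono[rotated])
      then show ?thesis using that by linarith
    next
      case False
      then have "k * y \<le> 0" using \<open>0 \<le> y\<close> by (simp add: mult_le_0_iff)
      then show ?thesis using that by linarith
    qed
    then show "p * y < H * x \<and> (L - p) * y < H * (L - x)"
      using inv_height_le1 inv_height_le2 assms by simp
  qed
  also have "\<dots> \<longleftrightarrow> y * ?s < 1" using s by (simp add: field_simps)
  finally show ?thesis .
qed

locale triangle_frame = plane_frame +
  fixes L p H :: real
  assumes L: "L > 0" and H: "H > 0"
begin

definition \<Delta> :: "(real^2) set" where "\<Delta> = convex hull {pt 0 0, pt L 0, pt p H}"
definition base :: "(real^2) set" where "base = closed_segment (pt 0 0) (pt L 0)"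

text \<open>The three inequalities say that the barycentric coordinates are nonnegative.\<close>

lemma triangle_eq: "\<Delta> = {z. 0 \<le> Y z \<and> p * Y z \<le> H * X z \<and> (L - p) * Y z \<le> H * (L - X z)}"
proof (intro set_eqI iffI)
  fix z assume "z \<in> \<Delta>"
  then obtain u v w where uvw: "0 \<le> u" "0 \<le> v" "0 \<le> w" "u + v + w = 1"
    and z: "z = u *\<^sub>R pt 0 0 + v *\<^sub>R pt L 0 + w *\<^sub>R pt p H"
    by (auto simp: \<Delta>_def convex_hull_3)
  have u: "u = 1 - v - w" using uvw by simp
  have "z = pt (v * L + w * p) (w * H)"
    unfolding z u by (simp add: pt_def algebra_simps)
  then have XY: "X z = v * L + w * p" "Y z = w * H" by simp_all
  have "H * (L - X z) = H * (u * L) + (L - p) * Y z" unfolding XY u by (simp add: algebra_simps)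
  moreover have "H * X z = H * (v * L) + p * Y z" unfolding XY by (simp add: algebra_simps)
  moreover have "0 \<le> H * (u * L)" "0 \<le> H * (v * L)" "0 \<le> Y z" using uvw L H XY by simp_all
  ultimately show "z \<in> {z. 0 \<le> Y z \<and> p * Y z \<le> H * X z \<and> (L - p) * Y z \<le> H * (L - X z)}" by simp
next
  fix z assume z: "z \<in> {z. 0 \<le> Y z \<and> p * Y z \<le> H * X z \<and> (L - p) * Y z \<le> H * (L - X z)}"
  define w v u where "w = Y z / H" and "v = (H * X z - p * Y z) / (H * L)"
    and "u = (H * (L - X z) - (L - p) * Y z) / (H * L)"
  have "0 \<le> u" "0 \<le> v" "0 \<le> w" using z L H by (simp_all add: u_def v_def w_def)
  moreover have u: "u = 1 - v - w" using L H by (simp add: u_def v_def w_def field_simps)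
  moreover have "z = u *\<^sub>R pt 0 0 + v *\<^sub>R pt L 0 + w *\<^sub>R pt p H"
  proof -
    have "u *\<^sub>R pt 0 0 + v *\<^sub>R pt L 0 + w *\<^sub>R pt p H = pt (v * L + w * p) (w * H)"
      unfolding u by (simp add: pt_def algebra_simps)
    also have "v * L + w * p = X z" using L H by (simp add: v_def w_def field_simps)
    also have "w * H = Y z" using H by (simp add: w_def)
    finally show ?thesis by simp
  qed
  ultimately show "z \<in> \<Delta>" unfolding \<Delta>_def convex_hull_3 by force
qed

lemma interior_triangle: "interior \<Delta> = {z. 0 < Y z \<and> p * Y z < H * X z \<and> (L - p) * Y z < H * (L - X z)}" (is "_ = ?S")
proof
  have "open ?S"
    by (intro open_Collect_conj open_Collect_less continuous_intros continuous_on_X continuous_on_Y)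
  moreover have "?S \<subseteq> \<Delta>" by (auto simp: triangle_eq)
  ultimately show "?S \<subseteq> interior \<Delta>" by (rule interior_maximal[rotated])
next
  show "interior \<Delta> \<subseteq> ?S"
  proof
    fix z assume "z \<in> interior \<Delta>"
    then obtain r where r: "r > 0" "cball z r \<subseteq> \<Delta>" by (auto simp: mem_interior_cball)
    have ne: "norm e1 = 1" "norm e2 = 1" using e11 e22 by (simp_all add: norm_eq_1)
    have "z - r *\<^sub>R e2 \<in> \<Delta>" "z - r *\<^sub>R e1 \<in> \<Delta>" "z + r *\<^sub>R e1 \<in> \<Delta>"
      using r ne by (auto intro!: subsetD[OF r(2)] simp: dist_norm)
    moreover have "Y (z - r *\<^sub>R e2) = Y z - r" "X (z - r *\<^sub>R e1) = X z - r" "Y (z - r *\<^sub>R e1) = Y z"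
      "X (z + r *\<^sub>R e1) = X z + r" "Y (z + r *\<^sub>R e1) = Y z"
      by (simp_all add: X_def Y_def inner_simps e11 e22 e12 e21)
    ultimately have "0 \<le> Y z - r" "p * Y z \<le> H * (X z - r)" "(L - p) * Y z \<le> H * (L - (X z + r))"
      by (simp_all add: triangle_eq)
    moreover have "H * (X z - r) < H * X z" "H * (L - (X z + r)) < H * (L - X z)" using H r by simp_all
    ultimately show "z \<in> ?S" using r by simp
  qed
qed

lemma compact_triangle: "compact \<Delta>" and convex_triangle: "convex \<Delta>"
  unfolding \<Delta>_def by (auto intro: finite_imp_compact_convex_hull)

lemma frontier_triangle: "frontier \<Delta> = \<Delta> - interior \<Delta>"
  using compact_triangle by (simp add: frontier_def compact_imp_closed)

lemma base_eq: "base = {z. Y z = 0 \<and> 0 \<le> X z \<and> X z \<le> L}"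
proof (intro set_eqI iffI)
  fix z assume "z \<in> base"
  then obtain u where u: "0 \<le> u" "u \<le> 1" "z = (1 - u) *\<^sub>R pt 0 0 + u *\<^sub>R pt L 0"
    by (auto simp: base_def in_segment)
  then have "z = pt (u * L) 0" by (simp add: pt_def algebra_simps)
  then show "z \<in> {z. Y z = 0 \<and> 0 \<le> X z \<and> X z \<le> L}" using u L by (simp add: mult_left_le_one_le)
next
  fix z assume z: "z \<in> {z. Y z = 0 \<and> 0 \<le> X z \<and> X z \<le> L}"
  have "z = (1 - X z / L) *\<^sub>R pt 0 0 + (X z / L) *\<^sub>R pt L 0"
  proof (rule XY_eqI)
    have eq: "(1 - X z / L) *\<^sub>R pt 0 0 + (X z / L) *\<^sub>R pt L 0 = pt (X z) 0"
      using L by (simp add: pt_def algebra_simps)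
    show "X z = X ((1 - X z / L) *\<^sub>R pt 0 0 + (X z / L) *\<^sub>R pt L 0)" unfolding eq by simp
    show "Y z = Y ((1 - X z / L) *\<^sub>R pt 0 0 + (X z / L) *\<^sub>R pt L 0)" unfolding eq using z by simp
  qed
  then show "z \<in> base" unfolding base_def in_segment using z L by (intro exI[of _ "X z / L"]) auto
qed

lemma orthogonal_line_base: "orthogonal_line base z = {w. X w = X z}"
proof -
  have "(w - z) \<bullet> (q - r) = (X w - X z) * (X q - X r)" if "Y q = 0" "Y r = 0" for w q r
    using that inner_e[of "w - z" "q - r"] by (simp add: X_def Y_def inner_simps algebra_simps)
  note * = this
  show ?thesis
  proof (intro set_eqI iffI)
    fix w assume "w \<in> orthogonal_line base z"
    then have "(w - z) \<bullet> (pt L 0 - pt 0 0) = 0"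
      by (simp add: orthogonal_line_def base_def)
    then show "w \<in> {w. X w = X z}" using *[of "pt L 0" "pt 0 0" w] L by simp
  qed (auto simp: orthogonal_line_def base_eq *)
qed

text \<open>The vertical line through an interior point leaves the triangle in one point above and one
  point below it. Linear interpolation between these two points reproduces the affine \<open>u\<close>, so
  only \<open>w - u\<close> matters, and that vanishes at the upper point. The lower point lies on the base
  if \<open>0 < X z < L\<close>; otherwise \<open>w - u\<close> vanishes there as well.\<close>

lemma linear_extension_minus_affine:
  assumes u: "\<And>y. y \<in> \<Delta> \<Longrightarrow> u y = k + d \<bullet> y"
    and on: "\<And>y. y \<in> base \<Longrightarrow> w y - u y = \<phi> (X y)"
    and off: "\<And>y. y \<in> frontier \<Delta> \<Longrightarrow> Y y \<noteq> 0 \<Longrightarrow> w y = u y"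
    and \<phi>: "\<And>x. x \<le> 0 \<Longrightarrow> \<phi> x = 0" "\<And>x. L \<le> x \<Longrightarrow> \<phi> x = 0"
    and z: "z \<in> interior \<Delta>"
  shows "linear_extension \<Delta> base w z - u z = \<phi> (X z) * (1 - Y z * inv_height L p H (X z))"
proof -
  have e2: "e2 \<noteq> 0" "norm e2 = 1" using e22 by (auto simp: norm_eq_1)
  have bd: "bounded \<Delta>" using compact_triangle by (rule compact_imp_bounded)
  obtain d2 where d2: "0 < d2" "z + d2 *\<^sub>R e2 \<in> frontier \<Delta>"
    "\<And>t. 0 \<le> t \<Longrightarrow> t < d2 \<Longrightarrow> z + t *\<^sub>R e2 \<in> interior \<Delta>"
    using ray_to_frontier[OF bd z e2(1)] by blast
  obtain d1 where d1: "0 < d1" "z + d1 *\<^sub>R (- e2) \<in> frontier \<Delta>"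
    "\<And>t. 0 \<le> t \<Longrightarrow> t < d1 \<Longrightarrow> z + t *\<^sub>R (- e2) \<in> interior \<Delta>"
    using ray_to_frontier[OF bd z, of "- e2"] e2(1) by (metis neg_equal_0_iff_equal)
  define z1 where "z1 = z - d1 *\<^sub>R e2"
  define z2 where "z2 = z + d2 *\<^sub>R e2"
  have XY: "X (z + t *\<^sub>R e2) = X z" "Y (z + t *\<^sub>R e2) = Y z + t" for t
    by (simp_all add: X_def Y_def inner_simps e22 e21)
  have z1XY: "X z1 = X z" "Y z1 = Y z - d1" using XY[of "- d1"] by (simp_all add: z1_def)
  have z2XY: "X z2 = X z" "Y z2 = Y z + d2" using XY[of d2] by (simp_all add: z2_def)
  have fr: "z1 \<in> frontier \<Delta>" "z2 \<in> frontier \<Delta>" using d1(2) d2(2) by (simp_all add: z1_def z2_def)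
  \<comment> \<open>By convexity, a vertical ray has left the triangle for good once it has hit the frontier.\<close>
  have beyond: False if d: "z + t0 *\<^sub>R v \<in> frontier \<Delta>" "z + t *\<^sub>R v \<in> \<Delta>" "0 < t0" "t0 < t" "v \<noteq> 0" for t0 t v
  proof -
    have "z + t0 *\<^sub>R v \<in> open_segment z (z + t *\<^sub>R v)"
      unfolding in_segment using d by (intro conjI exI[of _ "t0 / t"]) (auto simp: algebra_simps)
    moreover have "open_segment z (z + t *\<^sub>R v) \<subseteq> interior \<Delta>"
      using in_interior_closure_convex_segment[OF convex_triangle z] d(2) closure_subset by blast
    ultimately show False using d(1) by (auto simp: frontier_triangle)
  qed
  have line: "orthogonal_line base z \<inter> frontier \<Delta> = {z1, z2}"
  proof (intro equalityI subsetI)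
    fix y assume "y \<in> orthogonal_line base z \<inter> frontier \<Delta>"
    then have y: "X y = X z" "y \<in> frontier \<Delta>" by (simp_all add: orthogonal_line_base)
    define t where "t = Y y - Y z"
    have yt: "y = z + t *\<^sub>R e2" by (rule XY_eqI) (simp_all add: XY y t_def)
    have yi: "y \<notin> interior \<Delta>" "y \<in> \<Delta>" using y by (simp_all add: frontier_triangle)
    show "y \<in> {z1, z2}"
    proof (cases "0 \<le> t")
      case True
      then have "d2 \<le> t" using d2(3)[of t] yi yt by force
      moreover have "\<not> d2 < t" using beyond[OF d2(2), of t] yi yt d2(1) e2(1) by auto
      ultimately show ?thesis using yt by (simp add: z2_def)
    next
      case False
      then have "d1 \<le> - t" using d1(3)[of "- t"] yi yt by force
      moreover have "\<not> d1 < - t" using beyond[OF d1(2), of "- t"] yi yt d1(1) e2(1) by auto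
      ultimately have "t = - d1" by linarith
      then show ?thesis using yt by (simp add: z1_def)
    qed
  qed (use fr z1XY z2XY in \<open>auto simp: orthogonal_line_base\<close>)
  have dist: "dist z z1 = d1" "dist z z2 = d2"
    using d1 d2 e2 by (simp_all add: z1_def z2_def dist_norm)
  have Yz: "Y z > 0" using z by (simp add: interior_triangle)
  have foot: "y = z1" if "y \<in> base" "X y = X z" for y
  proof -
    have Y0: "Y y = 0" "0 \<le> X y" "X y \<le> L" using that by (simp_all add: base_eq)
    have "y \<in> \<Delta>" using Y0 H by (simp add: triangle_eq)
    moreover have "y \<notin> interior \<Delta>" using Y0 by (simp add: interior_triangle)
    ultimately have "y \<in> {z1, z2}" using that line by (auto simp: frontier_triangle orthogonal_line_base)
    then show ?thesis using Y0 z2XY Yz d2(1) by auto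
  qed
  have sum: "d1 + d2 \<noteq> 0" using d1 d2 by simp
  let ?V = "(d2 * w z1 + d1 * w z2) / (d1 + d2)"
  have "linear_extension \<Delta> base w z = ?V"
    unfolding linear_extension_def
  proof (rule the_equality, goal_cases)
    case 1
    show ?case
    proof (rule exI[of _ z1], rule exI[of _ z2], intro conjI impI)
      assume "orthogonal_line base z \<inter> base \<noteq> {}"
      then obtain y where "y \<in> base" "X y = X z" by (auto simp: orthogonal_line_base)
      with foot show "z1 \<in> base" by blast
    qed (simp_all add: line dist)
  next
    case (2 V)
    then obtain y1 y2 where y: "{z1, z2} = {y1, y2}"
      and V: "V = (dist z y2 * w y1 + dist z y1 * w y2) / (dist z y1 + dist z y2)"
      unfolding line by blast
    from y have "y1 = z1 \<and> y2 = z2 \<or> y1 = z2 \<and> y2 = z1" by (auto simp: doubleton_eq_iff)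
    then show ?case unfolding V by (auto simp: dist algebra_simps)
  qed
  moreover have "?V - u z = (d2 * (w z1 - u z1) + d1 * (w z2 - u z2)) / (d1 + d2)"
  proof -
    have *: "u z1 = u z - d1 * (d \<bullet> e2)" "u z2 = u z + d2 * (d \<bullet> e2)"
      using fr z interior_subset[of \<Delta>] by (auto simp: u frontier_triangle z1_def z2_def inner_simps)
    show ?thesis unfolding * using sum by (simp add: field_simps)
  qed
  moreover have "w z2 - u z2 = 0" using off[OF fr(2)] z2XY Yz d2 by simp
  ultimately have eq: "linear_extension \<Delta> base w z - u z = d2 * (w z1 - u z1) / (d1 + d2)" by simp
  show ?thesis
  proof (cases "0 < X z \<and> X z < L")
    case True
    let ?s = "inv_height L p H (X z)"
    have s: "?s > 0" using inv_height_pos[OF L H] True by simp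
    have "pt (X z) 0 \<in> base" using True by (simp add: base_eq)
    with foot[of "pt (X z) 0"] have z1: "z1 = pt (X z) 0" "z1 \<in> base" by auto
    then have "d1 = Y z" using z1XY by simp
    moreover have "w z1 - u z1 = \<phi> (X z)" using on[OF z1(2)] z1XY by simp
    moreover have "d2 = 1 / ?s - Y z"
    proof -
      have m: "pt (X z) (1 / ?s) \<in> \<Delta>" "pt (X z) (1 / ?s) \<notin> interior \<Delta>"
        using s inv_height_le1[OF L H, of "X z" p] inv_height_le2[OF L H, of "X z" p]
          inv_height_eq[OF L H, of "X z" p] True
        unfolding interior_triangle by (auto simp: triangle_eq)
      then have "pt (X z) (1 / ?s) \<in> {z1, z2}"
        unfolding line[symmetric] by (simp add: frontier_triangle orthogonal_line_base)
      then have "Y z1 = 1 / ?s \<or> Y z2 = 1 / ?s" by (metis Y_pt insertE singletonD)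
      then show ?thesis using z1 s z2XY by auto
    qed
    ultimately have *: "w z1 - u z1 = \<phi> (X z)" "d1 + d2 = 1 / ?s" "d2 = 1 / ?s - Y z"
      by simp_all
    show ?thesis unfolding eq *(1,2) unfolding *(3) using s by (simp add: field_simps)
  next
    case False
    then have "\<phi> (X z) = 0" using \<phi> by force
    moreover have "w z1 - u z1 = 0"
    proof (cases "Y z1 = 0")
      case True
      moreover have "z1 \<in> \<Delta>" using fr(1) by (simp add: frontier_triangle)
      ultimately have "z1 \<in> base" using H by (auto simp: triangle_eq base_eq zero_le_mult_iff)
      from on[OF this] show ?thesis using z1XY \<open>\<phi> (X z) = 0\<close> by simp
    qed (use off[OF fr(1)] in simp)
    ultimately show ?thesis unfolding eq by simp
  qed
qed

end

section \<open>Edges and angles in a shape-regular mesh\<close>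

lemma triangle_third_vertex:
  assumes "2 simplex T" "x extreme_point_of T" "y extreme_point_of T" "x \<noteq> y"
  obtains r where "T = convex hull {x, y, r}" "\<not> affine_dependent {x, y, r}" "r \<noteq> x" "r \<noteq> y"
proof -
  obtain C where C: "\<not> affine_dependent C" "int (card C) = 2 + 1" "T = convex hull C"
    using assms(1) unfolding simplex_def by auto
  have "x \<in> C" "y \<in> C"
    using assms C by (auto simp: extreme_point_of_convex_hull_affine_independent)
  moreover have "card C = 3" using C(2) by simp
  ultimately have "card (C - {x, y}) = 1" using \<open>x \<noteq> y\<close> by (simp add: card_Diff_subset)
  then obtain r where r: "C - {x, y} = {r}" by (rule card_1_singletonE)
  then have "C = {x, y, r}" "r \<noteq> x" "r \<noteq> y" using \<open>x \<in> C\<close> \<open>y \<in> C\<close> by auto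
  then show thesis using that C by metis
qed

lemma triangle_frame_exists:
  fixes a b c :: "real^2"
  assumes "\<not> affine_dependent {a, b, c}" "a \<noteq> b" "c \<noteq> a" "c \<noteq> b"
  obtains e1 e2 p H where "triangle_frame e1 e2 (dist a b) H" "plane_frame.pt a e1 e2 0 0 = a"
    "plane_frame.pt a e1 e2 (dist a b) 0 = b" "plane_frame.pt a e1 e2 p H = c"
    "b - a = dist a b *\<^sub>R e1"
proof -
  obtain e1 e2 where fr: "plane_frame e1 e2" and ba: "b - a = dist a b *\<^sub>R e1" and c: "(c - a) \<bullet> e2 > 0"
    using frame_exists[OF assms(1,2)] assms(3,4) by metis
  interpret plane_frame a e1 e2 by (rule fr)
  have "triangle_frame e1 e2 (dist a b) (Y c)"
    using fr c \<open>a \<noteq> b\<close> by (simp add: triangle_frame_def triangle_frame_axioms_def Y_def)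
  moreover have "pt (dist a b) 0 = b" using ba by (simp add: pt_def algebra_simps)
  ultimately show thesis using that[of e1 e2 "Y c" "X c"] ba by (simp add: pt_def[of 0])
qed

text \<open>The vector \<open>n\<close> is an inner normal of the edge. Near a relatively interior point of the edge,
  only the half plane that it bounds restricts the triangle.\<close>

lemma half_disc_in_triangle:
  fixes x y r n :: "real^2"
  assumes "\<not> affine_dependent {x, y, r}" "x \<noteq> y" "r \<noteq> x" "r \<noteq> y"
    and n: "n \<bullet> (y - x) = 0" "n \<bullet> (r - x) > 0" and z: "z \<in> open_segment x y"
  shows "\<exists>\<epsilon>>0. \<forall>w\<in>ball z \<epsilon>. n \<bullet> (w - x) \<ge> 0 \<longrightarrow> w \<in> convex hull {x, y, r}"
proof -
  obtain e1 e2 p H where fr: "triangle_frame e1 e2 (dist x y) H" and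
    pts: "plane_frame.pt x e1 e2 0 0 = x" "plane_frame.pt x e1 e2 (dist x y) 0 = y" "plane_frame.pt x e1 e2 p H = r"
    and yx: "y - x = dist x y *\<^sub>R e1"
    using triangle_frame_exists[OF assms(1-4)] by metis
  interpret triangle_frame x e1 e2 "dist x y" p H by (rule fr)
  have T: "convex hull {x, y, r} = \<Delta>" unfolding \<Delta>_def pts ..
  have "n \<bullet> e1 = 0" using n(1) L unfolding yx by simp
  then have side: "n \<bullet> (w - x) = (n \<bullet> e2) * Y w" for w
    using inner_e[of n "w - x"] by (simp add: Y_def)
  have "Y r = H" unfolding pts(3)[symmetric] by simp
  then have ne: "n \<bullet> e2 > 0" using n(2) H unfolding side by (simp add: zero_less_mult_iff)
  let ?S = "{w. p * Y w < H * X w \<and> (dist x y - p) * Y w < H * (dist x y - X w)}"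
  have "open ?S"
    by (intro open_Collect_conj open_Collect_less continuous_intros continuous_on_X continuous_on_Y)
  moreover have "z \<in> ?S"
  proof -
    obtain u where u: "0 < u" "u < 1" "z = (1 - u) *\<^sub>R x + u *\<^sub>R y"
      using z by (auto simp: in_segment)
    then have "z = x + u *\<^sub>R (y - x)" by (simp add: algebra_simps)
    then have "z = pt (u * dist x y) 0" unfolding yx by (simp add: pt_def)
    then show ?thesis using u H L by simp
  qed
  ultimately obtain \<epsilon> where \<epsilon>: "\<epsilon> > 0" "ball z \<epsilon> \<subseteq> ?S" by (rule openE)
  have "w \<in> \<Delta>" if "w \<in> ball z \<epsilon>" "n \<bullet> (w - x) \<ge> 0" for w
  proof -
    have "w \<in> ?S" using \<epsilon> that by blast
    moreover have "0 \<le> Y w" using that ne unfolding side by (simp add: zero_le_mult_iff)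
    ultimately show ?thesis by (auto simp: triangle_eq)
  qed
  then show ?thesis unfolding T using \<epsilon>(1) by blast
qed

text \<open>Points of \<open>\<Omega>\<close> just across the edge, near \<open>z\<close>, belong to some triangle \<open>T'\<close> that contains
  \<open>z\<close>. As \<open>T \<inter> T'\<close> is a face that contains \<open>z\<close>, it contains \<open>x\<close> and \<open>y\<close>, which are thus
  vertices of \<open>T'\<close> too. Half discs from \<open>T\<close> and from \<open>T'\<close> then make up a whole disc around
  every point of the open edge.\<close>

lemma conforming_mesh_edge_inside:
  assumes mesh: "conforming_mesh \<Omega> \<T>" and "open \<Omega>" and reg: "interior (closure \<Omega>) = \<Omega>"
    and T: "T \<in> \<T>" and x: "x extreme_point_of T" and y: "y extreme_point_of T" and "x \<noteq> y"
    and z: "z \<in> open_segment x y" "z \<in> \<Omega>"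
  shows "open_segment x y \<subseteq> \<Omega>"
proof -
  have fin: "finite \<T>" and face: "\<And>T T'. T \<in> \<T> \<Longrightarrow> T' \<in> \<T> \<Longrightarrow> (T \<inter> T') face_of T"
    and simp2: "\<And>T. T \<in> \<T> \<Longrightarrow> 2 simplex T" and union: "\<Union>\<T> = closure \<Omega>"
    using mesh by (auto simp: conforming_mesh_def triangulation_def)
  obtain r where r: "T = convex hull {x, y, r}" "\<not> affine_dependent {x, y, r}" "r \<noteq> x" "r \<noteq> y"
    using triangle_third_vertex[OF simp2[OF T] x y \<open>x \<noteq> y\<close>] by metis
  obtain e1 e2 where fr: "plane_frame e1 e2" and yx: "y - x = dist x y *\<^sub>R e1" and rp: "(r - x) \<bullet> e2 > 0"
    using frame_exists[OF r(2) \<open>x \<noteq> y\<close>] r by metis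
  interpret plane_frame x e1 e2 by (rule fr)
  have yx0: "(y - x) \<bullet> e2 = 0" by (simp add: yx e12)
  have z0: "Y z = 0"
  proof -
    obtain u where "z = (1 - u) *\<^sub>R x + u *\<^sub>R y" using z(1) by (auto simp: in_segment)
    then have "z - x = u *\<^sub>R (y - x)" by (simp add: algebra_simps)
    then show ?thesis by (simp add: Y_def yx0)
  qed
  \<comment> \<open>Avoiding \<open>U\<close> forces every mesh triangle at \<open>w\<close> to contain \<open>z\<close>.\<close>
  define U where "U = \<Union>{T'\<in>\<T>. z \<notin> T'}"
  have "closed U" unfolding U_def using fin simp2 closed_simplex by (intro closed_Union) auto
  then have "open (\<Omega> - U)" using \<open>open \<Omega>\<close> by blast
  moreover have "z \<in> \<Omega> - U" using z by (auto simp: U_def)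
  ultimately obtain \<epsilon> where \<epsilon>: "\<epsilon> > 0" "ball z \<epsilon> \<subseteq> \<Omega> - U" by (rule openE)
  define w where "w = z - (\<epsilon> / 2) *\<^sub>R e2"
  have "norm e2 = 1" using e22 by (simp add: norm_eq_1)
  then have "w \<in> ball z \<epsilon>" using \<epsilon> by (simp add: w_def dist_norm)
  then have w: "w \<in> \<Omega>" "w \<notin> U" using \<epsilon> by auto
  have Yw: "Y w < 0" using z0 \<epsilon> by (simp add: w_def Y_def inner_simps e22)
  obtain T' where T': "T' \<in> \<T>" "w \<in> T'" using w union closure_subset by blast
  then have zT': "z \<in> T'" using w by (auto simp: U_def)
  have xyT: "x \<in> T" "y \<in> T" using x y by (auto simp: extreme_point_of_def)
  moreover have "z \<in> T"
    using z(1) xyT r(1) by (meson convex_contains_open_segment convex_convex_hull subsetD)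
  moreover have "T \<inter> T' face_of T" by (rule face[OF T T'(1)])
  ultimately have "x \<in> T \<inter> T'" "y \<in> T \<inter> T'"
    using z(1) zT' unfolding face_of_def by blast+
  then have "x extreme_point_of (T \<inter> T')" "y extreme_point_of (T \<inter> T')"
    using x y extreme_point_of_face[OF face[OF T T'(1)]] by auto
  moreover have "T \<inter> T' face_of T'" using face[OF T'(1) T] by (simp add: Int_commute)
  ultimately have xy': "x extreme_point_of T'" "y extreme_point_of T'"
    using extreme_point_of_face by blast+
  obtain r' where r': "T' = convex hull {x, y, r'}" "\<not> affine_dependent {x, y, r'}" "r' \<noteq> x" "r' \<noteq> y"
    using triangle_third_vertex[OF simp2[OF T'(1)] xy' \<open>x \<noteq> y\<close>] by metis
  have "(r' - x) \<bullet> e2 < 0"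
  proof -
    obtain u v k where k: "0 \<le> k" "u + v + k = 1" "w = u *\<^sub>R x + v *\<^sub>R y + k *\<^sub>R r'"
      using T'(2) unfolding r'(1) convex_hull_3 by auto
    have u: "u = 1 - v - k" using k by simp
    have "w - x = v *\<^sub>R (y - x) + k *\<^sub>R (r' - x)"
      unfolding k(3) u by (simp add: algebra_simps)
    then have "Y w = k * ((r' - x) \<bullet> e2)" by (simp add: Y_def inner_add_left yx0)
    then show ?thesis using Yw k(1) by (simp add: mult_less_0_iff)
  qed
  then have r'n: "(- e2) \<bullet> (r' - x) > 0" by (simp add: inner_commute)
  show ?thesis
  proof
    fix v assume v: "v \<in> open_segment x y"
    obtain \<epsilon>1 where \<epsilon>1: "\<epsilon>1 > 0" "\<forall>w\<in>ball v \<epsilon>1. e2 \<bullet> (w - x) \<ge> 0 \<longrightarrow> w \<in> T"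
      using half_disc_in_triangle[OF r(2) \<open>x \<noteq> y\<close> r(3,4), of e2 v] v yx0 rp r(1)
      by (auto simp: inner_commute)
    obtain \<epsilon>2 where \<epsilon>2: "\<epsilon>2 > 0" "\<forall>w\<in>ball v \<epsilon>2. (- e2) \<bullet> (w - x) \<ge> 0 \<longrightarrow> w \<in> T'"
      using half_disc_in_triangle[OF r'(2) \<open>x \<noteq> y\<close> r'(3,4) _ r'n v] yx0 r'(1)
      by (auto simp: inner_commute)
    have "ball v (min \<epsilon>1 \<epsilon>2) \<subseteq> T \<union> T'"
    proof
      fix q assume "q \<in> ball v (min \<epsilon>1 \<epsilon>2)"
      then have "q \<in> ball v \<epsilon>1" "q \<in> ball v \<epsilon>2" by auto
      then show "q \<in> T \<union> T'" using \<epsilon>1 \<epsilon>2 by (cases "e2 \<bullet> (q - x) \<ge> 0") auto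
    qed
    also have "\<dots> \<subseteq> closure \<Omega>" using T T'(1) union by blast
    finally have "ball v (min \<epsilon>1 \<epsilon>2) \<subseteq> interior (closure \<Omega>)" by (rule interior_maximal) simp
    then show "v \<in> \<Omega>" using \<epsilon>1(1) \<epsilon>2(1) reg by auto
  qed
qed

text \<open>If one of the other two open edges met the boundary, then it could not meet \<open>\<Omega>\<close>, and it
  would be a second boundary edge of the triangle.\<close>

lemma boundary_triangle_frontier:
  assumes mesh: "conforming_mesh \<Omega> \<T>" and dom: "polygonal_domain \<Omega>"
    and one: "at_most_one_boundary_edge \<Omega> \<T>"
    and T: "T \<in> \<T>" "T = convex hull {a, b, c}" and ind: "\<not> affine_dependent {a, b, c}"
    and ne: "a \<noteq> b" "c \<noteq> a" "c \<noteq> b"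
    and e: "closed_segment a b \<in> boundary_edges \<Omega> \<T>"
  shows "(open_segment a c \<union> open_segment b c) \<inter> frontier \<Omega> = {}"
proof -
  have op: "open \<Omega>" and reg: "interior (closure \<Omega>) = \<Omega>" using dom by (auto simp: polygonal_domain_def)
  have ext: "v extreme_point_of T \<longleftrightarrow> v \<in> {a, b, c}" for v
    unfolding T(2) by (rule extreme_point_of_convex_hull_affine_independent[OF ind])
  have edge: "closed_segment v w edge_of T" if "v \<in> {a, b, c}" "w \<in> {a, b, c}" "v \<noteq> w" for v w
  proof -
    have "closed_segment v w face_of T"
      unfolding T(2) face_of_convex_hull_affine_independent[OF ind] segment_convex_hull
      using that by (intro exI[of _ "{v, w}"]) auto
    moreover have "aff_dim (closed_segment v w) = 1"
      using \<open>v \<noteq> w\<close> by (simp add: segment_convex_hull aff_dim_convex_hull aff_dim_2)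
    ultimately show ?thesis by (simp add: edge_of_def)
  qed
  have "open_segment v c \<inter> frontier \<Omega> = {}" if v: "v \<in> {a, b}" for v
  proof (cases "open_segment v c \<inter> \<Omega> = {}")
    case True
    have vc: "v \<noteq> c" using v ne by auto
    have "\<Omega> \<inter> closed_segment v c = {}"
      using True open_Int_closure_eq_empty[OF op, of "open_segment v c"] vc by (simp add: Int_commute)
    moreover have "closed_segment v c \<subseteq> T"
      using edge_of_imp_subset[OF edge[of v c]] v vc by auto
    moreover have "T \<subseteq> closure \<Omega>" using mesh T by (auto simp: conforming_mesh_def)
    ultimately have "closed_segment v c \<subseteq> frontier \<Omega>"
      using op by (auto simp: frontier_def interior_open)
    then have "closed_segment v c \<in> boundary_edges \<Omega> \<T>"
      using edge[of v c] v vc T(1) by (auto simp: boundary_edges_def)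
    moreover have "T \<in> boundary_triangles \<Omega> \<T>"
      using e edge[of a b] T(1) ne by (auto simp: boundary_triangles_def)
    ultimately have "closed_segment v c = closed_segment a b"
      using one e edge[of a b] edge[of v c] v vc ne unfolding at_most_one_boundary_edge_def by blast
    then show ?thesis using v ne by (auto simp: doubleton_eq_iff)
  next
    case False
    then obtain z where z: "z \<in> open_segment v c" "z \<in> \<Omega>" by auto
    have "open_segment v c \<subseteq> \<Omega>"
      by (rule conforming_mesh_edge_inside[OF mesh op reg T(1) _ _ _ z]) (use v ne ext in auto)
    then show ?thesis using op by (auto simp: frontier_def interior_open)
  qed
  then show ?thesis by blast
qed

lemma edge_endpoints:
  assumes "closed_segment a b edge_of T"
  shows "a \<noteq> b" "a extreme_point_of T" "b extreme_point_of T"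
proof -
  have face: "closed_segment a b face_of T" and dim: "aff_dim (closed_segment a b) = 1"
    using assms by (simp_all add: edge_of_def)
  show "a \<noteq> b" using dim by auto
  show "a extreme_point_of T" "b extreme_point_of T"
    using extreme_point_of_face[OF face] extreme_point_of_segment by blast+
qed

lemma inner_le_of_angle:
  assumes "\<theta> \<le> angle_at x y z" "0 \<le> \<theta>" "y \<noteq> x" "z \<noteq> x"
  shows "(y - x) \<bullet> (z - x) \<le> cos \<theta> * (norm (y - x) * norm (z - x))"
proof -
  let ?q = "((y - x) \<bullet> (z - x)) / (norm (y - x) * norm (z - x))"
  have n: "norm (y - x) * norm (z - x) > 0" using assms by simp
  have "\<bar>?q\<bar> \<le> 1"
    using Cauchy_Schwarz_ineq2[of "y - x" "z - x"] n by (simp add: abs_mult divide_le_eq_1)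
  then have q: "-1 \<le> ?q" "?q \<le> 1" unfolding abs_le_iff by linarith+
  then have "?q = cos (angle_at x y z)" by (simp add: angle_at_def)
  also have "\<dots> \<le> cos \<theta>"
    using assms q by (intro cos_monotone_0_pi_le) (simp_all add: angle_at_def arccos_ubound)
  finally show ?thesis using n by (simp add: field_simps)
qed

text \<open>The first two bounds say that the cotangents of the angles at \<open>a\<close> and \<open>b\<close> are at most the
  cotangent of the angle whose cosine is \<open>k\<close>. For the third, the law of cosines at \<open>c\<close> bounds
  \<open>(dist a b)\<^sup>2\<close> from below by \<open>1 - k\<close> times the sum of the squares of the other two sides,
  neither of which is shorter than the height.\<close>

lemma shape_bounds:
  fixes a b c :: "real^2"
  assumes ne: "a \<noteq> b" "c \<noteq> a" "c \<noteq> b"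
    and fr: "triangle_frame e1 e2 (dist a b) H"
    and pts: "plane_frame.pt a e1 e2 (dist a b) 0 = b" "plane_frame.pt a e1 e2 p H = c"
    and k: "0 < k" "k < 1"
    and angles: "(b - a) \<bullet> (c - a) \<le> k * (norm (b - a) * norm (c - a))"
      "(a - b) \<bullet> (c - b) \<le> k * (norm (a - b) * norm (c - b))"
      "(a - c) \<bullet> (b - c) \<le> k * (norm (a - c) * norm (b - c))"
  shows "p \<le> k / sqrt (1 - k\<^sup>2) * H" "dist a b - p \<le> k / sqrt (1 - k\<^sup>2) * H"
    "H \<le> dist a b / sqrt (2 * (1 - k))"
proof -
  define L' where "L' = dist a b"
  interpret triangle_frame a e1 e2 L' p H unfolding L'_def by (rule fr)
  have "b = a + L' *\<^sub>R e1" "c = a + p *\<^sub>R e1 + H *\<^sub>R e2"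
    using pts unfolding pt_def L'_def[symmetric] by simp_all
  then have b: "b - a = L' *\<^sub>R e1" and c: "c - a = p *\<^sub>R e1 + H *\<^sub>R e2" by simp_all
  have cb: "c - b = (p - L') *\<^sub>R e1 + H *\<^sub>R e2" using b c by (simp add: algebra_simps)
  have norm_eq: "norm (x *\<^sub>R e1 + y *\<^sub>R e2) = sqrt (x\<^sup>2 + y\<^sup>2)" for x y
    by (simp add: norm_eq_sqrt_inner inner_simps e11 e22 e12 e21 power2_eq_square)
  have k2: "1 - k\<^sup>2 > 0" using k by (simp add: power_less_one_iff)
  have slope: "x \<le> k / sqrt (1 - k\<^sup>2) * H" if "x \<le> k * sqrt (x\<^sup>2 + H\<^sup>2)" for x
  proof (cases "x \<le> 0")
    case True
    then show ?thesis using k k2 H by (auto intro: order.trans)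
  next
    case False
    then have "x\<^sup>2 \<le> (k * sqrt (x\<^sup>2 + H\<^sup>2))\<^sup>2" using that by (intro power_mono) auto
    then have "x\<^sup>2 * (1 - k\<^sup>2) \<le> (k * H)\<^sup>2" by (simp add: power_mult_distrib algebra_simps)
    then have "(x * sqrt (1 - k\<^sup>2))\<^sup>2 \<le> (k * H)\<^sup>2" using k2 by (simp add: power_mult_distrib)
    then have "x * sqrt (1 - k\<^sup>2) \<le> k * H" by (rule power2_le_imp_le) (use k H in simp)
    then show ?thesis using k2 by (simp add: field_simps)
  qed
  have n: "norm (b - a) = L'" by (simp add: L'_def dist_norm norm_minus_commute)
  have "L' * p \<le> L' * (k * sqrt (p\<^sup>2 + H\<^sup>2))"
    using angles(1) unfolding n unfolding c norm_eq by (simp add: b inner_simps e11 e12 mult_ac)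
  then show "p \<le> k / sqrt (1 - k\<^sup>2) * H" using L by (intro slope) simp
  have "(a - b) \<bullet> (c - b) = - ((b - a) \<bullet> (c - b))" by (simp add: inner_diff_left)
  also have "\<dots> = L' * (L' - p)" unfolding b cb by (simp add: inner_simps e11 e12 algebra_simps)
  finally have "L' * (L' - p) \<le> L' * (k * sqrt ((p - L')\<^sup>2 + H\<^sup>2))"
    using angles(2) norm_minus_commute[of a b] n unfolding cb norm_eq by (simp add: mult_ac)
  then show "dist a b - p \<le> k / sqrt (1 - k\<^sup>2) * H"
    using L unfolding L'_def[symmetric] by (intro slope) (simp add: power2_commute)
  have "L'\<^sup>2 = norm ((a - c) - (b - c))^2" by (simp add: L'_def dist_norm)
  also have "\<dots> = (norm (a - c))\<^sup>2 + (norm (b - c))\<^sup>2 - 2 * ((a - c) \<bullet> (b - c))"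
    by (simp add: power2_norm_eq_inner inner_simps inner_commute)
  finally have "(norm (a - c))\<^sup>2 + (norm (b - c))\<^sup>2 - 2 * k * (norm (a - c) * norm (b - c)) \<le> L'\<^sup>2"
    using angles(3) by simp
  moreover have "k * (2 * (norm (a - c) * norm (b - c))) \<le> k * ((norm (a - c))\<^sup>2 + (norm (b - c))\<^sup>2)"
    using k sum_squares_bound[of "norm (a - c)" "norm (b - c)"] by (intro mult_left_mono) (auto simp: mult.assoc)
  ultimately have "(1 - k) * ((norm (a - c))\<^sup>2 + (norm (b - c))\<^sup>2) \<le> L'\<^sup>2" by (simp add: algebra_simps)
  moreover have "(norm (a - c))\<^sup>2 \<ge> H\<^sup>2" "(norm (b - c))\<^sup>2 \<ge> H\<^sup>2"
    by (simp_all add: norm_minus_commute[of _ c] c cb norm_eq)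
  then have "(1 - k) * (H\<^sup>2 + H\<^sup>2) \<le> (1 - k) * ((norm (a - c))\<^sup>2 + (norm (b - c))\<^sup>2)"
    using k by (intro mult_left_mono) auto
  ultimately have "(1 - k) * (H\<^sup>2 + H\<^sup>2) \<le> L'\<^sup>2" by linarith
  then have "(H * sqrt (2 * (1 - k)))\<^sup>2 \<le> L'\<^sup>2" using k by (simp add: power_mult_distrib algebra_simps)
  then have "H * sqrt (2 * (1 - k)) \<le> L'" by (rule power2_le_imp_le) (use L in simp)
  then show "H \<le> dist a b / sqrt (2 * (1 - k))" using k by (simp add: L'_def field_simps)
qed

section \<open>The difference function and the size of its gradient\<close>

text \<open>Cauchy-Schwarz, from the nonnegative integral of \<open>(D x - I / h)\<^sup>2\<close> with \<open>I / h\<close> the mean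
  value.\<close>

lemma square_integral_le:
  fixes D :: "real \<Rightarrow> real"
  assumes "s \<le> t" and D: "integrable lborel D" "integrable lborel (\<lambda>x. (D x)\<^sup>2)"
  shows "(\<integral>x. indicator {s<..<t} x * D x \<partial>lborel)\<^sup>2 \<le> (t - s) * (\<integral>x. (D x)\<^sup>2 \<partial>lborel)"
proof (cases "s = t")
  case False
  define I where "I = (\<integral>x. indicator {s<..<t} x * D x \<partial>lborel)"
  define h where "h = t - s"
  have h: "h > 0" using assms(1) False by (simp add: h_def)
  have i1: "integrable lborel (\<lambda>x. indicator {s<..<t} x * D x)"
    using integrable_mult_indicator[of "{s<..<t}" lborel D] D by simp
  have i2: "integrable lborel (\<lambda>x. indicator {s<..<t} x * (D x)\<^sup>2)"
    using integrable_mult_indicator[of "{s<..<t}" lborel "\<lambda>x. (D x)\<^sup>2"] D by simp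
  have i0: "integrable lborel (indicat_real {s<..<t})" "(\<integral>x. indicat_real {s<..<t} x \<partial>lborel) = h"
    using h by (auto simp: h_def intro!: integrable_real_indicator)
  have "0 \<le> (\<integral>x. indicator {s<..<t} x * (D x - I / h)\<^sup>2 \<partial>lborel)"
    by (intro integral_nonneg_AE AE_I2) simp
  also have "\<dots> = (\<integral>x. indicator {s<..<t} x * (D x)\<^sup>2 - (2 * I / h) * (indicator {s<..<t} x * D x)
       + (I / h)\<^sup>2 * indicator {s<..<t} x \<partial>lborel)"
    by (rule Bochner_Integration.integral_cong) (auto simp: power2_diff algebra_simps)
  also have "\<dots> = (\<integral>x. indicator {s<..<t} x * (D x)\<^sup>2 \<partial>lborel) - (2 * I / h) * I + (I / h)\<^sup>2 * h"
    using i0 i1 i2 by (simp add: I_def)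
  also have "\<dots> = (\<integral>x. indicator {s<..<t} x * (D x)\<^sup>2 \<partial>lborel) - I\<^sup>2 / h"
    using h by (simp add: field_simps power2_eq_square)
  finally have "I\<^sup>2 \<le> h * (\<integral>x. indicator {s<..<t} x * (D x)\<^sup>2 \<partial>lborel)"
    using h by (simp add: field_simps)
  also have "\<dots> \<le> h * (\<integral>x. (D x)\<^sup>2 \<partial>lborel)"
    using h i2 D(2) by (intro mult_left_mono integral_mono) (auto split: split_indicator)
  finally show ?thesis by (simp add: I_def h_def)
qed simp

lemma lebesgue_on_borel_integral:
  fixes F :: "'a::euclidean_space \<Rightarrow> real"
  assumes "S \<in> sets borel" "F \<in> borel_measurable borel"
  shows "integral\<^sup>L (lebesgue_on S) F = (\<integral>x. indicator S x * F x \<partial>lborel)"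
    and "integrable (lebesgue_on S) F \<longleftrightarrow> integrable lborel (\<lambda>x. indicator S x * F x)"
proof -
  have "(\<lambda>x. indicator S x * F x) \<in> borel_measurable lborel" using assms by simp
  then show "integral\<^sup>L (lebesgue_on S) F = (\<integral>x. indicator S x * F x \<partial>lborel)"
    "integrable (lebesgue_on S) F \<longleftrightarrow> integrable lborel (\<lambda>x. indicator S x * F x)"
    using assms by (simp_all add: integral_restrict_space integrable_restrict_space integral_completion integrable_completion)
qed

text \<open>The setting of the estimate: a profile \<open>\<phi>\<close> on the base that vanishes at both ends and is a
  primitive of a square-integrable \<open>D\<close>. Both are extended by zero, so that the part of the
  triangle that does not lie above the base needs no separate treatment.\<close>

locale extension_profile = triangle_frame +
  fixes \<phi> D :: "real \<Rightarrow> real"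
  assumes D_meas [measurable]: "D \<in> borel_measurable borel"
    and D2: "integrable lborel (\<lambda>x. (D x)\<^sup>2)"
    and D_out: "x \<notin> {0<..<L} \<Longrightarrow> D x = 0"
    and \<phi>_meas [measurable]: "\<phi> \<in> borel_measurable borel"
    and \<phi>_diff: "0 \<le> s \<Longrightarrow> s \<le> t \<Longrightarrow> t \<le> L \<Longrightarrow> \<phi> t - \<phi> s = (\<integral>x. indicator {s<..<t} x * D x \<partial>lborel)"
    and \<phi>_out: "x \<notin> {0<..<L} \<Longrightarrow> \<phi> x = 0"
begin

definition N :: real where "N = (\<integral>x. (D x)\<^sup>2 \<partial>lborel)"
definition \<sigma> :: "real \<Rightarrow> real" where "\<sigma> = inv_height L p H"
text \<open>The derivative of \<open>\<sigma>\<close> away from \<open>p\<close>.\<close>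

definition \<sigma>' :: "real \<Rightarrow> real" where
  "\<sigma>' x = (if 0 < p \<and> x \<le> p then - p / (H * x\<^sup>2) else (L - p) / (H * (L - x)\<^sup>2))"
definition v :: "real^2 \<Rightarrow> real" where "v z = \<phi> (X z) * (1 - Y z * \<sigma> (X z))"
text \<open>The components of the gradient \<open>G\<close> of \<open>v\<close> in the frame.\<close>

definition gx :: "real^2 \<Rightarrow> real" where
  "gx z = D (X z) * (1 - Y z * \<sigma> (X z)) - \<phi> (X z) * Y z * \<sigma>' (X z)"
definition gy :: "real^2 \<Rightarrow> real" where "gy z = - \<phi> (X z) * \<sigma> (X z)"
definition G :: "real^2 \<Rightarrow> real^2" where "G z = gx z *\<^sub>R e1 + gy z *\<^sub>R e2"

lemma \<sigma>_measurable [measurable]: "\<sigma> \<in> borel_measurable borel"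
  and \<sigma>'_measurable [measurable]: "\<sigma>' \<in> borel_measurable borel"
  unfolding \<sigma>_def inv_height_def[abs_def] \<sigma>'_def[abs_def] by measurable

lemma v_measurable [measurable]: "v \<in> borel_measurable borel"
  and gx_measurable [measurable]: "gx \<in> borel_measurable borel"
  and gy_measurable [measurable]: "gy \<in> borel_measurable borel"
  and G_measurable [measurable]: "G \<in> borel_measurable borel"
  unfolding v_def[abs_def] gx_def[abs_def] gy_def[abs_def] G_def[abs_def] by measurable

lemma pt_measurable_compose [measurable]:
  "f \<in> borel_measurable M \<Longrightarrow> g \<in> borel_measurable M \<Longrightarrow> (\<lambda>w. pt (f w) (g w)) \<in> borel_measurable M"
  unfolding pt_def by (intro borel_measurable_add borel_measurable_scaleR borel_measurable_const)

lemma interior_measurable [measurable]: "interior \<Delta> \<in> sets borel"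
  by simp

lemma D_integrable: "integrable lborel D"
proof (rule Bochner_Integration.integrable_bound)
  show "integrable lborel (\<lambda>x. indicat_real {0<..<L} x + (D x)\<^sup>2)"
    using D2 L by (intro Bochner_Integration.integrable_add integrable_real_indicator) auto
  have "\<bar>y\<bar> \<le> 1 + y\<^sup>2" for y :: real
    using zero_le_power2[of "\<bar>y\<bar> - 1"] by (simp add: power2_diff)
  then have "\<bar>D x\<bar> \<le> indicat_real {0<..<L} x + (D x)\<^sup>2" for x
    using D_out[of x] by (auto split: split_indicator)
  then show "AE x in lborel. norm (D x) \<le> norm (indicat_real {0<..<L} x + (D x)\<^sup>2)"
    by (intro AE_I2) (simp add: order.trans[OF _ abs_ge_self])
qed simp

lemma N_nonneg: "N \<ge> 0" unfolding N_def by simp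

lemma \<phi>_square_le:
  assumes "0 < x" "x < L"
  shows "(\<phi> x)\<^sup>2 \<le> x * N" "(\<phi> x)\<^sup>2 \<le> (L - x) * N"
proof -
  have "(\<phi> x - \<phi> 0)\<^sup>2 \<le> (x - 0) * N"
    using assms square_integral_le[OF _ D_integrable D2, of 0 x] by (simp add: N_def \<phi>_diff)
  moreover have "(\<phi> L - \<phi> x)\<^sup>2 \<le> (L - x) * N"
    using assms square_integral_le[OF _ D_integrable D2, of x L] by (simp add: N_def \<phi>_diff)
  ultimately show "(\<phi> x)\<^sup>2 \<le> x * N" "(\<phi> x)\<^sup>2 \<le> (L - x) * N"
    by (simp_all add: \<phi>_out)
qed

lemma interior_strip_iff:
  assumes "0 < X z" "X z < L"
  shows "z \<in> interior \<Delta> \<longleftrightarrow> 0 < Y z \<and> Y z * \<sigma> (X z) < 1"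
  using inv_height_less_iff[OF L H assms, of "Y z" p]
  by (auto simp: interior_triangle \<sigma>_def)

lemma outside_strip: "X z \<notin> {0<..<L} \<Longrightarrow> v z = 0 \<and> gx z = 0 \<and> gy z = 0"
  by (simp add: v_def gx_def gy_def \<phi>_out D_out)

lemma \<sigma>_pos: "0 < x \<Longrightarrow> x < L \<Longrightarrow> \<sigma> x > 0"
  unfolding \<sigma>_def using inv_height_pos[OF L H] by simp

text \<open>The left-hand side bounds the integral of the squared gradient over the vertical slice at
  \<open>x\<close>: a bound for the integrand times the length \<open>1 / \<sigma> x\<close>. On each side of the apex \<open>\<sigma>\<close> is
  explicit, and the powers of \<open>x\<close> or \<open>L - x\<close> cancel against those in \<open>\<phi>_square_le\<close>.\<close>

lemma bound_on_slice:
  assumes x: "0 < x" "x < L" and \<kappa>: "p \<le> \<kappa> * H" "L - p \<le> \<kappa> * H"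
  shows "(2 * (D x)\<^sup>2 + 2 * (\<phi> x)\<^sup>2 * (\<sigma>' x / \<sigma> x)\<^sup>2 + (\<phi> x)\<^sup>2 * (\<sigma> x)\<^sup>2) / \<sigma> x
    \<le> 2 * H * (D x)\<^sup>2 + 2 * N * H * (indicator {0<..p} x / p) + 2 * N * H * (indicator {p<..<L} x / (L - p)) + \<kappa> * N * indicator {0<..<L} x"
proof -
  have s: "\<sigma> x > 0" using \<sigma>_pos x .
  \<comment> \<open>The slice is no longer than the height of the apex.\<close>
  have sH: "1 / \<sigma> x \<le> H"
  proof (cases "0 < p \<and> x \<le> p")
    case True
    then have "1 / \<sigma> x = H * (x / p)" by (simp add: \<sigma>_def inv_height_def)
    also have "\<dots> \<le> H * 1" using True H by (intro mult_left_mono) auto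
    finally show ?thesis by simp
  next
    case False
    then have "p < L" "p < x" using x by auto
    have "1 / \<sigma> x = H * ((L - x) / (L - p))" by (simp add: \<sigma>_def inv_height_def if_not_P[OF False])
    also have "\<dots> \<le> H * 1" using \<open>p < L\<close> \<open>p < x\<close> H by (intro mult_left_mono) auto
    finally show ?thesis by simp
  qed
  have t1: "2 * (D x)\<^sup>2 * (1 / \<sigma> x) \<le> 2 * (D x)\<^sup>2 * H"
    by (intro mult_left_mono sH) simp
  have t2: "(\<phi> x)\<^sup>2 * (\<sigma>' x / \<sigma> x)\<^sup>2 * (1 / \<sigma> x) \<le> N * H * (indicator {0<..p} x / p) + N * H * (indicator {p<..<L} x / (L - p))
     \<and> (\<phi> x)\<^sup>2 * \<sigma> x \<le> \<kappa> * N"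
  proof (cases "0 < p \<and> x \<le> p")
    case True
    then have \<sigma>: "\<sigma> x = p / (H * x)" "\<sigma>' x = - p / (H * x\<^sup>2)" by (simp_all add: \<sigma>_def inv_height_def \<sigma>'_def)
    have r: "\<sigma>' x / \<sigma> x = - (1 / x)" "1 / \<sigma> x = H * x / p"
      unfolding \<sigma> using True x H by (simp_all add: field_simps power2_eq_square)
    have "(\<phi> x)\<^sup>2 * (\<sigma>' x / \<sigma> x)\<^sup>2 * (1 / \<sigma> x) \<le> (x * N) * (1 / x)\<^sup>2 * (H * x / p)"
      unfolding r power2_minus using True x H by (intro mult_right_mono \<phi>_square_le) auto
    also have "\<dots> = N * H * (1 / p)" using True x by (simp add: field_simps power2_eq_square)
    finally have 1: "(\<phi> x)\<^sup>2 * (\<sigma>' x / \<sigma> x)\<^sup>2 * (1 / \<sigma> x) \<le> N * H * (1 / p)" .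
    have "(\<phi> x)\<^sup>2 * \<sigma> x \<le> (x * N) * \<sigma> x" using s x by (intro mult_right_mono \<phi>_square_le) auto
    also have "\<dots> = N * (p / H)" unfolding \<sigma> using x by simp
    also have "\<dots> \<le> N * \<kappa>" using \<kappa> H N_nonneg by (intro mult_left_mono) (auto simp: field_simps)
    finally show ?thesis using 1 True x by (simp add: mult.commute)
  next
    case False
    then have pL: "p < L" "p < x" using x by auto
    have \<sigma>: "\<sigma> x = (L - p) / (H * (L - x))" "\<sigma>' x = (L - p) / (H * (L - x)\<^sup>2)"
      using False by (auto simp: \<sigma>_def inv_height_def \<sigma>'_def)
    have r: "\<sigma>' x / \<sigma> x = 1 / (L - x)" "1 / \<sigma> x = H * (L - x) / (L - p)"
      unfolding \<sigma> using pL x H by (simp_all add: power2_eq_square)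
    have "(\<phi> x)\<^sup>2 * (\<sigma>' x / \<sigma> x)\<^sup>2 * (1 / \<sigma> x) \<le> ((L - x) * N) * (1 / (L - x))\<^sup>2 * (H * (L - x) / (L - p))"
      unfolding r using pL x H by (intro mult_right_mono \<phi>_square_le) auto
    also have "\<dots> = N * H * (1 / (L - p))" using pL x by (simp add: power2_eq_square)
    finally have 1: "(\<phi> x)\<^sup>2 * (\<sigma>' x / \<sigma> x)\<^sup>2 * (1 / \<sigma> x) \<le> N * H * (1 / (L - p))" .
    have "(\<phi> x)\<^sup>2 * \<sigma> x \<le> ((L - x) * N) * \<sigma> x" using s x by (intro mult_right_mono \<phi>_square_le) auto
    also have "\<dots> = N * ((L - p) / H)" unfolding \<sigma> using x by simp
    also have "\<dots> \<le> N * \<kappa>" using \<kappa> H N_nonneg by (intro mult_left_mono) (auto simp: field_simps)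
    finally show ?thesis using 1 False pL x by (auto simp add: mult.commute)
  qed
  have "(2 * (D x)\<^sup>2 + 2 * (\<phi> x)\<^sup>2 * (\<sigma>' x / \<sigma> x)\<^sup>2 + (\<phi> x)\<^sup>2 * (\<sigma> x)\<^sup>2) / \<sigma> x
     = 2 * (D x)\<^sup>2 * (1 / \<sigma> x) + 2 * ((\<phi> x)\<^sup>2 * (\<sigma>' x / \<sigma> x)\<^sup>2 * (1 / \<sigma> x)) + (\<phi> x)\<^sup>2 * \<sigma> x"
    using s by (simp add: add_divide_distrib power2_eq_square[of "\<sigma> x"])
  also have "\<dots> \<le> 2 * (D x)\<^sup>2 * H + 2 * (N * H * (indicator {0<..p} x / p) + N * H * (indicator {p<..<L} x / (L - p))) + \<kappa> * N"
    by (rule add_mono[OF add_mono[OF t1 mult_left_mono[OF conjunct1[OF t2]]] conjunct2[OF t2]]) simp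
  also have "\<dots> = 2 * H * (D x)\<^sup>2 + 2 * N * H * (indicator {0<..p} x / p) + 2 * N * H * (indicator {p<..<L} x / (L - p)) + \<kappa> * N * indicator {0<..<L} x"
    using x by (simp add: algebra_simps)
  finally show ?thesis .
qed

lemma norm_G: "(norm (G z))\<^sup>2 = (gx z)\<^sup>2 + (gy z)\<^sup>2"
  unfolding power2_norm_eq_inner by (simp add: G_def inner_simps e11 e22 e12 e21 power2_eq_square)

text \<open>Fubini and \<open>bound_on_slice\<close>. The two summands with denominators \<open>p\<close> and \<open>L - p\<close> have
  integral at most \<open>2 * N * H\<close> each, since the intervals are not longer than the denominators.\<close>

lemma nn_integral_G:
  assumes \<kappa>: "p \<le> \<kappa> * H" "L - p \<le> \<kappa> * H"
  shows "(\<integral>\<^sup>+z. ennreal (indicator (interior \<Delta>) z * (norm (G z))\<^sup>2) \<partial>lborel) \<le> ennreal (N * (6 * H + \<kappa> * L))"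
proof -
  let ?F = "\<lambda>z. ennreal (indicator (interior \<Delta>) z * (norm (G z))\<^sup>2)"
  define M where "M x = 2 * H * (D x)\<^sup>2 + 2 * N * H * (indicator {0<..p} x / p) + 2 * N * H * (indicator {p<..<L} x / (L - p)) + \<kappa> * N * indicator {0<..<L} x" for x
  have "interior \<Delta> \<in> sets borel" by simp
  then have Fm: "?F \<in> borel_measurable borel" by measurable
  have slice: "(\<integral>\<^sup>+y. ?F (pt x y) \<partial>lborel) \<le> ennreal (M x)" for x
  proof (cases "0 < x \<and> x < L")
    case True
    then have s: "\<sigma> x > 0" using \<sigma>_pos by simp
    define c where "c = 2 * (D x)\<^sup>2 + 2 * (\<phi> x)\<^sup>2 * (\<sigma>' x / \<sigma> x)\<^sup>2 + (\<phi> x)\<^sup>2 * (\<sigma> x)\<^sup>2"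
    have c0: "c \<ge> 0" by (simp add: c_def)
    have "?F (pt x y) \<le> ennreal c * indicator {0..1 / \<sigma> x} y" for y
    proof (cases "pt x y \<in> interior \<Delta>")
      case in_T: True
      then have y: "0 < y" "y * \<sigma> x < 1" using interior_strip_iff[of "pt x y"] True by auto
      have m: "(1 - y * \<sigma> x)\<^sup>2 \<le> 1" using y s by (intro power_le_one) auto
      have "(y * \<sigma>' x)\<^sup>2 = (y * \<sigma> x)\<^sup>2 * (\<sigma>' x / \<sigma> x)\<^sup>2" using s by (simp add: power_mult_distrib power_divide)
      also have "\<dots> \<le> 1 * (\<sigma>' x / \<sigma> x)\<^sup>2" using y s by (intro mult_right_mono power_le_one) auto
      finally have y\<sigma>': "(y * \<sigma>' x)\<^sup>2 \<le> (\<sigma>' x / \<sigma> x)\<^sup>2" by simp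
      have "(A - B)\<^sup>2 \<le> 2 * A\<^sup>2 + 2 * B\<^sup>2" for A B :: real
        using zero_le_power2[of "A + B"] by (simp add: power2_eq_square algebra_simps)
      from this[of "D x * (1 - y * \<sigma> x)" "\<phi> x * (y * \<sigma>' x)"]
      have "(gx (pt x y))\<^sup>2 \<le> 2 * ((D x)\<^sup>2 * (1 - y * \<sigma> x)\<^sup>2) + 2 * ((\<phi> x)\<^sup>2 * (y * \<sigma>' x)\<^sup>2)"
        by (simp add: gx_def power_mult_distrib mult.assoc)
      also have "\<dots> \<le> 2 * ((D x)\<^sup>2 * 1) + 2 * ((\<phi> x)\<^sup>2 * (\<sigma>' x / \<sigma> x)\<^sup>2)"
        by (intro add_mono mult_left_mono m y\<sigma>') auto
      finally have "(norm (G (pt x y)))\<^sup>2 \<le> c"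
        by (simp add: norm_G c_def gy_def power_mult_distrib)
      moreover have "y \<in> {0..1 / \<sigma> x}" using y s by (simp add: field_simps)
      ultimately show ?thesis using in_T by (simp add: ennreal_leI)
    qed simp
    then have "(\<integral>\<^sup>+y. ?F (pt x y) \<partial>lborel) \<le> (\<integral>\<^sup>+y. ennreal c * indicator {0..1 / \<sigma> x} y \<partial>lborel)"
      by (rule nn_integral_mono)
    also have "\<dots> = ennreal c * ennreal (1 / \<sigma> x)"
      using s by (simp add: nn_integral_cmult_indicator)
    also have "\<dots> = ennreal (c / \<sigma> x)" using c0 s by (simp add: ennreal_mult[symmetric])
    also have "\<dots> \<le> ennreal (M x)"
      unfolding c_def M_def using bound_on_slice[of x \<kappa>] True \<kappa> by (intro ennreal_leI) auto
    finally show ?thesis .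
  next
    case False
    then have "norm (G (pt x y)) = 0" for y using outside_strip[of "pt x y"] by (simp add: G_def)
    then show ?thesis by simp
  qed
  have M0: "0 \<le> M x" for x
  proof -
    have "\<kappa> * H \<ge> 0" using \<kappa> L by linarith
    then have "\<kappa> \<ge> 0" using H by (simp add: zero_le_mult_iff)
    moreover have "0 \<le> indicat_real {0<..p} x / p" "0 \<le> indicat_real {p<..<L} x / (L - p)"
      by (auto split: split_indicator)
    ultimately show ?thesis unfolding M_def using H N_nonneg
      by (intro add_nonneg_nonneg mult_nonneg_nonneg) auto
  qed
  have ip: "integrable lborel (\<lambda>x. indicator {0<..p} x / p)" "(\<integral>x. indicator {0<..p} x / p \<partial>lborel) \<le> 1"
    by (cases "0 < p"; simp)+
  have iq: "integrable lborel (\<lambda>x. indicator {p<..<L} x / (L - p))" "(\<integral>x. indicator {p<..<L} x / (L - p) \<partial>lborel) \<le> 1"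
    by (cases "p < L"; simp)+
  have i0: "integrable lborel (indicat_real {0<..<L})" using L by (intro integrable_real_indicator) auto
  have Mi: "integrable lborel M"
    unfolding M_def by (intro Bochner_Integration.integrable_add integrable_mult_right D2 ip(1) iq(1) i0)
  have "integral\<^sup>L lborel M = 2 * H * N + 2 * N * H * (\<integral>x. indicator {0<..p} x / p \<partial>lborel)
       + 2 * N * H * (\<integral>x. indicator {p<..<L} x / (L - p) \<partial>lborel) + \<kappa> * N * L"
    unfolding M_def
    by (subst Bochner_Integration.integral_add; (intro Bochner_Integration.integrable_add integrable_mult_right D2 ip(1) iq(1) i0)?)+
      (use L in \<open>simp add: N_def\<close>)
  also have "\<dots> \<le> 2 * H * N + 2 * N * H * 1 + 2 * N * H * 1 + \<kappa> * N * L"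
    by (intro add_mono order_refl mult_left_mono ip(2) iq(2)) (use H N_nonneg in auto)
  finally have MI: "integral\<^sup>L lborel M \<le> N * (6 * H + \<kappa> * L)" by (simp add: algebra_simps)
  have ptm: "(\<lambda>(x, y). pt x y) \<in> lborel \<Otimes>\<^sub>M lborel \<rightarrow>\<^sub>M borel" by (rule pt_measurable)
  have "(\<integral>\<^sup>+z. ?F z \<partial>lborel) = (\<integral>\<^sup>+z. ?F z \<partial>distr (lborel \<Otimes>\<^sub>M lborel) borel (\<lambda>(x, y). pt x y))"
    by (simp only: distr_pt)
  also have "\<dots> = (\<integral>\<^sup>+q. ?F (pt (fst q) (snd q)) \<partial>(lborel \<Otimes>\<^sub>M lborel))"
    by (subst nn_integral_distr[OF ptm]) (use Fm in \<open>simp_all add: case_prod_beta'\<close>)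
  also have "\<dots> = (\<integral>\<^sup>+x. (\<integral>\<^sup>+y. ?F (pt x y) \<partial>lborel) \<partial>lborel)"
    using lborel.nn_integral_fst[OF measurable_compose[OF ptm Fm], symmetric] by (simp add: case_prod_beta')
  also have "\<dots> \<le> (\<integral>\<^sup>+x. ennreal (M x) \<partial>lborel)" by (intro nn_integral_mono slice)
  also have "\<dots> = ennreal (integral\<^sup>L lborel M)" by (rule nn_integral_eq_integral[OF Mi]) (simp add: M0)
  also have "\<dots> \<le> ennreal (N * (6 * H + \<kappa> * L))" using MI by (rule ennreal_leI)
  finally show ?thesis .
qed

end

section \<open>Integration by parts on slices of the triangle\<close>

context extension_profile
begin

lemma \<phi>_bounded: "\<bar>\<phi> x\<bar> \<le> sqrt (L * N)"
proof (cases "0 < x \<and> x < L")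
  case True
  have "(\<phi> x)\<^sup>2 \<le> x * N" using \<phi>_square_le True by simp
  also have "\<dots> \<le> L * N" using True N_nonneg by (intro mult_right_mono) auto
  finally show ?thesis by (rule real_le_rsqrt[of "\<bar>\<phi> x\<bar>", simplified])
next
  case False
  then have "\<phi> x = 0" using \<phi>_out by simp
  then show ?thesis using L N_nonneg by simp
qed

lemma v_bounded: "z \<in> interior \<Delta> \<Longrightarrow> \<bar>v z\<bar> \<le> sqrt (L * N)"
proof (cases "X z \<in> {0<..<L}")
  case True
  assume z: "z \<in> interior \<Delta>"
  then have y: "0 < Y z" "Y z * \<sigma> (X z) < 1" using interior_strip_iff[of z] True by auto
  moreover have "\<sigma> (X z) > 0" using \<sigma>_pos True by simp
  ultimately have "\<bar>1 - Y z * \<sigma> (X z)\<bar> \<le> 1" by (simp add: abs_le_iff)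
  then have "\<bar>v z\<bar> \<le> \<bar>\<phi> (X z)\<bar> * 1" unfolding v_def abs_mult by (intro mult_left_mono) auto
  then show ?thesis using \<phi>_bounded[of "X z"] by linarith
next
  case False
  then show ?thesis using outside_strip[of z] L N_nonneg by simp
qed

lemma finite_measure_interior: "emeasure lborel (interior \<Delta>) < \<infinity>"
  using compact_triangle bounded_subset[OF compact_imp_bounded interior_subset]
  by (intro emeasure_bounded_finite) auto

lemma integrable_on_triangle:
  fixes F :: "real^2 \<Rightarrow> real"
  assumes "F \<in> borel_measurable borel" "\<And>z. z \<in> interior \<Delta> \<Longrightarrow> \<bar>F z\<bar> \<le> B"
  shows "integrable lborel (\<lambda>z. indicator (interior \<Delta>) z * F z)"
proof (rule Bochner_Integration.integrable_bound)
  show "integrable lborel (\<lambda>z. B * indicat_real (interior \<Delta>) z)"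
    using finite_measure_interior by (intro integrable_mult_right integrable_real_indicator) auto
  show "AE z in lborel. norm (indicator (interior \<Delta>) z * F z) \<le> norm (B * indicat_real (interior \<Delta>) z)"
    using assms(2) by (intro AE_I2) (auto split: split_indicator intro: order.trans[OF _ abs_ge_self])
qed (use assms(1) in measurable)

lemma G_square_integrable:
  shows "integrable lborel (\<lambda>z. indicator (interior \<Delta>) z * (norm (G z))\<^sup>2)"
    and "p \<le> \<kappa> * H \<Longrightarrow> L - p \<le> \<kappa> * H \<Longrightarrow>
      (\<integral>z. indicator (interior \<Delta>) z * (norm (G z))\<^sup>2 \<partial>lborel) \<le> N * (6 * H + \<kappa> * L)"
proof -
  have m: "(\<lambda>z. indicator (interior \<Delta>) z * (norm (G z))\<^sup>2) \<in> borel_measurable lborel" by simp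
  define \<kappa>0 where "\<kappa>0 = max (p / H) ((L - p) / H)"
  have "p \<le> \<kappa>0 * H" "L - p \<le> \<kappa>0 * H"
    using mult_right_mono[of "p / H" \<kappa>0 H] mult_right_mono[of "(L - p) / H" \<kappa>0 H] H by (auto simp: \<kappa>0_def)
  from nn_integral_G[OF this] show i: "integrable lborel (\<lambda>z. indicator (interior \<Delta>) z * (norm (G z))\<^sup>2)"
    by (intro integrableI_nonneg m) (auto intro: le_less_trans)
  assume \<kappa>: "p \<le> \<kappa> * H" "L - p \<le> \<kappa> * H"
  have "\<kappa> * H \<ge> 0" using \<kappa> L by linarith
  then have "\<kappa> \<ge> 0" using H by (simp add: zero_le_mult_iff)
  then have "N * (6 * H + \<kappa> * L) \<ge> 0" using N_nonneg H L by simp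
  then show "(\<integral>z. indicator (interior \<Delta>) z * (norm (G z))\<^sup>2 \<partial>lborel) \<le> N * (6 * H + \<kappa> * L)"
    using nn_integral_G[OF \<kappa>] nn_integral_eq_integral[OF i] by (simp add: ennreal_le_iff)
qed

text \<open>On a vertical slice \<open>v\<close> is affine in \<open>y\<close> and vanishes at the top, and the test function
  vanishes at the bottom.\<close>

lemma slice_y:
  fixes \<Psi> \<Psi>' :: "real \<Rightarrow> real"
  assumes x: "0 < x" "x < L"
    and der: "\<And>y. (\<Psi> has_real_derivative \<Psi>' y) (at y)" and cont: "continuous_on UNIV \<Psi>'"
    and supp: "\<And>y. pt x y \<notin> interior \<Delta> \<Longrightarrow> \<Psi> y = 0"
  shows "(\<integral>y. indicator (interior \<Delta>) (pt x y) * (v (pt x y) * \<Psi>' y + gy (pt x y) * \<Psi> y) \<partial>lborel) = 0"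
proof -
  let ?t = "1 / \<sigma> x"
  have s: "\<sigma> x > 0" using \<sigma>_pos x .
  define q where "q y = \<phi> x * ((1 - y * \<sigma> x) * \<Psi> y)" for y
  define q' where "q' y = \<phi> x * ((1 - y * \<sigma> x) * \<Psi>' y - \<sigma> x * \<Psi> y)" for y
  have "(q has_real_derivative q' y) (at y)" for y
    unfolding q_def q'_def by (auto intro!: derivative_eq_intros der simp: algebra_simps)
  moreover have c\<Psi>: "continuous_on UNIV \<Psi>"
    using DERIV_continuous[OF der] by (simp add: continuous_on_eq_continuous_at)
  then have "continuous_on UNIV q'" unfolding q'_def by (intro continuous_intros cont)
  ultimately have "(\<integral>y. q' y * indicator {0..?t} y \<partial>lborel) = q ?t - q 0"
    using s by (intro integral_FTC_Icc_real) (auto intro: continuous_on_interior[of UNIV])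
  also have "q ?t = 0" using s by (simp add: q_def)
  also have "q 0 = 0" using supp[of 0] by (simp add: q_def interior_triangle)
  finally have 0: "(\<integral>y. q' y * indicator {0..?t} y \<partial>lborel) = 0" by simp
  have "(\<integral>y. indicator (interior \<Delta>) (pt x y) * (v (pt x y) * \<Psi>' y + gy (pt x y) * \<Psi> y) \<partial>lborel)
      = (\<integral>y. q' y * indicator {0..?t} y \<partial>lborel)"
  proof (rule integral_cong_AE)
    have "AE y in lborel. y \<noteq> 0 \<and> y \<noteq> ?t"
      using AE_lborel_singleton[of 0] AE_lborel_singleton[of ?t] by auto
    then show "AE y in lborel. indicator (interior \<Delta>) (pt x y) * (v (pt x y) * \<Psi>' y + gy (pt x y) * \<Psi> y)
       = q' y * indicator {0..?t} y"
    proof eventually_elim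
      case (elim y)
      have "pt x y \<in> interior \<Delta> \<longleftrightarrow> y \<in> {0..?t}"
        using interior_strip_iff[of "pt x y"] x s elim by (auto simp: field_simps)
      then show ?case by (auto simp: v_def gy_def q'_def algebra_simps split: split_indicator)
    qed
    have [measurable]: "\<Psi> \<in> borel_measurable borel" "\<Psi>' \<in> borel_measurable borel"
      using cont c\<Psi> by (auto intro: borel_measurable_continuous_onI)
    show "(\<lambda>y. q' y * indicator {0..?t} y) \<in> borel_measurable lborel" unfolding q'_def by measurable
    show "(\<lambda>y. indicator (interior \<Delta>) (pt x y) * (v (pt x y) * \<Psi>' y + gy (pt x y) * \<Psi> y)) \<in> borel_measurable lborel"
      by measurable
  qed
  then show ?thesis using 0 by simp
qed

text \<open>The hypotheses keep the interval away from the end points of the base at which the height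
  vanishes.\<close>

lemma \<sigma>_continuous:
  assumes "0 \<le> \<alpha>" "\<beta> \<le> L" "0 < p \<Longrightarrow> 0 < \<alpha>" "p < L \<Longrightarrow> \<beta> < L"
  shows "continuous_on {\<alpha>..\<beta>} \<sigma>"
proof -
  have 1: "continuous_on S (\<lambda>x. p / (H * x))" if "\<And>x. x \<in> S \<Longrightarrow> 0 < x" for S
    using that H by (intro continuous_intros) force
  have 2: "continuous_on S (\<lambda>x. (L - p) / (H * (L - x)))" if "\<And>x. x \<in> S \<Longrightarrow> x < L" for S
    using that H by (intro continuous_intros) force
  consider "p \<le> 0" | "L \<le> p" | "0 < p" "p < L" by linarith
  then show ?thesis
  proof cases
    case 1
    then have "continuous_on {\<alpha>..\<beta>} (\<lambda>x. (L - p) / (H * (L - x)))" using assms L by (intro 2) auto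
    then show ?thesis using 1 by (simp add: \<sigma>_def inv_height_def[abs_def])
  next
    case 2
    then have "continuous_on {\<alpha>..\<beta>} (\<lambda>x. p / (H * x))" using assms L by (intro 1) auto
    moreover have "\<sigma> x = p / (H * x)" if "x \<in> {\<alpha>..\<beta>}" for x
      using that 2 assms L by (simp add: \<sigma>_def inv_height_def)
    ultimately show ?thesis by (simp cong: continuous_on_cong_simp)
  next
    case 3
    have "continuous_on {\<alpha>..\<beta>} (\<lambda>x. if x \<le> p then p / (H * x) else (L - p) / (H * (L - x)))"
      by (rule continuous_on_cases_le) (use 3 assms H in \<open>auto intro!: 1 2 continuous_on_id\<close>)
    then show ?thesis using 3 by (simp add: \<sigma>_def inv_height_def[abs_def])
  qed
qed

lemma \<sigma>_derivative:
  assumes "x \<noteq> p" "0 < x" "x < L"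
  shows "(\<sigma> has_real_derivative \<sigma>' x) (at x)"
proof (cases "0 < p \<and> x \<le> p")
  case True
  have "((\<lambda>x. p / (H * x)) has_real_derivative \<sigma>' x) (at x)"
    using True assms H by (auto intro!: derivative_eq_intros simp: \<sigma>'_def power2_eq_square)
  then show ?thesis
    by (rule has_field_derivative_transform_within_open[of _ _ _ "{..<p}"])
      (use True assms in \<open>auto simp: \<sigma>_def inv_height_def\<close>)
next
  case False
  have "((\<lambda>x. (L - p) / (H * (L - x))) has_real_derivative \<sigma>' x) (at x)"
    using assms H by (auto intro!: derivative_eq_intros simp: \<sigma>'_def if_not_P[OF False] power2_eq_square)
  then show ?thesis
    by (rule has_field_derivative_transform_within_open[of _ _ _ "{max 0 p<..}"])
      (use False assms in \<open>auto simp: \<sigma>_def inv_height_def\<close>)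
qed

text \<open>On a horizontal slice at height \<open>y\<close> the distance of \<open>x\<close> from an end of the base at which the
  height vanishes is at least proportional to \<open>y\<close>, so \<open>\<sigma>'\<close> is bounded on the slice.\<close>

lemma \<sigma>'_bound:
  assumes y: "0 < y" and x: "0 < x" "x < L" "p * y < H * x" "(L - p) * y < H * (L - x)"
  shows "\<bar>y * \<sigma>' x\<bar> \<le> H / (\<bar>p\<bar> * y) + H / (\<bar>L - p\<bar> * y)"
proof -
  have gen: "y * (r / (H * d\<^sup>2)) \<le> H / (r * y)" if "0 < r" "0 < d" "r * y < H * d" for r d
  proof -
    have "(r * y)\<^sup>2 \<le> (H * d)\<^sup>2" using that y by (intro power_mono) auto
    then show ?thesis using that y H by (simp add: divide_simps power2_eq_square mult_ac)
  qed
  show ?thesis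
  proof (cases "0 < p \<and> x \<le> p")
    case True
    then have "\<bar>y * \<sigma>' x\<bar> = y * (p / (H * x\<^sup>2))" using y H by (simp add: \<sigma>'_def abs_mult)
    also have "\<dots> \<le> H / (p * y)" using gen[of p x] True x by simp
    finally show ?thesis using True y H by (simp add: add_increasing2)
  next
    case False
    then have pL: "0 < L - p" using x by auto
    then have "\<bar>y * \<sigma>' x\<bar> = y * ((L - p) / (H * (L - x)\<^sup>2))"
      using y H by (simp add: \<sigma>'_def if_not_P[OF False] abs_mult)
    also have "\<dots> \<le> H / ((L - p) * y)" using gen[of "L - p" "L - x"] pL x by simp
    finally show ?thesis using pL y H by (simp add: add_increasing)
  qed
qed

text \<open>The part above the base of the horizontal slice at height \<open>y\<close> is an interval \<open>(\<alpha>, \<beta>)\<close>. At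
  each of its ends either \<open>\<phi>\<close> vanishes, because that end lies above an end of the base, or the
  test function does, because it lies on a side of the triangle.\<close>

lemma slice_x:
  fixes \<Psi> \<Psi>' :: "real \<Rightarrow> real"
  assumes der: "\<And>x. (\<Psi> has_real_derivative \<Psi>' x) (at x)" and cont: "continuous_on UNIV \<Psi>'"
    and supp: "\<And>x. pt x y \<notin> interior \<Delta> \<Longrightarrow> \<Psi> x = 0"
  shows "(\<integral>x. indicator (interior \<Delta>) (pt x y) * (v (pt x y) * \<Psi>' x + gx (pt x y) * \<Psi> x) \<partial>lborel) = 0"
proof (cases "0 < y")
  case True
  define \<alpha> where "\<alpha> = max 0 (p * y / H)"
  define \<beta> where "\<beta> = min L (L - (L - p) * y / H)"
  have in_iff: "pt x y \<in> interior \<Delta> \<longleftrightarrow> \<alpha> < x \<and> x < \<beta>" if "0 < x" "x < L" for x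
    using True H that by (auto simp: interior_triangle \<alpha>_def \<beta>_def field_simps)
  have out: "v (pt x y) = 0 \<and> gx (pt x y) = 0" if "\<not> (0 < x \<and> x < L)" for x
    using outside_strip[of "pt x y"] that by auto
  show ?thesis
  proof (cases "\<alpha> < \<beta>")
    case \<alpha>\<beta>: True
    define q where "q x = (1 - y * \<sigma> x) * \<Psi> x" for x
    define q' where "q' x = (1 - y * \<sigma> x) * \<Psi>' x - y * \<sigma>' x * \<Psi> x" for x
    have c\<Psi>: "continuous_on UNIV \<Psi>"
      using DERIV_continuous[OF der] by (simp add: continuous_on_eq_continuous_at)
    have rng: "0 \<le> \<alpha>" "\<beta> \<le> L" by (simp_all add: \<alpha>_def \<beta>_def)
    have c\<sigma>: "continuous_on {\<alpha>..\<beta>} \<sigma>"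
    proof (rule \<sigma>_continuous[OF rng])
      assume "0 < p"
      then have "p * y / H > 0" using True H by simp
      then show "0 < \<alpha>" by (simp add: \<alpha>_def)
    next
      assume "p < L"
      then have "(L - p) * y / H > 0" using True H by simp
      then show "\<beta> < L" by (simp add: \<beta>_def)
    qed
    have [measurable]: "\<Psi> \<in> borel_measurable borel" "\<Psi>' \<in> borel_measurable borel"
      using cont c\<Psi> by (auto intro: borel_measurable_continuous_onI)
    obtain M where M: "\<And>x. x \<in> {\<alpha>..\<beta>} \<Longrightarrow> \<bar>\<Psi> x\<bar> \<le> M"
      using compact_imp_bounded[OF compact_continuous_image[OF continuous_on_subset[OF c\<Psi>] compact_Icc]]
      by (force simp: bounded_iff)
    obtain M' where M': "\<And>x. x \<in> {\<alpha>..\<beta>} \<Longrightarrow> \<bar>\<Psi>' x\<bar> \<le> M'"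
      using compact_imp_bounded[OF compact_continuous_image[OF continuous_on_subset[OF cont] compact_Icc]]
      by (force simp: bounded_iff)
    define B where "B = H / (\<bar>p\<bar> * y) + H / (\<bar>L - p\<bar> * y)"
    have "(\<integral>x. indicator {\<alpha><..<\<beta>} x * (\<phi> x * q' x + D x * q x) \<partial>lborel) = \<phi> \<beta> * q \<beta> - \<phi> \<alpha> * q \<alpha>"
    proof (rule integral_weak_ibp[where S = "{p}" and B = "1 * M' + B * M"])
      show "\<phi> x = \<phi> \<alpha> + (\<integral>t. indicator {\<alpha><..<x} t * D t \<partial>lborel)" if "x \<in> {\<alpha>..\<beta>}" for x
        using \<phi>_diff[of \<alpha> x] rng that by simp
      show "continuous_on {\<alpha>..\<beta>} q" unfolding q_def
        by (intro continuous_intros c\<sigma> continuous_on_subset[OF c\<Psi>]) simp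
      show "(q has_real_derivative q' x) (at x)" if "x \<in> {\<alpha><..<\<beta>} - {p}" for x
        unfolding q_def q'_def using that rng
        by (auto intro!: derivative_eq_intros der \<sigma>_derivative simp: algebra_simps)
      show "q' \<in> borel_measurable borel" unfolding q'_def by measurable
      show "\<bar>q' x\<bar> \<le> 1 * M' + B * M" if x: "x \<in> {\<alpha><..<\<beta>}" for x
      proof -
        have x0: "0 < x" "x < L" using x rng by auto
        then have "pt x y \<in> interior \<Delta>" using in_iff x by simp
        then have "y * \<sigma> x < 1" "p * y < H * x" "(L - p) * y < H * (L - x)"
          using interior_strip_iff[of "pt x y"] x0 by (simp_all add: interior_triangle)
        moreover have "0 < y * \<sigma> x" using True \<sigma>_pos x0 by simp
        ultimately have "\<bar>1 - y * \<sigma> x\<bar> \<le> 1" "\<bar>y * \<sigma>' x\<bar> \<le> B"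
          using \<sigma>'_bound[OF True x0] by (simp_all add: B_def abs_le_iff)
        moreover have "\<bar>\<Psi> x\<bar> \<le> M" "\<bar>\<Psi>' x\<bar> \<le> M'" using M M' x by auto
        ultimately have "\<bar>(1 - y * \<sigma> x) * \<Psi>' x\<bar> \<le> 1 * M'" "\<bar>y * \<sigma>' x * \<Psi> x\<bar> \<le> B * M"
          unfolding abs_mult[of "1 - y * \<sigma> x"] abs_mult[of "y * \<sigma>' x"] by (intro mult_mono; force)+
        then show ?thesis unfolding q'_def by linarith
      qed
    qed (use \<alpha>\<beta> D_integrable in auto)
    also have "\<phi> \<beta> * q \<beta> = 0"
    proof (cases "\<beta> = L")
      case False
      then have "\<beta> = L - (L - p) * y / H" by (auto simp: \<beta>_def min_def split: if_splits)
      then have "pt \<beta> y \<notin> interior \<Delta>" using H by (simp add: interior_triangle)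
      then show ?thesis using supp by (simp add: q_def)
    qed (simp add: \<phi>_out)
    also have "\<phi> \<alpha> * q \<alpha> = 0"
    proof (cases "\<alpha> = 0")
      case False
      then have "\<alpha> = p * y / H" by (auto simp: \<alpha>_def max_def split: if_splits)
      then have "pt \<alpha> y \<notin> interior \<Delta>" using H by (simp add: interior_triangle)
      then show ?thesis using supp by (simp add: q_def)
    qed (simp add: \<phi>_out)
    also have "(\<lambda>x. indicator {\<alpha><..<\<beta>} x * (\<phi> x * q' x + D x * q x))
      = (\<lambda>x. indicator (interior \<Delta>) (pt x y) * (v (pt x y) * \<Psi>' x + gx (pt x y) * \<Psi> x))"
    proof
      fix x
      show "indicator {\<alpha><..<\<beta>} x * (\<phi> x * q' x + D x * q x)
        = indicator (interior \<Delta>) (pt x y) * (v (pt x y) * \<Psi>' x + gx (pt x y) * \<Psi> x)"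
      proof (cases "0 < x \<and> x < L")
        case True
        then show ?thesis using in_iff[of x]
          by (auto simp: v_def gx_def q_def q'_def algebra_simps split: split_indicator)
      next
        case False
        then have "x \<notin> {\<alpha><..<\<beta>}" using rng by auto
        then show ?thesis using out[OF False] by simp
      qed
    qed
    finally show ?thesis by simp
  next
    case False
    then have "indicator (interior \<Delta>) (pt x y) * (v (pt x y) * \<Psi>' x + gx (pt x y) * \<Psi> x) = 0" for x
      using in_iff[of x] out[of x] by (cases "0 < x \<and> x < L") (auto split: split_indicator)
    then show ?thesis by (simp only: Bochner_Integration.integral_zero)
  qed
next
  case False
  then have "pt x y \<notin> interior \<Delta>" for x by (simp add: interior_triangle)
  then show ?thesis by simp
qed

end

section \<open>The weak gradient on the triangle\<close>

lemma test_function_derivative: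
  assumes "test_function S \<psi>"
  shows "(\<psi> has_derivative frechet_derivative \<psi> (at z)) (at z)"
    and "continuous_on A (\<lambda>z. frechet_derivative \<psi> (at z) w)"
    and "z \<notin> S \<Longrightarrow> \<psi> z = 0"
proof -
  have "C_times (Suc 0) \<psi>" using assms unfolding test_function_def smooth_def by blast
  then have d: "\<psi> differentiable (at z)" "continuous_on UNIV (\<lambda>z. frechet_derivative \<psi> (at z) w)" for z w
    by simp_all
  from d(1) show "(\<psi> has_derivative frechet_derivative \<psi> (at z)) (at z)"
    by (simp add: frechet_derivative_works)
  from d(2) show "continuous_on A (\<lambda>z. frechet_derivative \<psi> (at z) w)"
    by (rule continuous_on_subset) simp
  show "\<psi> z = 0" if "z \<notin> S"
  proof (rule ccontr)
    assume "\<psi> z \<noteq> 0"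
    then have "z \<in> closure {x. \<psi> x \<noteq> 0}"
      using closure_subset[of "{x. \<psi> x \<noteq> 0}"] by auto
    moreover have "closure {x. \<psi> x \<noteq> 0} \<subseteq> S" using assms unfolding test_function_def by blast
    ultimately show False using that by blast
  qed
qed

context triangle_frame
begin

lemma frontier_off_base:
  assumes "z \<in> frontier \<Delta>" "Y z \<noteq> 0"
  shows "z \<in> open_segment (pt 0 0) (pt p H) \<union> open_segment (pt L 0) (pt p H) \<union> {pt p H}"
proof -
  have z: "z \<in> \<Delta>" "z \<notin> interior \<Delta>" using assms by (auto simp: frontier_triangle)
  then have Y: "0 < Y z" "p * Y z \<le> H * X z" "(L - p) * Y z \<le> H * (L - X z)"
    using assms(2) by (auto simp: triangle_eq)
  have "L * Y z \<le> L * H" using Y(2,3) by (simp add: algebra_simps)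
  then have YH: "Y z \<le> H" using L by simp
  have side: "z \<in> open_segment (pt q 0) (pt p H) \<union> {pt p H}"
    if q: "X z = q + (Y z / H) * (p - q)" "pt q 0 \<noteq> pt p H" for q
  proof -
    have mix: "pt (q + \<tau> * (p - q)) (\<tau> * H) = (1 - \<tau>) *\<^sub>R pt q 0 + \<tau> *\<^sub>R pt p H" for \<tau>
      by (simp add: pt_def algebra_simps)
    have "z = pt (q + (Y z / H) * (p - q)) ((Y z / H) * H)"
      using q H by (intro XY_eqI) simp_all
    also note mix
    finally have eq: "z = (1 - Y z / H) *\<^sub>R pt q 0 + (Y z / H) *\<^sub>R pt p H" .
    show ?thesis
    proof (cases "Y z = H")
      case True
      then show ?thesis using eq H by simp
    next
      case False
      then have "0 < Y z / H" "Y z / H < 1" using Y YH H by simp_all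
      with eq q(2) have "z \<in> open_segment (pt q 0) (pt p H)"
        unfolding in_segment by (intro conjI exI[of _ "Y z / H"])
      then show ?thesis by simp
    qed
  qed
  have ne: "pt q 0 \<noteq> pt p H" for q using H Y_pt by (metis less_irrefl)
  from z Y have "p * Y z = H * X z \<or> (L - p) * Y z = H * (L - X z)"
    by (auto simp: interior_triangle)
  then show ?thesis
  proof
    assume "p * Y z = H * X z"
    then have "X z = 0 + (Y z / H) * (p - 0)" using H by (simp add: field_simps)
    from side[OF this ne] show ?thesis by auto
  next
    assume "(L - p) * Y z = H * (L - X z)"
    then have "X z = L + (Y z / H) * (p - L)" using H by (simp add: field_simps)
    from side[OF this ne] show ?thesis by auto
  qed
qed

lemma integrable_pt:
  fixes F :: "real^2 \<Rightarrow> real"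
  assumes "integrable lborel F"
  shows "integrable (lborel \<Otimes>\<^sub>M lborel) (\<lambda>(x, y). F (pt x y))"
    and "integral\<^sup>L lborel F = (\<integral>(x, y). F (pt x y) \<partial>(lborel \<Otimes>\<^sub>M lborel))"
proof -
  have Fm: "F \<in> borel_measurable borel" using assms by simp
  have "integrable (distr (lborel \<Otimes>\<^sub>M lborel) borel (\<lambda>(x, y). pt x y)) F"
    using assms by (simp only: distr_pt)
  then show "integrable (lborel \<Otimes>\<^sub>M lborel) (\<lambda>(x, y). F (pt x y))"
    by (subst (asm) integrable_distr_eq[OF pt_measurable Fm]) (simp add: case_prod_beta')
  have "integral\<^sup>L lborel F = integral\<^sup>L (distr (lborel \<Otimes>\<^sub>M lborel) borel (\<lambda>(x, y). pt x y)) F"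
    by (simp only: distr_pt)
  also have "\<dots> = (\<integral>(x, y). F (pt x y) \<partial>(lborel \<Otimes>\<^sub>M lborel))"
    by (subst integral_distr[OF pt_measurable Fm]) (simp add: case_prod_beta')
  finally show "integral\<^sup>L lborel F = (\<integral>(x, y). F (pt x y) \<partial>(lborel \<Otimes>\<^sub>M lborel))" .
qed

end

context extension_profile
begin

lemma G_component_integrable:
  assumes "\<And>z. \<bar>g z\<bar> \<le> norm (G z)" and [measurable]: "g \<in> borel_measurable borel" "\<psi> \<in> borel_measurable borel"
    and \<psi>: "\<And>z. z \<in> interior \<Delta> \<Longrightarrow> \<bar>\<psi> z\<bar> \<le> B"
  shows "integrable lborel (\<lambda>z. indicator (interior \<Delta>) z * (g z * \<psi> z))"
proof (rule Bochner_Integration.integrable_bound)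
  have "integrable lborel (\<lambda>z. indicat_real (interior \<Delta>) z + indicator (interior \<Delta>) z * (norm (G z))\<^sup>2)"
    using finite_measure_interior G_square_integrable(1)
    by (intro Bochner_Integration.integrable_add integrable_real_indicator) auto
  then show "integrable lborel (\<lambda>z. B * (indicat_real (interior \<Delta>) z + indicator (interior \<Delta>) z * (norm (G z))\<^sup>2))"
    by (rule integrable_mult_right)
  show "AE z in lborel. norm (indicator (interior \<Delta>) z * (g z * \<psi> z))
      \<le> norm (B * (indicat_real (interior \<Delta>) z + indicator (interior \<Delta>) z * (norm (G z))\<^sup>2))"
  proof (intro AE_I2)
    fix z
    show "norm (indicator (interior \<Delta>) z * (g z * \<psi> z))
      \<le> norm (B * (indicat_real (interior \<Delta>) z + indicator (interior \<Delta>) z * (norm (G z))\<^sup>2))"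
    proof (cases "z \<in> interior \<Delta>")
      case True
      have "norm (G z) \<le> 1 + (norm (G z))\<^sup>2"
        using zero_le_power2[of "norm (G z) - 1"] norm_ge_zero[of "G z"] by (simp add: power2_diff del: norm_ge_zero)
      then have "\<bar>g z\<bar> * \<bar>\<psi> z\<bar> \<le> (1 + (norm (G z))\<^sup>2) * B"
        using assms(1)[of z] \<psi>[OF True] by (intro mult_mono) auto
      moreover have "B \<ge> 0" using \<psi>[OF True] by linarith
      ultimately show ?thesis using True by (simp add: abs_mult mult.commute)
    qed simp
  qed
qed measurable

lemma abs_gx_le: "\<bar>gx z\<bar> \<le> norm (G z)" and abs_gy_le: "\<bar>gy z\<bar> \<le> norm (G z)"
  using norm_G[of z] abs_le_square_iff[of "gx z" "norm (G z)"] abs_le_square_iff[of "gy z" "norm (G z)"]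
  by simp_all

text \<open>The integrand of the difference of the two sides is a combination of \<open>Fx\<close> and \<open>Fy\<close>, one for
  each frame vector. Their integrals vanish by Fubini, \<open>Fx\<close> slice by slice in the \<open>x\<close>
  direction and \<open>Fy\<close> in the \<open>y\<close> direction.\<close>

lemma weak_gradient:
  assumes test: "test_function (interior \<Delta>) \<psi>"
  shows "(\<integral>z. v z * frechet_derivative \<psi> (at z) w \<partial>lebesgue_on (interior \<Delta>))
    = - (\<integral>z. (G z \<bullet> w) * \<psi> z \<partial>lebesgue_on (interior \<Delta>))"
proof -
  define d where "d w z = frechet_derivative \<psi> (at z) w" for w z
  note D\<psi> = test_function_derivative(1)[OF test]
  have d_cont: "continuous_on A (d w)" for A w
    using test_function_derivative(2)[OF test, of A w] by (simp add: d_def[abs_def])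
  have \<psi>_cont: "continuous_on A \<psi>" for A
    using D\<psi> by (intro differentiable_imp_continuous_on)
      (auto simp: differentiable_on_def differentiable_def intro: has_derivative_at_withinI)
  have supp: "z \<notin> interior \<Delta> \<Longrightarrow> \<psi> z = 0" for z
    by (rule test_function_derivative(3)[OF test])
  have [measurable]: "d w \<in> borel_measurable borel" "\<psi> \<in> borel_measurable borel" for w
    using d_cont \<psi>_cont by (auto intro: borel_measurable_continuous_onI)
  have bounded: "\<exists>B. \<forall>z\<in>interior \<Delta>. \<bar>f z\<bar> \<le> B" if "continuous_on \<Delta> f" for f :: "real^2 \<Rightarrow> real"
    using compact_imp_bounded[OF compact_continuous_image[OF that compact_triangle]] interior_subset[of \<Delta>]
    by (force simp: bounded_iff)
  have lin: "d w z = (w \<bullet> e1) * d e1 z + (w \<bullet> e2) * d e2 z" for z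
  proof -
    have "linear (frechet_derivative \<psi> (at z))" using D\<psi> by (rule has_derivative_linear)
    then have "frechet_derivative \<psi> (at z) ((w \<bullet> e1) *\<^sub>R e1 + (w \<bullet> e2) *\<^sub>R e2)
       = (w \<bullet> e1) * d e1 z + (w \<bullet> e2) * d e2 z"
      by (simp add: linear_add linear_scale d_def)
    then show ?thesis using basis_expansion[of w] by (simp add: d_def)
  qed
  have Gw: "G z \<bullet> w = (w \<bullet> e1) * gx z + (w \<bullet> e2) * gy z" for z
    by (simp add: G_def inner_simps inner_commute)
  have v_int: "integrable lborel (\<lambda>z. indicator (interior \<Delta>) z * (v z * d w z))" for w
  proof -
    obtain B where B: "\<And>z. z \<in> interior \<Delta> \<Longrightarrow> \<bar>d w z\<bar> \<le> B" using bounded[OF d_cont] by blast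
    show ?thesis
    proof (rule integrable_on_triangle)
      show "\<bar>v z * d w z\<bar> \<le> sqrt (L * N) * B" if "z \<in> interior \<Delta>" for z
        unfolding abs_mult using v_bounded[OF that] B[OF that] L N_nonneg by (intro mult_mono) auto
    qed measurable
  qed
  obtain B where B: "\<And>z. z \<in> interior \<Delta> \<Longrightarrow> \<bar>\<psi> z\<bar> \<le> B" using bounded[OF \<psi>_cont] by blast
  have gx_int: "integrable lborel (\<lambda>z. indicator (interior \<Delta>) z * (gx z * \<psi> z))"
    by (rule G_component_integrable[OF abs_gx_le _ _ B]) measurable
  have gy_int: "integrable lborel (\<lambda>z. indicator (interior \<Delta>) z * (gy z * \<psi> z))"
    by (rule G_component_integrable[OF abs_gy_le _ _ B]) measurable
  define Fx where "Fx z = indicator (interior \<Delta>) z * (v z * d e1 z + gx z * \<psi> z)" for z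
  define Fy where "Fy z = indicator (interior \<Delta>) z * (v z * d e2 z + gy z * \<psi> z)" for z
  have Fx_int: "integrable lborel Fx" and Fy_int: "integrable lborel Fy"
    unfolding Fx_def Fy_def distrib_left using v_int gx_int gy_int by simp_all
  have chain: "((\<lambda>t. \<psi> (\<gamma> t)) has_real_derivative d u (\<gamma> t)) (at t)"
    if "(\<gamma> has_derivative (\<lambda>h. h *\<^sub>R u)) (at t)" for \<gamma> :: "real \<Rightarrow> real^2" and u t
  proof -
    have "((\<lambda>t. \<psi> (\<gamma> t)) has_derivative (\<lambda>h. frechet_derivative \<psi> (at (\<gamma> t)) (h *\<^sub>R u))) (at t)"
      by (rule has_derivative_compose[OF that D\<psi>])
    moreover have "frechet_derivative \<psi> (at (\<gamma> t)) (h *\<^sub>R u) = d u (\<gamma> t) * h" for h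
      using linear_scale[OF has_derivative_linear[OF D\<psi>[of "\<gamma> t"]], of h u] by (simp add: d_def mult.commute)
    ultimately show ?thesis by (simp add: has_field_derivative_def)
  qed
  have pt_cont: "continuous_on UNIV (\<lambda>t. pt t y)" "continuous_on UNIV (\<lambda>t. pt x t)" for x y
    unfolding pt_def by (intro continuous_intros)+
  have inner_x: "(\<integral>x. Fx (pt x y) \<partial>lborel) = 0" for y
    unfolding Fx_def
  proof (rule slice_x)
    show "((\<lambda>x. \<psi> (pt x y)) has_real_derivative d e1 (pt x y)) (at x)" for x
      by (rule chain) (auto simp: pt_def intro!: derivative_eq_intros)
    show "continuous_on UNIV (\<lambda>x. d e1 (pt x y))"
      by (rule continuous_on_compose2[OF d_cont[of UNIV] pt_cont(1)]) simp
  qed (rule supp)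
  have "(\<integral>z. Fx z \<partial>lborel) = (\<integral>y. (\<integral>x. Fx (pt x y) \<partial>lborel) \<partial>lborel)"
    using integrable_pt[OF Fx_int] by (simp add: lborel_pair.integral_snd)
  also have "\<dots> = 0" by (simp only: inner_x) simp
  finally have Fx0: "(\<integral>z. Fx z \<partial>lborel) = 0" .
  have inner_y: "(\<integral>y. Fy (pt x y) \<partial>lborel) = 0" for x
  proof (cases "0 < x \<and> x < L")
    case True
    show ?thesis
      unfolding Fy_def
    proof (rule slice_y)
      show "((\<lambda>y. \<psi> (pt x y)) has_real_derivative d e2 (pt x y)) (at y)" for y
        by (rule chain) (auto simp: pt_def intro!: derivative_eq_intros)
      show "continuous_on UNIV (\<lambda>y. d e2 (pt x y))"
        by (rule continuous_on_compose2[OF d_cont[of UNIV] pt_cont(2)]) simp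
    qed (use True supp in auto)
  next
    case False
    then have "Fy (pt x y) = 0" for y using outside_strip[of "pt x y"] by (simp add: Fy_def)
    then show ?thesis by simp
  qed
  have "(\<integral>z. Fy z \<partial>lborel) = (\<integral>x. (\<integral>y. Fy (pt x y) \<partial>lborel) \<partial>lborel)"
    using integrable_pt[OF Fy_int] lborel_pair.integral_fst'[of "\<lambda>(x, y). Fy (pt x y)"] by simp
  also have "\<dots> = 0" by (simp only: inner_y) simp
  finally have Fy0: "(\<integral>z. Fy z \<partial>lborel) = 0" .
  have G_int: "integrable lborel (\<lambda>z. indicator (interior \<Delta>) z * ((G z \<bullet> w) * \<psi> z))"
  proof -
    have "integrable lborel (\<lambda>z. (w \<bullet> e1) * (indicator (interior \<Delta>) z * (gx z * \<psi> z))
        + (w \<bullet> e2) * (indicator (interior \<Delta>) z * (gy z * \<psi> z)))"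
      by (intro Bochner_Integration.integrable_add integrable_mult_right gx_int gy_int)
    then show ?thesis unfolding Gw by (simp add: algebra_simps)
  qed
  have "(\<integral>z. indicator (interior \<Delta>) z * (v z * d w z) \<partial>lborel) + (\<integral>z. indicator (interior \<Delta>) z * ((G z \<bullet> w) * \<psi> z) \<partial>lborel)
     = (\<integral>z. indicator (interior \<Delta>) z * (v z * d w z) + indicator (interior \<Delta>) z * ((G z \<bullet> w) * \<psi> z) \<partial>lborel)"
    by (rule Bochner_Integration.integral_add[OF v_int G_int, symmetric])
  also have "\<dots> = (\<integral>z. (w \<bullet> e1) * Fx z + (w \<bullet> e2) * Fy z \<partial>lborel)"
    by (simp add: lin Gw Fx_def Fy_def algebra_simps)
  also have "\<dots> = 0"
    using Fx_int Fy_int Fx0 Fy0 by simp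
  finally show ?thesis
    unfolding d_def[symmetric] by (simp add: lebesgue_on_borel_integral)
qed

lemma has_H1_gradient_extension:
  assumes "\<And>z. z \<in> interior \<Delta> \<Longrightarrow> f z = v z"
  shows "has_H1_gradient (interior \<Delta>) f G"
proof -
  have sub: "h \<in> borel_measurable (lebesgue_on (interior \<Delta>))" if "h \<in> borel_measurable borel"
    for h :: "real^2 \<Rightarrow> 'b::euclidean_space"
    using that by (intro measurable_restrict_space1 measurable_completion) simp
  have sp: "space (lebesgue_on (interior \<Delta>)) = interior \<Delta>" by simp
  have "integrable lborel (\<lambda>z. indicator (interior \<Delta>) z * (norm (v z))\<^sup>2)"
  proof (rule integrable_on_triangle)
    show "\<bar>(norm (v z))\<^sup>2\<bar> \<le> (sqrt (L * N))\<^sup>2" if "z \<in> interior \<Delta>" for z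
      using power_mono[OF v_bounded[OF that], of 2] by simp
  qed measurable
  then have "integrable (lebesgue_on (interior \<Delta>)) (\<lambda>z. (norm (v z))\<^sup>2)"
    by (subst lebesgue_on_borel_integral) simp_all
  then have "in_L2 (interior \<Delta>) v" using sub[OF v_measurable] by (simp add: in_L2_def)
  moreover have "in_L2 (interior \<Delta>) f \<longleftrightarrow> in_L2 (interior \<Delta>) v"
    unfolding in_L2_def using assms
    by (intro conj_cong measurable_cong Bochner_Integration.integrable_cong) auto
  moreover have "integrable (lebesgue_on (interior \<Delta>)) (\<lambda>z. (norm (G z))\<^sup>2)"
    using G_square_integrable(1) by (subst lebesgue_on_borel_integral) simp_all
  then have "in_L2 (interior \<Delta>) G" using sub[OF G_measurable] by (simp add: in_L2_def)
  moreover have "(\<integral>z. f z * frechet_derivative \<psi> (at z) w \<partial>lebesgue_on (interior \<Delta>))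
     = (\<integral>z. v z * frechet_derivative \<psi> (at z) w \<partial>lebesgue_on (interior \<Delta>))" for \<psi> w
    by (rule Bochner_Integration.integral_cong) (use assms in auto)
  ultimately show ?thesis
    unfolding has_H1_gradient_def using weak_gradient by simp
qed

lemma L2_norm_G_le:
  assumes "p \<le> \<kappa> * H" "L - p \<le> \<kappa> * H"
  shows "L2_nrm (interior \<Delta>) G \<le> sqrt (N * (6 * H + \<kappa> * L))"
  unfolding L2_nrm_def using G_square_integrable(2)[OF assms]
  by (subst lebesgue_on_borel_integral) simp_all

end

section \<open>The estimate on a boundary triangle\<close>

text \<open>Weak derivatives are only Lebesgue measurable. Passing to a Borel representative that
  vanishes outside the interval makes them usable in integrals over the plane.\<close>

lemma weak_derivative_difference:
  fixes g gh dg dgh :: "real \<Rightarrow> real"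
  assumes g: "has_H1_gradient {0<..<L} g dg" "continuous_on {0..L} g"
    and gh: "has_H1_gradient {0<..<L} gh dgh" "continuous_on {0..L} gh"
  obtains D where "D \<in> borel_measurable borel" "integrable lborel (\<lambda>x. (D x)\<^sup>2)"
    "\<forall>x. x \<notin> {0<..<L} \<longrightarrow> D x = 0"
    "(\<integral>x. (D x)\<^sup>2 \<partial>lborel) = (L2_nrm {0<..<L} (\<lambda>t. dg t - dgh t))\<^sup>2"
    "\<forall>s t. 0 \<le> s \<longrightarrow> s \<le> t \<longrightarrow> t \<le> L \<longrightarrow>
      (g t - gh t) - (g s - gh s) = (\<integral>x. indicator {s<..<t} x * D x \<partial>lborel)"
proof -
  define S where "S = {0<..<L}"
  have S: "S \<inter> space lebesgue \<in> sets lebesgue" by (simp add: S_def)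
  define d where "d x = dg x - dgh x" for x
  have L2: "in_L2 S dg" "in_L2 S dgh" using g gh by (simp_all add: has_H1_gradient_def S_def)
  have dm: "d \<in> borel_measurable (lebesgue_on S)" unfolding d_def using L2 by (intro borel_measurable_diff) (simp_all add: in_L2_def)
  have d2: "integrable (lebesgue_on S) (\<lambda>x. (d x)\<^sup>2)"
  proof (rule Bochner_Integration.integrable_bound)
    show "integrable (lebesgue_on S) (\<lambda>x. 2 * (norm (dg x))\<^sup>2 + 2 * (norm (dgh x))\<^sup>2)"
      using L2 by (intro Bochner_Integration.integrable_add integrable_mult_right) (auto simp: in_L2_def)
    have "(A - B)\<^sup>2 \<le> 2 * A\<^sup>2 + 2 * B\<^sup>2" for A B :: real
      using zero_le_power2[of "A + B"] by (simp add: power2_eq_square algebra_simps)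
    then show "AE x in lebesgue_on S. norm ((d x)\<^sup>2) \<le> norm (2 * (norm (dg x))\<^sup>2 + 2 * (norm (dgh x))\<^sup>2)"
      by (intro AE_I2) (simp add: d_def)
  qed (use dm in measurable)
  have "(\<lambda>x. indicator S x *\<^sub>R d x) \<in> borel_measurable lebesgue"
    using dm borel_measurable_restrict_space_iff[OF S, of d] by simp
  then obtain D1 where D1[measurable]: "D1 \<in> borel_measurable lborel" and eq1: "AE x in lborel. indicator S x *\<^sub>R d x = D1 x"
    using completion_ex_borel_measurable_real by blast
  define D where "D x = indicator S x * D1 x" for x
  have Dm[measurable]: "D \<in> borel_measurable borel" unfolding D_def S_def by measurable
  have eq: "AE x in lebesgue. indicator S x * d x = D x"
    using AE_completion[OF eq1] by eventually_elim (auto simp: D_def split: split_indicator)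
  have m0: "(\<lambda>x. indicator S x * d x) \<in> borel_measurable lebesgue"
    using dm borel_measurable_restrict_space_iff[OF S, of d] by simp
  have m0b: "(\<lambda>x. indicator S x * (d x)\<^sup>2) \<in> borel_measurable lebesgue"
    using d2 by (simp add: integrable_restrict_space[OF S])
  have sub: "f \<in> borel_measurable lebesgue" if "f \<in> borel_measurable borel" for f :: "real \<Rightarrow> real"
    using that by (intro measurable_completion) simp
  have eq2: "AE x in lebesgue. indicator S x * (d x)\<^sup>2 = (D x)\<^sup>2"
    using eq by eventually_elim (auto simp: D_def split: split_indicator)
  have D2m: "(\<lambda>x. (D x)\<^sup>2) \<in> borel_measurable borel" by measurable
  have D2: "integrable lborel (\<lambda>x. (D x)\<^sup>2)"
  proof -
    have "integrable lebesgue (\<lambda>x. indicator S x * (d x)\<^sup>2)"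
      using d2 by (simp add: integrable_restrict_space[OF S])
    then have "integrable lebesgue (\<lambda>x. (D x)\<^sup>2)"
      using integrable_cong_AE[OF m0b sub[OF D2m] eq2] by simp
    then show ?thesis using D2m by (simp add: integrable_completion)
  qed
  have D2I: "(\<integral>x. (D x)\<^sup>2 \<partial>lborel) = (L2_nrm S (\<lambda>t. dg t - dgh t))\<^sup>2"
  proof -
    have "(\<integral>x. (D x)\<^sup>2 \<partial>lborel) = (\<integral>x. (D x)\<^sup>2 \<partial>lebesgue)" using D2m by (simp add: integral_completion)
    also have "\<dots> = (\<integral>x. indicator S x * (d x)\<^sup>2 \<partial>lebesgue)"
      by (rule integral_cong_AE[OF sub[OF D2m] m0b]) (use eq2 in \<open>auto elim: eventually_mono\<close>)
    also have "\<dots> = (\<integral>x. (d x)\<^sup>2 \<partial>lebesgue_on S)" by (simp add: integral_restrict_space[OF S])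
    finally show ?thesis by (simp add: L2_nrm_def d_def)
  qed
  have diff: "(g t - gh t) - (g s - gh s) = (\<integral>x. indicator {s<..<t} x * D x \<partial>lborel)"
    if st: "0 \<le> s" "s \<le> t" "t \<le> L" for s t
  proof -
    have i: "integrable (lebesgue_on S) (\<lambda>x. f x * indicator {s<..<t} x)" if "in_L2 S f" for f :: "real \<Rightarrow> real"
    proof (rule Bochner_Integration.integrable_bound)
      show "integrable (lebesgue_on S) f" using L2_imp_integrable that by (simp add: S_def)
      then have "f \<in> borel_measurable (lebesgue_on S)" by simp
      moreover have "indicat_real {s<..<t} \<in> borel_measurable (lebesgue_on S)"
        by (intro measurable_restrict_space1 sub) simp
      ultimately show "(\<lambda>x. f x * indicator {s<..<t} x) \<in> borel_measurable (lebesgue_on S)"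
        by (rule borel_measurable_times)
    qed (auto split: split_indicator)
    have "(g t - gh t) - (g s - gh s) = (g t - g s) - (gh t - gh s)" by simp
    also have "\<dots> = (\<integral>x. dg x * indicator {s<..<t} x - dgh x * indicator {s<..<t} x \<partial>lebesgue_on S)"
      using weak_derivative_FTC[OF g st] weak_derivative_FTC[OF gh st] i[OF L2(1)] i[OF L2(2)]
      by (simp add: S_def)
    also have "\<dots> = (\<integral>x. indicator S x * (dg x * indicator {s<..<t} x - dgh x * indicator {s<..<t} x) \<partial>lebesgue)"
      by (simp add: integral_restrict_space[OF S])
    also have "\<dots> = (\<integral>x. indicator {s<..<t} x * (indicator S x * d x) \<partial>lebesgue)"
      by (simp add: d_def algebra_simps)
    also have "\<dots> = (\<integral>x. indicator {s<..<t} x * D x \<partial>lebesgue)"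
    proof (rule integral_cong_AE)
      show "(\<lambda>x. indicator {s<..<t} x * (indicator S x * d x)) \<in> borel_measurable lebesgue"
        by (intro borel_measurable_times m0 sub) simp
      show "(\<lambda>x. indicator {s<..<t} x * D x) \<in> borel_measurable lebesgue" by (rule sub) simp
    qed (use eq in \<open>auto elim: eventually_mono\<close>)
    also have "\<dots> = (\<integral>x. indicator {s<..<t} x * D x \<partial>lborel)" by (rule integral_completion) simp
    finally show ?thesis .
  qed
  show thesis
    by (rule that[OF Dm D2]) (use D2I diff in \<open>auto simp: S_def D_def\<close>)
qed

lemma arclen_in_segment:
  assumes "a \<noteq> b" "0 \<le> t" "t \<le> dist a b"
  shows "arclen a b t \<in> closed_segment a b"
proof -
  have "arclen a b t = (1 - t / dist a b) *\<^sub>R a + (t / dist a b) *\<^sub>R b"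
    by (simp add: arclen_def algebra_simps)
  then show ?thesis unfolding in_segment using assms by (intro exI[of _ "t / dist a b"]) auto
qed

text \<open>All geometric data enter through the coordinates of the apex: the angles bound \<open>p\<close>, \<open>L - p\<close>
  and \<open>H\<close> in terms of \<open>k\<close>, and the mesh supplies the boundary values.\<close>

lemma linear_extension_gradient_bound:
  fixes \<Omega> :: "(real^2) set" and k \<theta> :: real
  assumes k: "0 < k" "k < 1" "k = cos \<theta>" "0 \<le> \<theta>"
    and dom: "polygonal_domain \<Omega>" and data: "obstacle_data \<Omega> f g \<psi>"
    and mesh: "conforming_mesh \<Omega> \<T>" and reg: "shape_regular \<theta> \<T>" and one: "at_most_one_boundary_edge \<Omega> \<T>"
    and interp: "boundary_interpolant \<Omega> \<T> g gh" and sol: "discrete_solution \<Omega> \<T> f \<psi> gh u"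
    and T: "T \<in> boundary_triangles \<Omega> \<T>" and e: "e \<in> boundary_edges \<Omega> \<T>" "e edge_of T"
    and e_eq: "e = closed_segment a b"
    and dg: "has_H1_gradient {0<..<dist a b} (\<lambda>t. g (arclen a b t)) dg"
    and dgh: "has_H1_gradient {0<..<dist a b} (\<lambda>t. gh (arclen a b t)) dgh"
  shows "\<exists>G. has_H1_gradient (interior T) (\<lambda>z. linear_extension T e (ustar \<Omega> g u) z - u z) G \<and>
     L2_nrm (interior T) G \<le> sqrt (6 / sqrt (2 * (1 - k)) + k / sqrt (1 - k\<^sup>2)) * sqrt (dist a b)
       * L2_nrm {0<..<dist a b} (\<lambda>t. dg t - dgh t)"
proof -
  have T': "T \<in> \<T>" using T by (simp add: boundary_triangles_def)
  have T2: "2 simplex T" using mesh T' by (simp add: conforming_mesh_def)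
  have ab: "a \<noteq> b" "a extreme_point_of T" "b extreme_point_of T"
    using edge_endpoints e(2) unfolding e_eq by blast+
  obtain c where c: "T = convex hull {a, b, c}" "\<not> affine_dependent {a, b, c}" "c \<noteq> a" "c \<noteq> b"
    using triangle_third_vertex[OF T2 ab(2,3,1)] by metis
  have c_ext: "c extreme_point_of T"
    unfolding c(1) using extreme_point_of_convex_hull_affine_independent[OF c(2)] by simp
  obtain e1 e2 p H where fr: "triangle_frame e1 e2 (dist a b) H" and
    pts: "plane_frame.pt a e1 e2 0 0 = a" "plane_frame.pt a e1 e2 (dist a b) 0 = b" "plane_frame.pt a e1 e2 p H = c"
    and ba: "b - a = dist a b *\<^sub>R e1"
    using triangle_frame_exists[OF c(2) ab(1) c(3,4)] by metis
  define L where "L = dist a b"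
  have e_front: "e \<subseteq> frontier \<Omega>" using e by (simp add: boundary_edges_def)
  have bv: "z \<in> frontier \<Omega> \<Longrightarrow> gh z = g z" if "z extreme_point_of T" for z
    using that T' interp by (auto simp: boundary_interpolant_def boundary_vertices_def mesh_vertices_def)
  have cont: "continuous_on {0..L} (\<lambda>t. w (arclen a b t))" if "continuous_on (frontier \<Omega>) w" for w :: "real^2 \<Rightarrow> real"
  proof (rule continuous_on_compose2[OF that])
    show "continuous_on {0..L} (arclen a b)" using ab(1)
      unfolding arclen_def[abs_def] by (intro continuous_intros) simp
    show "arclen a b ` {0..L} \<subseteq> frontier \<Omega>"
      using e_front arclen_in_segment[OF ab(1)] by (auto simp: e_eq L_def)
  qed
  have cg: "continuous_on {0..L} (\<lambda>t. g (arclen a b t))" using data by (intro cont) (simp add: obstacle_data_def)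
  have cgh: "continuous_on {0..L} (\<lambda>t. gh (arclen a b t))" using interp by (intro cont) (simp add: boundary_interpolant_def)
  define \<delta> where "\<delta> t = g (arclen a b t) - gh (arclen a b t)" for t
  obtain D where D: "D \<in> borel_measurable borel" "integrable lborel (\<lambda>x. (D x)\<^sup>2)"
    "\<forall>x. x \<notin> {0<..<L} \<longrightarrow> D x = 0"
    "(\<integral>x. (D x)\<^sup>2 \<partial>lborel) = (L2_nrm {0<..<L} (\<lambda>t. dg t - dgh t))\<^sup>2"
    "\<forall>s t. 0 \<le> s \<longrightarrow> s \<le> t \<longrightarrow> t \<le> L \<longrightarrow> \<delta> t - \<delta> s = (\<integral>x. indicator {s<..<t} x * D x \<partial>lborel)"
    by (rule weak_derivative_difference[OF dg[folded L_def] cg dgh[folded L_def] cgh, folded \<delta>_def])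
  have "a \<in> e" "b \<in> e" by (simp_all add: e_eq)
  then have ends: "\<delta> 0 = 0" "\<delta> L = 0"
    using bv[OF ab(2)] bv[OF ab(3)] e_front ab(1) by (auto simp: \<delta>_def arclen_def L_def)
  define \<phi> where "\<phi> x = indicator {0<..<L} x * \<delta> x" for x
  have \<phi>\<delta>: "\<phi> x = \<delta> x" if "0 \<le> x" "x \<le> L" for x
    using that ends by (cases "x = 0 \<or> x = L") (auto simp: \<phi>_def)
  have "continuous_on {0<..<L} \<delta>"
    unfolding \<delta>_def by (intro continuous_on_diff continuous_on_subset[OF cg] continuous_on_subset[OF cgh]) auto
  then have \<phi>m: "\<phi> \<in> borel_measurable borel"
    using borel_measurable_continuous_on_indicator[of "{0<..<L}" \<delta>] by (simp add: \<phi>_def[abs_def])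
  interpret triangle_frame a e1 e2 L p H by (rule fr[folded L_def])
  interpret extension_profile a e1 e2 L p H \<phi> D
  proof
    show "\<phi> t - \<phi> s = (\<integral>x. indicator {s<..<t} x * D x \<partial>lborel)" if "0 \<le> s" "s \<le> t" "t \<le> L" for s t
      using D(5)[rule_format, OF that] that by (simp add: \<phi>\<delta>)
    show "D x = 0" if "x \<notin> {0<..<L}" for x using D(3) that by blast
    show "\<phi> x = 0" if "x \<notin> {0<..<L}" for x using that by (simp add: \<phi>_def)
  qed (rule D(1) D(2) \<phi>m)+
  have T_eq: "T = \<Delta>" unfolding \<Delta>_def pts[folded L_def] by (rule c(1))
  have base: "e = base" unfolding base_def pts[folded L_def] by (rule e_eq)
  have u: "u \<in> fe_space \<Omega> \<T>" "\<And>z. z \<in> frontier \<Omega> \<Longrightarrow> u z = gh z"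
    using sol by (simp_all add: discrete_solution_def admissible_set_def)
  then obtain k0 d0 where aff: "\<And>z. z \<in> T \<Longrightarrow> u z = k0 + d0 \<bullet> z"
    using T' by (auto simp: fe_space_def affine_fun_on_def)
  have on: "ustar \<Omega> g u z - u z = \<phi> (X z)" if "z \<in> base" for z
  proof -
    have z: "Y z = 0" "0 \<le> X z" "X z \<le> L" using that by (simp_all add: base_eq)
    have "arclen a b (X z) = pt (X z) (Y z)"
      using ab(1) z(1) by (simp add: arclen_def ba pt_def)
    then have "arclen a b (X z) = z" by simp
    moreover have "z \<in> frontier \<Omega>" using that e_front by (auto simp: base)
    ultimately show ?thesis using z u(2) by (simp add: \<phi>\<delta> \<delta>_def ustar_def)
  qed
  have off: "ustar \<Omega> g u z = u z" if z: "z \<in> frontier \<Delta>" "Y z \<noteq> 0" for z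
  proof (cases "z \<in> frontier \<Omega>")
    case True
    have "(open_segment a c \<union> open_segment b c) \<inter> frontier \<Omega> = {}"
      using boundary_triangle_frontier[OF mesh dom one T' c(1,2) ab(1) c(3,4)] e(1) by (simp add: e_eq)
    then have "z = c"
      using frontier_off_base[OF z] True pts by (auto simp: L_def)
    then show ?thesis using True bv[OF c_ext] u(2) by (simp add: ustar_def)
  qed (simp add: ustar_def)
  have ext: "linear_extension T e (ustar \<Omega> g u) z - u z = v z" if "z \<in> interior \<Delta>" for z
    unfolding T_eq base v_def \<sigma>_def
    by (rule linear_extension_minus_affine[OF aff[unfolded T_eq] on off _ _ that])
      (simp_all add: \<phi>_out)
  have angle: "(y - x) \<bullet> (z - x) \<le> k * (norm (y - x) * norm (z - x))"
    if "x \<in> {a, b, c}" "y \<in> {a, b, c}" "z \<in> {a, b, c}" "x \<noteq> y" "y \<noteq> z" "x \<noteq> z" for x y z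
  proof -
    have "x extreme_point_of T" "y extreme_point_of T" "z extreme_point_of T"
      using that ab c_ext by auto
    then have "\<theta> \<le> angle_at x y z" using reg T' that unfolding shape_regular_def by blast
    then show ?thesis unfolding k(3) using k(4) that by (intro inner_le_of_angle) auto
  qed
  let ?\<kappa> = "k / sqrt (1 - k\<^sup>2)" and ?\<mu> = "1 / sqrt (2 * (1 - k))"
  have shape: "p \<le> ?\<kappa> * H" "L - p \<le> ?\<kappa> * H" "H \<le> L / sqrt (2 * (1 - k))"
    unfolding L_def by (rule shape_bounds[OF ab(1) c(3,4) fr pts(2,3) k(1,2)]; use ab c angle in auto)+
  let ?n = "L2_nrm {0<..<L} (\<lambda>t. dg t - dgh t)"
  have n0: "?n \<ge> 0" by (simp add: L2_nrm_def)
  have "L2_nrm (interior T) G \<le> sqrt (N * (6 * H + ?\<kappa> * L))"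
    unfolding T_eq by (rule L2_norm_G_le[OF shape(1,2)])
  also have "\<dots> \<le> sqrt (?n\<^sup>2 * ((6 * ?\<mu> + ?\<kappa>) * L))"
  proof -
    have "6 * H + ?\<kappa> * L \<le> (6 * ?\<mu> + ?\<kappa>) * L"
      using mult_left_mono[OF shape(3), of 6] by (simp add: algebra_simps)
    then show ?thesis unfolding N_def D(4) by (intro real_sqrt_le_mono mult_left_mono) auto
  qed
  also have "\<dots> = sqrt (6 / sqrt (2 * (1 - k)) + ?\<kappa>) * sqrt L * ?n"
    using n0 by (simp add: real_sqrt_mult mult_ac)
  finally have bound: "L2_nrm (interior T) G \<le> sqrt (6 / sqrt (2 * (1 - k)) + ?\<kappa>) * sqrt L * ?n" .
  have "has_H1_gradient (interior T) (\<lambda>z. linear_extension T e (ustar \<Omega> g u) z - u z) G"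
    unfolding T_eq by (rule has_H1_gradient_extension) (use ext[unfolded T_eq] in blast)
  then show ?thesis using bound unfolding L_def by blast
qed

theorem theorem3p2:
  fixes \<theta> :: real
  assumes "\<theta> > 0"
  shows "\<exists>C>0. \<forall>(\<Omega>::(real^2) set) f g \<psi> \<T> gh u T e a b dg dgh.
    polygonal_domain \<Omega> \<and> obstacle_data \<Omega> f g \<psi> \<and>
    conforming_mesh \<Omega> \<T> \<and> shape_regular \<theta> \<T> \<and> at_most_one_boundary_edge \<Omega> \<T> \<and>
    boundary_interpolant \<Omega> \<T> g gh \<and> discrete_solution \<Omega> \<T> f \<psi> gh u \<and>
    T \<in> boundary_triangles \<Omega> \<T> \<and> e \<in> boundary_edges \<Omega> \<T> \<and> e edge_of T \<and>
    e = closed_segment a b \<and>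
    has_H1_gradient {0<..<dist a b} (\<lambda>t. g (arclen a b t)) dg \<and>
    has_H1_gradient {0<..<dist a b} (\<lambda>t. gh (arclen a b t)) dgh \<longrightarrow>
    (\<exists>G. has_H1_gradient (interior T)
           (\<lambda>z. linear_extension T e (ustar \<Omega> g u) z - u z) G \<and>
         L2_nrm (interior T) G
           \<le> C * sqrt (dist a b) * L2_nrm {0<..<dist a b} (\<lambda>t. dg t - dgh t))"
proof -
  \<comment> \<open>Any value in \<open>(0, \<pi> / 2)\<close> would do instead of 1; it makes the cosine lie in \<open>(0, 1)\<close>.\<close>
  define \<theta>' where "\<theta>' = min \<theta> 1"
  define k where "k = cos \<theta>'"
  have \<theta>': "0 < \<theta>'" "\<theta>' \<le> 1" "\<theta>' \<le> \<theta>" using assms by (simp_all add: \<theta>'_def)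
  have k: "0 < k" "k < 1"
  proof -
    show "0 < k" unfolding k_def using \<theta>' pi_gt3 by (intro cos_gt_zero_pi) auto
    show "k < 1" unfolding k_def using \<theta>' pi_gt3 cos_monotone_0_pi[of 0 \<theta>'] by simp
  qed
  have reg: "shape_regular \<theta>' \<T>" if "shape_regular \<theta> \<T>" for \<T>
    unfolding shape_regular_def
  proof (intro ballI allI impI)
    fix T x y z
    assume "T \<in> \<T>" "x extreme_point_of T \<and> y extreme_point_of T \<and> z extreme_point_of T \<and> x \<noteq> y \<and> y \<noteq> z \<and> x \<noteq> z"
    then have "\<theta> \<le> angle_at x y z" using that unfolding shape_regular_def by blast
    then show "\<theta>' \<le> angle_at x y z" using \<theta>'(3) by linarith
  qed
  have k2: "k\<^sup>2 < 1" using k by (simp add: power_less_one_iff)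
  have "6 / sqrt (2 * (1 - k)) + k / sqrt (1 - k\<^sup>2) > 0"
    using k k2 by (intro add_pos_pos divide_pos_pos) auto
  then have "sqrt (6 / sqrt (2 * (1 - k)) + k / sqrt (1 - k\<^sup>2)) > 0" by simp
  moreover note linear_extension_gradient_bound[OF k k_def less_imp_le[OF \<theta>'(1)] _ _ _ reg]
  ultimately show ?thesis
    by (intro exI[of _ "sqrt (6 / sqrt (2 * (1 - k)) + k / sqrt (1 - k\<^sup>2))"] conjI allI impI; (elim conjE)?) blast+
qed

end
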